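(* Let $p,q\in(0,1)$. For each $n$ and each $i=1,\dots,n$, let $i$ be contained in $\Omega_n$ independently with probability $1-q$ and, also independently, let $i$ be included in $T_n$ with probability $1-p$. Then, as $n\to\infty$, the empirical distributions of the $\min(|T_n|,|\Omega_n|)$ largest singular values of $F_{\Omega_nT_n}$ and of $\mathcal{U}_{\Omega_nT_n}$ each converge almost surely to $$f^s_{p,q}(x)=\frac{\sqrt{x^2\left(1-\frac{(r^s_-)^2}{x^2}\right)\left(\frac{(r^s_+)^2}{x^2}-1\right)}}{\pi(1-x^2)(1-\max(p,q))}\cdot I_{(r^s_-,r^s_+)}(x)+\frac{\max(0,1-(p+q))}{1-\max(p,q)}\cdot\delta(x-1),$$ where $$r^s_-=\left|\sqrt{p(1-q)}-\sqrt{q(1-p)}\right|\quad\text{and}\quad r^s_+=\sqrt{p(1-q)}+\sqrt{q(1-p)}.$$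
   Context: $F_n$ is the $n\times n$ discrete Fourier transform (DFT) matrix, with entries $F_{jk}=\frac{1}{\sqrt n}e^{-2\pi i(j-1)(k-1)/n}$, $1\le j,k\le n$; it is unitary. $\mathcal{U}_n$ is a random $n\times n$ unitary matrix with Haar distribution, independent of $\Omega_n$ and $T_n$. For subsets $\Omega,T\subset\{1,\dots,n\}$, $F_{\Omega T}$ (respectively $\mathcal{U}_{\Omega T}$) is the matrix obtained from $F_n$ (respectively $\mathcal{U}_n$) by removing the rows with indices not in $\Omega$ and the columns with indices not in $T$; the notation $F_{\Omega_nT_n}$, $\mathcal{U}_{\Omega_nT_n}$ makes the original dimension $n$ explicit. The singular values of a matrix $B$ are the nonnegative square roots of the eigenvalues of $BB^*$, counted with multiplicity, where $*$ denotes conjugate transpose. The empirical distribution of real numbers $s_1,\dots,s_k$ is the probability measure $\frac1k\sum_{i=1}^k\delta_{s_i}$. $I_{(a,b)}$ is the indicator function of $(a,b)$ and $\delta(x-1)$ is the unit point mass at $1$; $f^s_{p,q}$ is identified with the probability measure it describes (absolutely continuous part plus point mass). Almost sure convergence means that, with all random objects for all $n$ defined on a common probability space, the random empirical measures converge weakly to the limit measure with probability one. *)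

theory Defs
  imports
    "HOL-Probability.Probability"
    "Jordan_Normal_Form.Schur_Decomposition"
    "Jordan_Normal_Form.DL_Submatrix"
begin

text \<open>
  All indices are shifted by one: matrices of size \<open>n\<close> and subsets of the index set are indexed by
  \<open>{..<n}\<close> instead of \<open>{1..n}\<close>, so \<open>(j - 1) (k - 1)\<close> in the Fourier matrix becomes \<open>j * k\<close>.
\<close>

definition dft_mat :: "nat \<Rightarrow> complex mat" where
  "dft_mat n = Matrix.mat n n (\<lambda>(j, k).
     complex_of_real (1 / sqrt (real n)) *
     exp (- (2 * complex_of_real pi * \<i> * of_nat j * of_nat k / of_nat n)))"

definition unitary_group :: "nat \<Rightarrow> complex mat set" where
  "unitary_group n =
     {A \<in> carrier_mat n n. A * mat_adjoint A = 1\<^sub>m n \<and> mat_adjoint A * A = 1\<^sub>m n}"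

text \<open>The Borel sigma-algebra of the unitary group, as a subspace of the space of
  \<open>n * n\<close> tuples of complex numbers.\<close>

definition unitary_space :: "nat \<Rightarrow> complex mat measure" where
  "unitary_space n = vimage_algebra (unitary_group n)
     (\<lambda>A. \<lambda>ij\<in>{..<n} \<times> {..<n}. A $$ ij) (\<Pi>\<^sub>M ij\<in>{..<n} \<times> {..<n}. borel)"

text \<open>The Haar measure of a compact group is its unique left invariant Borel probability measure.\<close>

definition haar_unitary :: "nat \<Rightarrow> complex mat measure \<Rightarrow> bool" where
  "haar_unitary n \<mu> \<longleftrightarrow>
     prob_space \<mu> \<and> sets \<mu> = sets (unitary_space n) \<and>
     (\<forall>V\<in>unitary_group n. distr \<mu> (unitary_space n) (\<lambda>A. V * A) = \<mu>)"

lemma space_unitary_space [simp]: "space (unitary_space n) = unitary_group n"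
  by (simp add: unitary_space_def)

lemma measurable_unitary_space_entry:
  assumes "i < n" "j < n"
  shows "(\<lambda>A. A $$ (i, j)) \<in> borel_measurable (unitary_space n)"
proof -
  let ?f = "\<lambda>A::complex mat. \<lambda>ij\<in>{..<n} \<times> {..<n}. A $$ ij"
  have "?f \<in> measurable (unitary_space n) (\<Pi>\<^sub>M ij\<in>{..<n} \<times> {..<n}. borel)"
    unfolding unitary_space_def by (rule measurable_vimage_algebra1) (auto simp: space_PiM)
  then have "(\<lambda>A. ?f A (i, j)) \<in> borel_measurable (unitary_space n)"
    by (rule measurable_compose) (use assms in \<open>auto intro!: measurable_component_singleton\<close>)
  then show ?thesis using assms by simp
qed

lemma mat_adjoint_carrier: "A \<in> carrier_mat m n \<Longrightarrow> mat_adjoint A \<in> carrier_mat n m"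
  unfolding mat_adjoint_def by auto

lemma mat_adjoint_index:
  "A \<in> carrier_mat m n \<Longrightarrow> i < n \<Longrightarrow> j < m \<Longrightarrow> mat_adjoint A $$ (i, j) = conjugate (A $$ (j, i))"
  unfolding mat_adjoint_def by (auto simp: mat_of_rows_def)

lemma mat_adjoint_mult:
  assumes A: "(A :: complex mat) \<in> carrier_mat n n" and B: "B \<in> carrier_mat n n"
  shows "mat_adjoint (A * B) = mat_adjoint B * mat_adjoint A"
proof (rule eq_matI)
  have AB: "A * B \<in> carrier_mat n n" using A B by simp
  fix i j assume "i < dim_row (mat_adjoint B * mat_adjoint A)"
    "j < dim_col (mat_adjoint B * mat_adjoint A)"
  then have ij: "i < n" "j < n"
    using mat_adjoint_carrier[OF A] mat_adjoint_carrier[OF B] by auto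
  have "mat_adjoint (A * B) $$ (i, j) = cnj (\<Sum>k = 0..<n. A $$ (j, k) * B $$ (k, i))"
    using A B ij by (simp add: mat_adjoint_index[OF AB] scalar_prod_def)
  also have "\<dots> = (\<Sum>k = 0..<n. mat_adjoint B $$ (i, k) * mat_adjoint A $$ (k, j))"
    using ij by (auto simp: mat_adjoint_index[OF A] mat_adjoint_index[OF B] mult.commute
        intro!: sum.cong)
  also have "\<dots> = (mat_adjoint B * mat_adjoint A) $$ (i, j)"
    using mat_adjoint_carrier[OF A] mat_adjoint_carrier[OF B] ij by (simp add: scalar_prod_def)
  finally show "mat_adjoint (A * B) $$ (i, j) = (mat_adjoint B * mat_adjoint A) $$ (i, j)" .
qed (use A B mat_adjoint_carrier[of "A * B" n n] mat_adjoint_carrier[OF A]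
      mat_adjoint_carrier[OF B] in auto)

lemma unitary_group_mult:
  assumes "V \<in> unitary_group n" "A \<in> unitary_group n"
  shows "V * A \<in> unitary_group n"
proof -
  have V: "V \<in> carrier_mat n n" "V * mat_adjoint V = 1\<^sub>m n" "mat_adjoint V * V = 1\<^sub>m n"
    and A: "A \<in> carrier_mat n n" "A * mat_adjoint A = 1\<^sub>m n" "mat_adjoint A * A = 1\<^sub>m n"
    using assms by (auto simp: unitary_group_def)
  note c = mat_adjoint_carrier[OF V(1)] mat_adjoint_carrier[OF A(1)]
  have "V * A * (mat_adjoint A * mat_adjoint V) = V * ((A * mat_adjoint A) * mat_adjoint V)"
    using V(1) A(1) c by (simp add: assoc_mult_mat[of _ n n _ n _ n])
  moreover have "mat_adjoint A * mat_adjoint V * (V * A) = mat_adjoint A * ((mat_adjoint V * V) * A)"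
    using V(1) A(1) c by (simp add: assoc_mult_mat[of _ n n _ n _ n])
  ultimately show ?thesis
    using V A c by (simp add: unitary_group_def mat_adjoint_mult[OF V(1) A(1)])
qed

lemma measurable_unitary_space_mult_left:
  assumes V: "V \<in> unitary_group n"
  shows "(\<lambda>A. V * A) \<in> measurable (unitary_space n) (unitary_space n)"
proof -
  have Vc: "V \<in> carrier_mat n n" using V by (simp add: unitary_group_def)
  have "(\<lambda>A. \<lambda>ij\<in>{..<n} \<times> {..<n}. (V * A) $$ ij)
      \<in> measurable (unitary_space n) (\<Pi>\<^sub>M ij\<in>{..<n} \<times> {..<n}. borel)"
  proof (rule measurable_restrict)
    fix ij assume "ij \<in> {..<n} \<times> {..<n}"
    then obtain i j where ij: "ij = (i, j)" "i < n" "j < n" by auto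
    have "(\<lambda>A. \<Sum>k = 0..<n. V $$ (i, k) * A $$ (k, j)) \<in> borel_measurable (unitary_space n)"
      using ij by (intro borel_measurable_sum borel_measurable_times
          measurable_unitary_space_entry) auto
    moreover have "(\<Sum>k = 0..<n. V $$ (i, k) * A $$ (k, j)) = (V * A) $$ ij"
      if "A \<in> space (unitary_space n)" for A
      using that ij Vc by (auto simp: unitary_group_def scalar_prod_def)
    ultimately show "(\<lambda>A. (V * A) $$ ij) \<in> borel_measurable (unitary_space n)"
      by (rule measurable_cong[THEN iffD1, rotated])
  qed
  then show ?thesis
    unfolding unitary_space_def[of n]
    by (intro measurable_vimage_algebra2)
       (auto simp: unitary_space_def[symmetric] unitary_group_mult[OF V])
qed

text \<open>Singular values in decreasing order; \<open>proots\<close> of the characteristic polynomial is the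
  multiset of eigenvalues with (algebraic) multiplicity. The eigenvalues of \<open>B * mat_adjoint B\<close>
  are nonnegative reals, so \<open>Re\<close> loses nothing.\<close>

definition singular_values :: "complex mat \<Rightarrow> real list" where
  "singular_values B = rev (sorted_list_of_multiset
     (image_mset (\<lambda>z. sqrt (Re z)) (proots (char_poly (B * mat_adjoint B)))))"

text \<open>For the empty list this is the zero measure.\<close>

definition empirical_distribution :: "real list \<Rightarrow> real measure" where
  "empirical_distribution xs = distr (uniform_count_measure {..<length xs}) borel (\<lambda>i. xs ! i)"

definition r_minus :: "real \<Rightarrow> real \<Rightarrow> real" where
  "r_minus p q = \<bar>sqrt (p * (1 - q)) - sqrt (q * (1 - p))\<bar>"

definition r_plus :: "real \<Rightarrow> real \<Rightarrow> real" where
  "r_plus p q = sqrt (p * (1 - q)) + sqrt (q * (1 - p))"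

definition fs_density :: "real \<Rightarrow> real \<Rightarrow> real \<Rightarrow> real" where
  "fs_density p q x =
     sqrt (x\<^sup>2 * (1 - (r_minus p q)\<^sup>2 / x\<^sup>2) * ((r_plus p q)\<^sup>2 / x\<^sup>2 - 1)) /
       (pi * (1 - x\<^sup>2) * (1 - max p q)) *
     indicator {r_minus p q<..<r_plus p q} x"

definition fs_atom :: "real \<Rightarrow> real \<Rightarrow> real" where
  "fs_atom p q = max 0 (1 - (p + q)) / (1 - max p q)"

definition fs_measure :: "real \<Rightarrow> real \<Rightarrow> real measure" where
  "fs_measure p q = measure_of UNIV (sets borel)
     (\<lambda>A. emeasure (density lborel (\<lambda>x. ennreal (fs_density p q x))) A
        + ennreal (fs_atom p q) * emeasure (return borel 1) A)"

lemma emeasure_fs_measure: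
  assumes A: "A \<in> sets borel"
  shows "emeasure (fs_measure p q) A =
    (\<integral>\<^sup>+x\<in>A. ennreal (fs_density p q x) \<partial>lborel) + ennreal (fs_atom p q) * indicator A 1"
proof -
  let ?D = "density lborel (\<lambda>x. ennreal (fs_density p q x))"
  let ?\<mu> = "\<lambda>A. emeasure ?D A + ennreal (fs_atom p q) * emeasure (return borel (1::real)) A"
  have [measurable]: "fs_density p q \<in> borel_measurable borel"
    unfolding fs_density_def by measurable
  have "countably_additive (sets borel) ?\<mu>"
  proof (rule countably_additiveI)
    fix F :: "nat \<Rightarrow> real set"
    assume F: "range F \<subseteq> sets borel" "disjoint_family F"
    have "(\<Sum>i. ?\<mu> (F i)) =
        (\<Sum>i. emeasure ?D (F i)) + ennreal (fs_atom p q) * (\<Sum>i. emeasure (return borel 1) (F i))"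
      by (subst suminf_add[symmetric]) auto
    also have "\<dots> = ?\<mu> (\<Union>i. F i)"
      using F suminf_emeasure[of F ?D] suminf_emeasure[of F "return borel 1"]
      by (simp del: emeasure_return)
    finally show "(\<Sum>i. ?\<mu> (F i)) = ?\<mu> (\<Union>i. F i)" .
  qed
  then have "emeasure (fs_measure p q) A = ?\<mu> A"
    using A sets.sigma_algebra_axioms[of "borel :: real measure"]
    by (intro emeasure_measure_of[OF fs_measure_def])
       (auto simp: positive_def fs_measure_def sets_measure_of_conv sets.sigma_sets_eq[of borel, simplified])
  then show ?thesis
    using A by (simp add: emeasure_density)
qed

end

theory Submission
  imports Defs
begin

text \<open>
  Put \<open>\<alpha> = 1 - q\<close>, \<open>\<beta> = 1 - p\<close>, and let \<open>V\<close> be \<open>F\<^sub>n\<close> or \<open>\<U>\<^sub>n\<close>, \<open>Q = diag 1\<^sub>\<Omega>\<close> and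
  \<open>P = V (diag 1\<^sub>T) V\<^sup>*\<close>. The element \<open>Z = 1 - (P - Q)\<^sup>2\<close> commutes with \<open>P\<close> and \<open>Q\<close>, and the
  product \<open>X = (Q - \<alpha>) (P - \<beta>)\<close> of the centred projections satisfies \<open>X\<^sup>2 = (Z - c) X - D\<close> with
  scalars \<open>c = \<alpha> + \<beta> - 2 \<alpha> \<beta>\<close> and \<open>D = \<alpha> \<beta> (1 - \<alpha>) (1 - \<beta>)\<close>. Hence, up to explicit multiples of
  \<open>|\<Omega>|\<close>, \<open>|T|\<close> and \<open>n\<close>, the trace of \<open>X\<^sup>k\<close> is the sum of a rescaled Chebyshev polynomial over the squared
  singular values.

  Expand \<open>tr X\<^sup>k\<close> in the diagonal entries of the two centred projections. These are independent and
  centred, so in the second moment only index tuples without a value of multiplicity one survive;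
  when all entries of \<open>V\<close> satisfy \<open>|V\<^sub>i\<^sub>j|\<^sup>2 \<le> (16 ln n + 1) / n\<close>, the expectation of \<open>|tr X\<^sup>k / n|\<^sup>2\<close> is
  \<open>O((ln n)\<^sup>2\<^sup>k / n\<^sup>2)\<close>, which is summable, and \<open>tr X\<^sup>k / n\<close> tends to \<open>0\<close> almost surely. The Fourier matrix is flat in this
  sense. A Haar unitary matrix is flat for all large \<open>n\<close> almost surely: by invariance it may be
  multiplied from the left by the Fourier matrix times a diagonal matrix of random signs, after which
  each entry is a Rademacher sum.

  The Chebyshev moments of the limit measure become Poisson kernel integrals under
  \<open>x\<^sup>2 = c - 2 \<surd>D cos t\<close>; the Weierstrass theorem passes from polynomials to continuous functions.
\<close>

section \<open>Two projections\<close>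

text \<open>On a generic two-dimensional block of \<open>P\<close> and \<open>Q\<close>, where
  \<open>Q * P * Q\<close> has the eigenvalue x, the element X has trace x - c and determinant D.
  The trace of its k-th power there is \<open>centered_cheb c D k x\<close>, the power sum of the
  two roots of L^2 - (x - c) L + D, with value 2 at k = 0. Centring is what makes the limits
  trivial: asymptotic freeness predicts that the normalised traces vanish for every k >= 1, so no
  moment of the limit law has to be found by combinatorics. The estimate is pure counting. The
  squared modulus of the trace contains 4 k entries of V, together of size n^(-2k) up to logarithms,
  while the surviving row words and column words number about n^k each. The powers of n cancel
  without any use of phases. Only the size of the entries matters, so the rigid Fourier matrix and
  the random Haar matrix share one argument. The objects for different n may depend on each other
  arbitrarily; almost sure convergence therefore rests on moments or tail probabilities that are
  summable over n.\<close>

fun centered_cheb :: "real \<Rightarrow> real \<Rightarrow> nat \<Rightarrow> real \<Rightarrow> real" where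
  "centered_cheb c D 0 x = 2"
| "centered_cheb c D (Suc 0) x = x - c"
| "centered_cheb c D (Suc (Suc k)) x = (x - c) * centered_cheb c D (Suc k) x - D * centered_cheb c D k x"

locale two_projections =
  fixes P Q :: "'a::real_algebra_1" and S :: "'a set" and tr :: "'a \<Rightarrow> complex"
  assumes P_idem: "P * P = P" and Q_idem: "Q * Q = Q"
    and P_in: "P \<in> S" and Q_in: "Q \<in> S" and one_in: "1 \<in> S"
    and add_in: "\<And>x y. x \<in> S \<Longrightarrow> y \<in> S \<Longrightarrow> x + y \<in> S"
    and mult_in: "\<And>x y. x \<in> S \<Longrightarrow> y \<in> S \<Longrightarrow> x * y \<in> S"
    and scaleR_in: "\<And>r x. x \<in> S \<Longrightarrow> r *\<^sub>R x \<in> S"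
    and tr_add: "\<And>x y. tr (x + y) = tr x + tr y"
    and tr_scaleR: "\<And>r x. tr (r *\<^sub>R x) = of_real r * tr x"
    and tr_commute: "\<And>x y. x \<in> S \<Longrightarrow> y \<in> S \<Longrightarrow> tr (x * y) = tr (y * x)"
begin

lemma diff_in: "x \<in> S \<Longrightarrow> y \<in> S \<Longrightarrow> x - y \<in> S"
  using add_in[of x "(-1) *\<^sub>R y"] scaleR_in[of y "-1"] by simp

lemma tr_diff: "tr (x - y) = tr x - tr y"
  using tr_add[of x "(-1) *\<^sub>R y"] tr_scaleR[of "-1" y] by simp

lemma power_in: "x \<in> S \<Longrightarrow> x ^ k \<in> S"
  by (induction k) (auto intro: one_in mult_in)

lemmas in_S = P_in Q_in one_in add_in mult_in scaleR_in diff_in power_in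

lemma P_idem_left: "P * (P * x) = P * x" and Q_idem_left: "Q * (Q * x) = Q * x"
  by (simp_all add: P_idem Q_idem flip: mult.assoc)

lemmas idems = P_idem Q_idem P_idem_left Q_idem_left

text \<open>\<open>R\<close> and \<open>C\<close> anticommute and \<open>R * R + C * C = 1\<close>,
  so both squares commute with \<open>R\<close> and \<open>C\<close>, hence with \<open>P\<close>
  and \<open>Q\<close>. On a two-dimensional block \<open>Z\<close> is the squared cosine of the
  angle between the two ranges.\<close>

definition "R = P - Q"
definition "C = 1 - P - Q"
definition "Z = 1 - R * R"

lemma R_in: "R \<in> S" and C_in: "C \<in> S" and Z_in: "Z \<in> S"
  unfolding Z_def R_def C_def by (auto intro!: in_S)

lemma C_square: "C * C = Z" and C_R: "C * R = - (R * C)"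
  unfolding Z_def R_def C_def by (simp_all add: algebra_simps idems)

lemma Z_Q: "Z * Q = Q * P * Q"
  unfolding Z_def R_def C_def by (simp add: algebra_simps idems)

lemma Z_commute_R: "Z * R = R * Z"
  unfolding Z_def by (simp add: algebra_simps)

lemma R_commute_Z_power: "R * Z ^ j = Z ^ j * R"
  using power_commuting_commutes[OF Z_commute_R, of j] by simp

lemma C_commute_Z_power: "C * Z ^ j = Z ^ j * C"
proof -
  have "Z * C = C * Z" by (simp add: mult.assoc flip: C_square)
  then show ?thesis using power_commuting_commutes[of Z C j] by simp
qed

lemma tr_minus: "tr (- x) = - tr x"
  using tr_scaleR[of "-1" x] by simp

lemma tr_Z_power_C: "tr (Z ^ j * C) = tr C"
proof (induction j)
  case (Suc j)
  have "R * (Z ^ j * C * R) = Z ^ j * (R * C) * R"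
    by (simp only: mult.assoc[symmetric] R_commute_Z_power)
  also have "\<dots> = - ((Z ^ j * C * R) * R)"
    unfolding C_R[THEN minus_equation_iff[THEN iffD1, OF sym], symmetric]
    by (simp add: mult.assoc)
  finally have "tr ((Z ^ j * C * R) * R) = - tr ((Z ^ j * C * R) * R)"
    using tr_commute[of "Z ^ j * C * R" R] by (simp add: in_S C_in R_in Z_in tr_minus)
  then have "tr ((Z ^ j * C * R) * R) = 0" by simp
  moreover have "Z ^ Suc j * C = Z ^ j * C - (Z ^ j * C * R) * R"
  proof -
    have "Z ^ Suc j * C = Z ^ j * (C * Z)"
      using C_commute_Z_power[of 1] by (simp add: power_Suc2 mult.assoc del: power_Suc)
    also have "\<dots> = Z ^ j * (C * (1 - R * R))" by (simp only: Z_def)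
    finally show ?thesis by (simp only: right_diff_distrib mult.assoc mult_1_right)
  qed
  ultimately show ?case using Suc by (simp only: tr_diff) simp
qed simp

text \<open>The same sign argument with \<open>C\<close> in the role of \<open>R\<close>: one factor
  \<open>Z\<close> is split as \<open>C * C\<close> and half of it is cycled past \<open>R\<close>.
  Without a factor \<open>Z\<close> there is nothing to split, and \<open>tr R\<close> is the
  difference of the two ranks.\<close>

lemma tr_Z_power_Suc_R: "tr (Z ^ Suc j * R) = 0"
proof -
  have "(Z ^ j * C) * (C * R) = Z ^ j * (C * C) * R"
    by (simp only: mult.assoc)
  then have 1: "(Z ^ j * C) * (C * R) = Z ^ Suc j * R"
    by (simp only: C_square power_Suc2)
  have "(C * R) * (Z ^ j * C) = C * (R * Z ^ j) * C" by (simp only: mult.assoc)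
  also have "\<dots> = (C * Z ^ j) * (R * C)" by (simp only: R_commute_Z_power mult.assoc)
  also have "\<dots> = Z ^ j * (C * (R * C))" by (simp only: C_commute_Z_power mult.assoc)
  also have "\<dots> = - (Z ^ j * (C * C) * R)"
    using C_R by (simp add: mult.assoc minus_equation_iff)
  finally have "(C * R) * (Z ^ j * C) = - (Z ^ Suc j * R)"
    by (simp only: C_square power_Suc2)
  then have "tr (Z ^ Suc j * R) = - tr (Z ^ Suc j * R)"
    using tr_commute[of "Z ^ j * C" "C * R"] unfolding 1
    by (simp add: in_S C_in R_in Z_in tr_minus del: power_Suc)
  then show ?thesis by simp
qed

lemma tr_Z_power_R: "tr (Z ^ j * R) = (if j = 0 then tr R else 0)"
proof (cases j)
  case (Suc i)
  show ?thesis unfolding Suc tr_Z_power_Suc_R by simp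
qed simp

lemma Z_power_Q: "Z ^ j * Q = (Q * P) ^ j * Q"
proof (induction j)
  case (Suc j)
  have "Z ^ Suc j * Q = Z ^ j * Q * (P * Q)"
    by (simp add: power_Suc2 mult.assoc Z_Q del: power_Suc)
  also have "\<dots> = (Q * P) ^ j * (Q * P) * Q"
    unfolding Suc by (simp add: mult.assoc)
  finally show ?case by (simp add: power_Suc2 del: power_Suc)
qed simp

text \<open>Power sums of the eigenvalues of \<open>Q * P * Q\<close> on the range of
  \<open>Q\<close>. The trailing \<open>Q\<close> makes the moment of order 0 the rank of
  \<open>Q\<close>, so that zero eigenvalues are counted.\<close>

definition mom :: "nat \<Rightarrow> complex" where "mom j = tr ((Q * P) ^ j * Q)"

lemma tr_Z_power: "tr (Z ^ j) = 2 * mom j + tr C + (if j = 0 then tr R else 0)"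
proof -
  \<comment> \<open>Multiplies \<open>Z ^ j\<close> by the decomposition 1 = 2 Q + C + R.\<close>
  have "Z ^ j = 2 *\<^sub>R (Z ^ j * Q) + Z ^ j * C + Z ^ j * R"
    by (simp add: C_def R_def algebra_simps scaleR_2)
  from arg_cong[where f = tr, OF this]
  have "tr (Z ^ j) = 2 * mom j + tr (Z ^ j * C) + tr (Z ^ j * R)"
    by (simp only: tr_add tr_scaleR of_real_numeral mom_def Z_power_Q)
  then show ?thesis
    by (simp only: tr_Z_power_C tr_Z_power_R)
qed

lemma tr_Z_power_QP: "tr (Z ^ j * (Q * P)) = mom (Suc j)"
proof -
  have *: "Z ^ j * (Q * P) = (Q * P) ^ Suc j"
    by (simp add: Z_power_Q power_Suc2 mult.assoc[symmetric] del: power_Suc)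
  have "tr ((Q * P) ^ Suc j) = tr (Q * (P * (Q * P) ^ j))"
    by (simp add: mult.assoc)
  also have "\<dots> = tr (Q * (Q * (P * (Q * P) ^ j)))"
    by (simp add: idems)
  also have "\<dots> = tr (Q * (P * (Q * P) ^ j) * Q)"
    by (intro tr_commute in_S)
  also have "\<dots> = mom (Suc j)"
    by (simp add: mom_def mult.assoc)
  finally show ?thesis using * by simp
qed

lemma tr_Z_power_P: "tr (Z ^ j * P) = mom j + (if j = 0 then tr R else 0)"
proof -
  have "Z ^ j * P = Z ^ j * Q + Z ^ j * R" by (simp add: R_def algebra_simps)
  then have "tr (Z ^ j * P) = mom j + tr (Z ^ j * R)" by (simp add: tr_add Z_power_Q mom_def)
  then show ?thesis by (simp only: tr_Z_power_R)
qed

definition "X \<alpha> \<beta> = (Q - \<alpha> *\<^sub>R 1) * (P - \<beta> *\<^sub>R 1)"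

lemma X_expand: "X \<alpha> \<beta> = Q * P - \<alpha> *\<^sub>R P - \<beta> *\<^sub>R Q + (\<alpha> * \<beta>) *\<^sub>R 1"
  unfolding X_def by (simp add: algebra_simps)

context
  fixes \<alpha> \<beta> c D :: real
  assumes c_def: "c = \<alpha> + \<beta> - 2 * \<alpha> * \<beta>" and D_def: "D = \<alpha> * \<beta> * (1 - \<alpha>) * (1 - \<beta>)"
begin

text \<open>Cayley-Hamilton on a two-dimensional block; \<open>D\<close> is the product of the
  determinants - \<alpha> (1 - \<alpha>) and - \<beta> (1 - \<beta>) of the two centred
  projections.\<close>

lemma X_square: "X \<alpha> \<beta> * X \<alpha> \<beta> = Z * X \<alpha> \<beta> - c *\<^sub>R X \<alpha> \<beta> - D *\<^sub>R 1"
proof -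
  have c: "c = \<alpha> + \<beta> - \<alpha> * \<beta> - \<alpha> * \<beta>" by (simp add: c_def)
  show ?thesis
    unfolding X_expand Z_def R_def c D_def
    by (simp add: algebra_simps idems)
       (simp only: mult_2_right distrib_left distrib_right scaleR_left_distrib ac_simps)
qed

text \<open>The power of \<open>Z\<close> is carried along because every use of
  \<open>X_square\<close> produces one. The sum over \<open>E\<close> treats each eigenvalue as
  belonging to a two-dimensional block; the corrections account for the one-dimensional blocks,
  where \<open>P\<close> and \<open>Q\<close> commute. \<open>tr C\<close> compares the common
  kernel with the common range, both at x = 1. \<open>tr R\<close> compares the two parts on which
  exactly one projection vanishes; there \<open>Z\<close> is 0, so they show up only for j =
  0.\<close>

lemma tr_Z_power_X_power:
  assumes E: "\<And>j. mom j = (\<Sum>x\<in>#E. of_real (x ^ j))"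
  shows "tr (Z ^ j * X \<alpha> \<beta> ^ k) = (\<Sum>x\<in>#E. of_real (x ^ j * centered_cheb c D k x))
     + of_real ((\<alpha> * \<beta>) ^ k) * tr C + (if j = 0 then of_real ((- \<alpha> * (1 - \<beta>)) ^ k) * tr R else 0)"
proof (induction k arbitrary: j rule: induct_nat_012)
  case 0
  have "2 * (\<Sum>x\<in>#E. complex_of_real (x ^ j)) = (\<Sum>x\<in>#E. of_real (x ^ j * 2))"
    by (induction E) (simp_all add: algebra_simps)
  then show ?case
    by (simp add: tr_Z_power E)
next
  case 1
  have "Z ^ j * X \<alpha> \<beta> = Z ^ j * (Q * P) - \<alpha> *\<^sub>R (Z ^ j * P) - \<beta> *\<^sub>R (Z ^ j * Q) + (\<alpha> * \<beta>) *\<^sub>R Z ^ j"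
    by (simp add: X_expand algebra_simps)
  from arg_cong[where f = tr, OF this]
  have "tr (Z ^ j * X \<alpha> \<beta>) = tr (Z ^ j * (Q * P)) - of_real \<alpha> * tr (Z ^ j * P)
      - of_real \<beta> * tr (Z ^ j * Q) + of_real (\<alpha> * \<beta>) * tr (Z ^ j)"
    by (simp only: tr_add tr_diff tr_scaleR)
  also have "tr (Z ^ j * Q) = mom j" by (simp only: Z_power_Q mom_def)
  also note tr_Z_power
  also note tr_Z_power_P
  also note tr_Z_power_QP
  also have "mom (Suc j) - of_real \<alpha> * (mom j + (if j = 0 then tr R else 0)) - of_real \<beta> * mom j
      + of_real (\<alpha> * \<beta>) * (2 * mom j + tr C + (if j = 0 then tr R else 0)) = (mom (Suc j) - of_real c * mom j) + of_real (\<alpha> * \<beta>) * tr C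
      + (if j = 0 then of_real (- \<alpha> * (1 - \<beta>)) * tr R else 0)"
    by (simp add: c_def algebra_simps)
  also have "mom (Suc j) - of_real c * mom j = (\<Sum>x\<in>#E. of_real (x ^ j * (x - c)))"
    unfolding E by (induction E) (simp_all add: algebra_simps)
  finally show ?case by simp
next
  case (ge2 k)
  have "Z ^ j * X \<alpha> \<beta> ^ Suc (Suc k) = Z ^ j * (X \<alpha> \<beta> * X \<alpha> \<beta>) * X \<alpha> \<beta> ^ k" by (simp add: mult.assoc)
  also have "\<dots> = Z ^ Suc j * X \<alpha> \<beta> ^ Suc k - c *\<^sub>R (Z ^ j * X \<alpha> \<beta> ^ Suc k) - D *\<^sub>R (Z ^ j * X \<alpha> \<beta> ^ k)"
    unfolding X_square
    by (simp only: power_Suc2[of Z] power_Suc[of "X \<alpha> \<beta>"] algebra_simps mult_scaleR_left mult_scaleR_right mult_1_right mult_1_left)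
  finally have "tr (Z ^ j * X \<alpha> \<beta> ^ Suc (Suc k)) = tr (Z ^ Suc j * X \<alpha> \<beta> ^ Suc k)
      - of_real c * tr (Z ^ j * X \<alpha> \<beta> ^ Suc k) - of_real D * tr (Z ^ j * X \<alpha> \<beta> ^ k)"
    by (simp only: tr_diff tr_scaleR)
  also have "\<dots> = (\<Sum>x\<in>#E. of_real (x ^ j * centered_cheb c D (Suc (Suc k)) x))
     + of_real ((\<alpha> * \<beta>) ^ Suc (Suc k)) * tr C
     + (if j = 0 then of_real ((- \<alpha> * (1 - \<beta>)) ^ Suc (Suc k)) * tr R else 0)"
  proof -
    define w where "w = \<alpha> * \<beta>"
    define v where "v = - \<alpha> * (1 - \<beta>)"
    \<comment> \<open>\<open>w\<close> and \<open>v\<close> solve the block equation L^2 = (x - c) L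
      - D at x = 1 and at x = 0, so both corrections obey the recursion of
      \<open>centered_cheb\<close>.\<close>
    have 1: "w ^ Suc (Suc k) = (1 - c) * w ^ Suc k - D * w ^ k"
    proof -
      have "w * w = (1 - c) * w - D" by (simp add: w_def c_def D_def algebra_simps)
      then have "w * w * w ^ k = ((1 - c) * w - D) * w ^ k" by simp
      then show ?thesis by (simp add: algebra_simps)
    qed
    have 2: "v ^ Suc (Suc k) = - c * v ^ Suc k - D * v ^ k"
    proof -
      have "v * v = - c * v - D" by (simp add: v_def c_def D_def algebra_simps)
      then have "v * v * v ^ k = (- c * v - D) * v ^ k" by simp
      then show ?thesis by (simp add: algebra_simps)
    qed
    have 3: "(\<Sum>x\<in>#E. complex_of_real (x ^ j * centered_cheb c D (Suc (Suc k)) x)) =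
       (\<Sum>x\<in>#E. of_real (x ^ Suc j * centered_cheb c D (Suc k) x))
        - of_real c * (\<Sum>x\<in>#E. of_real (x ^ j * centered_cheb c D (Suc k) x))
        - of_real D * (\<Sum>x\<in>#E. of_real (x ^ j * centered_cheb c D k x))"
      by (induction E) (simp_all add: algebra_simps)
    show ?thesis
      unfolding ge2.IH 3 w_def[symmetric] v_def[symmetric] 1 2
      by (auto simp: algebra_simps)
  qed
  finally show ?case .
qed

end

end

section \<open>Singular values of submatrices\<close>

text \<open>
  Matrices of every size \<open>n\<close> are embedded in one unital algebra, since \<^locale>\<open>two_projections\<close>
  needs a type. The unit is the identity on all sequences, hence the restriction to \<open>block_ops\<close>, on
  which \<open>op_trace n\<close> is a trace.
\<close>

typedef seq_op =
  "{f :: (nat \<Rightarrow> complex) \<Rightarrow> (nat \<Rightarrow> complex).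
     \<forall>a x y. f (\<lambda>i. a * x i + y i) = (\<lambda>i. a * f x i + f y i)}"
  by (rule exI[of _ "\<lambda>x. x"]) simp

setup_lifting type_definition_seq_op

instantiation seq_op :: real_algebra_1
begin

lift_definition zero_seq_op :: seq_op is "\<lambda>x i. 0" by simp
lift_definition one_seq_op :: seq_op is "\<lambda>x. x" by simp
lift_definition plus_seq_op :: "seq_op \<Rightarrow> seq_op \<Rightarrow> seq_op" is "\<lambda>f g x i. f x i + g x i"
  by (simp add: algebra_simps)
lift_definition minus_seq_op :: "seq_op \<Rightarrow> seq_op \<Rightarrow> seq_op" is "\<lambda>f g x i. f x i - g x i"
  by (simp add: algebra_simps)
lift_definition uminus_seq_op :: "seq_op \<Rightarrow> seq_op" is "\<lambda>f x i. - f x i"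
  by (simp add: algebra_simps)
lift_definition times_seq_op :: "seq_op \<Rightarrow> seq_op \<Rightarrow> seq_op" is "\<lambda>f g x. f (g x)"
  by simp
lift_definition scaleR_seq_op :: "real \<Rightarrow> seq_op \<Rightarrow> seq_op" is "\<lambda>r f x i. of_real r * f x i"
  by (simp add: algebra_simps)

instance
proof
  fix f g h :: seq_op and r s :: real
  show "f + g + h = f + (g + h)" "f + g = g + f" "0 + f = f" "- f + f = 0" "f - g = f + - g"
    by (transfer; simp add: algebra_simps)+
  show "f * g * h = f * (g * h)" "1 * f = f" "f * 1 = f" "(f + g) * h = f * h + g * h"
    by (transfer; simp)+
  show "f * (g + h) = f * g + f * h"
  proof transfer
    fix f g h :: "(nat \<Rightarrow> complex) \<Rightarrow> (nat \<Rightarrow> complex)"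
    assume f: "\<forall>a x y. f (\<lambda>i. a * x i + y i) = (\<lambda>i. a * f x i + f y i)"
    show "(\<lambda>x. f (\<lambda>i. g x i + h x i)) = (\<lambda>x i. f (g x) i + f (h x) i)"
      using f[rule_format, of 1] by simp
  qed
  show "r *\<^sub>R (f + g) = r *\<^sub>R f + r *\<^sub>R g" "(r + s) *\<^sub>R f = r *\<^sub>R f + s *\<^sub>R f"
    "r *\<^sub>R s *\<^sub>R f = (r * s) *\<^sub>R f" "1 *\<^sub>R f = f" "r *\<^sub>R f * g = r *\<^sub>R (f * g)"
    by (transfer; simp add: algebra_simps)+
  show "f * r *\<^sub>R g = r *\<^sub>R (f * g)"
  proof transfer
    fix f g :: "(nat \<Rightarrow> complex) \<Rightarrow> (nat \<Rightarrow> complex)" and r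
    assume f: "\<forall>a x y. f (\<lambda>i. a * x i + y i) = (\<lambda>i. a * f x i + f y i)"
    have "f (\<lambda>i. 0) = (\<lambda>i. 0)"
      using f[rule_format, of "-1" "\<lambda>i. 0" "\<lambda>i. 0"] by simp
    then show "(\<lambda>x. f (\<lambda>i. complex_of_real r * g x i)) = (\<lambda>x i. complex_of_real r * f (g x) i)"
      using f[rule_format, of "of_real r" _ "\<lambda>i. 0"] by simp
  qed
  show "(0 :: seq_op) \<noteq> 1"
    by transfer (auto simp: fun_eq_iff intro: exI[of _ "\<lambda>_. 1"])
qed

end

lift_definition entry :: "seq_op \<Rightarrow> nat \<Rightarrow> nat \<Rightarrow> complex" is
  "\<lambda>f i j. f (\<lambda>l. if l = j then 1 else 0) i" .

lemma entry_simps [simp]: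
  "entry 1 i j = of_bool (i = j)" "entry (f + g) i j = entry f i j + entry g i j"
  "entry (f - g) i j = entry f i j - entry g i j" "entry (r *\<^sub>R f) i j = of_real r * entry f i j"
  by (transfer; simp)+

definition op_trace :: "nat \<Rightarrow> seq_op \<Rightarrow> complex" where
  "op_trace n f = (\<Sum>i<n. entry f i i)"

text \<open>Invariance of the span of the first n basis vectors. Demanding zeros outside the n by n
  corner would exclude the unit.\<close>

definition block_ops :: "nat \<Rightarrow> seq_op set" where
  "block_ops n = {f. \<forall>j<n. \<forall>i\<ge>n. entry f i j = 0}"

text \<open>A linear map on all sequences is not determined by its entries. The formula holds
  because \<open>g\<close> sends the basis vector j into a finite span, where linearity of
  \<open>f\<close> suffices.\<close>

lemma entry_mult:
  assumes "g \<in> block_ops n" "j < n"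
  shows "entry (f * g) i j = (\<Sum>l<n. entry f i l * entry g l j)"
  using assms unfolding block_ops_def mem_Collect_eq
proof transfer
  fix f g :: "(nat \<Rightarrow> complex) \<Rightarrow> (nat \<Rightarrow> complex)" and n j i
  let ?e = "\<lambda>j l::nat. if l = j then 1 else 0 :: complex"
  assume f: "\<forall>a x y. f (\<lambda>i. a * x i + y i) = (\<lambda>i. a * f x i + f y i)"
    and g: "\<forall>j<n. \<forall>i\<ge>n. g (?e j) i = 0" and j: "j < n"
  have f0: "f (\<lambda>i. 0) = (\<lambda>i. 0)"
    using f[rule_format, of "-1" "\<lambda>i. 0" "\<lambda>i. 0"] by simp
  have sum: "f (\<lambda>i. \<Sum>l\<in>L. c l * x l i) = (\<lambda>i. \<Sum>l\<in>L. c l * f (x l) i)" if "finite L"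
    for L :: "nat set" and c x using that
    by (induction L) (simp_all add: f0 f)
  have "g (?e j) = (\<lambda>i. \<Sum>l<n. g (?e j) l * ?e l i)"
  proof
    fix i
    show "g (?e j) i = (\<Sum>l<n. g (?e j) l * ?e l i)"
      using g j by (cases "i < n") (auto simp: if_distrib[of "(*) _"] cong: if_cong)
  qed
  then have "f (g (?e j)) = f (\<lambda>i. \<Sum>l<n. g (?e j) l * ?e l i)" by (rule arg_cong)
  also have "\<dots> = (\<lambda>i. \<Sum>l<n. g (?e j) l * f (?e l) i)" by (rule sum) simp
  finally show "f (g (?e j)) i = (\<Sum>l<n. f (?e l) i * g (?e j) l)"
    by (simp add: mult.commute)
qed

lift_definition matrix_op :: "nat \<Rightarrow> (nat \<Rightarrow> nat \<Rightarrow> complex) \<Rightarrow> seq_op" is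
  "\<lambda>n F v i. if i < n then \<Sum>j<n. F i j * v j else 0"
  by (auto simp: fun_eq_iff algebra_simps sum.distrib sum_distrib_left)

lemma entry_matrix_op [simp]: "entry (matrix_op n F) i j = (if i < n \<and> j < n then F i j else 0)"
  by transfer (auto simp: if_distrib[of "(*) _"] cong: if_cong)

lemma matrix_op_in_block_ops [simp]: "matrix_op n F \<in> block_ops n"
  by (simp add: block_ops_def)

lemma matrix_op_mult: "matrix_op n F * matrix_op n G = matrix_op n (\<lambda>i j. \<Sum>l<n. F i l * G l j)"
proof transfer
  fix n and F G :: "nat \<Rightarrow> nat \<Rightarrow> complex"
  have "(\<Sum>j<n. F i j * (\<Sum>l<n. G j l * v l)) = (\<Sum>j<n. (\<Sum>l<n. F i l * G l j) * v j)" for v i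
    unfolding sum_distrib_left sum_distrib_right by (subst sum.swap) (simp add: mult.assoc)
  then show "(\<lambda>x i. if i < n then \<Sum>j<n. F i j * (if j < n then \<Sum>ja<n. G j ja * x ja else 0) else 0) =
       (\<lambda>v i. if i < n then \<Sum>j<n. (\<Sum>l<n. F i l * G l j) * v j else 0)"
    by (auto simp: fun_eq_iff)
qed

lemma matrix_op_cong: "(\<And>i j. i < n \<Longrightarrow> j < n \<Longrightarrow> F i j = G i j) \<Longrightarrow> matrix_op n F = matrix_op n G"
  by transfer (auto simp: fun_eq_iff)

lemma op_trace_mult_commute:
  assumes "f \<in> block_ops n" "g \<in> block_ops n"
  shows "op_trace n (f * g) = op_trace n (g * f)"
proof -
  have "op_trace n (f * g) = (\<Sum>i<n. \<Sum>l<n. entry f i l * entry g l i)"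
    using assms by (simp add: op_trace_def entry_mult)
  also have "\<dots> = (\<Sum>i<n. \<Sum>l<n. entry g i l * entry f l i)"
    by (subst sum.swap) (simp add: mult.commute)
  also have "\<dots> = op_trace n (g * f)"
    using assms by (simp add: op_trace_def entry_mult)
  finally show ?thesis .
qed

text \<open>The index set is a parameter because powers are taken both over all rows and over
  \<Omega> alone, with rows keeping their original numbers.\<close>

primrec matrix_pow :: "nat set \<Rightarrow> (nat \<Rightarrow> nat \<Rightarrow> complex) \<Rightarrow> nat \<Rightarrow> nat \<Rightarrow> nat \<Rightarrow> complex" where
  "matrix_pow I F 0 = (\<lambda>i j. of_bool (i = j))"
| "matrix_pow I F (Suc k) = (\<lambda>i j. \<Sum>l\<in>I. F i l * matrix_pow I F k l j)"

definition unitary_on :: "nat \<Rightarrow> (nat \<Rightarrow> nat \<Rightarrow> complex) \<Rightarrow> bool" where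
  "unitary_on n V \<longleftrightarrow>
     (\<forall>i<n. \<forall>j<n. (\<Sum>t<n. V i t * cnj (V j t)) = of_bool (i = j)) \<and>
     (\<forall>s<n. \<forall>t<n. (\<Sum>i<n. cnj (V i s) * V i t) = of_bool (s = t))"

text \<open>With all rows this is the projection \<open>P\<close>; with the rows in \<Omega> it is
  the submatrix times its adjoint.\<close>

definition column_gram :: "(nat \<Rightarrow> nat \<Rightarrow> complex) \<Rightarrow> nat set \<Rightarrow> nat \<Rightarrow> nat \<Rightarrow> complex" where
  "column_gram V T i j = (\<Sum>t\<in>T. V i t * cnj (V j t))"

text \<open>The product of the centred projections \<open>diag 1\<^sub>\<Omega> - \<alpha>\<close> and \<open>V (diag 1\<^sub>T - \<beta>) V\<^sup>*\<close>.\<close>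

definition centered_product ::
  "nat \<Rightarrow> (nat \<Rightarrow> nat \<Rightarrow> complex) \<Rightarrow> (nat \<Rightarrow> real) \<Rightarrow> (nat \<Rightarrow> real) \<Rightarrow> nat \<Rightarrow> nat \<Rightarrow> complex" where
  "centered_product n V a b i l = of_real (a i) * (\<Sum>t<n. of_real (b t) * (V i t * cnj (V l t)))"

text \<open>\<open>E\<close> enters through its power sums only; that it consists of squared
  singular values is established separately. The general trace formula is used at j = 0, where both
  corrections survive.\<close>

lemma trace_centered_product_power:
  fixes n V \<Omega> T and \<alpha> \<beta> c D :: real and E :: "real multiset"
  assumes V: "unitary_on n V" and \<Omega>: "\<Omega> \<subseteq> {..<n}" and T: "T \<subseteq> {..<n}"
    and c: "c = \<alpha> + \<beta> - 2 * \<alpha> * \<beta>" and D: "D = \<alpha> * \<beta> * (1 - \<alpha>) * (1 - \<beta>)"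
    and E: "\<And>j. (\<Sum>i\<in>\<Omega>. matrix_pow \<Omega> (column_gram V T) j i i) = (\<Sum>x\<in>#E. of_real (x ^ j))"
  shows "(\<Sum>i<n. matrix_pow {..<n} (centered_product n V (\<lambda>i. indicator \<Omega> i - \<alpha>) (\<lambda>t. indicator T t - \<beta>)) k i i)
     = (\<Sum>x\<in>#E. of_real (centered_cheb c D k x))
       + of_real ((\<alpha> * \<beta>) ^ k) * (of_nat n - of_nat (card T) - of_nat (card \<Omega>))
       + of_real ((- \<alpha> * (1 - \<beta>)) ^ k) * (of_nat (card T) - of_nat (card \<Omega>))"
proof -
  let ?G = "column_gram V T"
  define P where "P = matrix_op n ?G"
  define Q where "Q = matrix_op n (\<lambda>i j. of_bool (i = j \<and> i \<in> \<Omega>))"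
  have rows: "\<And>i j. i < n \<Longrightarrow> j < n \<Longrightarrow> (\<Sum>t<n. V i t * cnj (V j t)) = of_bool (i = j)"
    and cols: "\<And>s t. s < n \<Longrightarrow> t < n \<Longrightarrow> (\<Sum>i<n. cnj (V i s) * V i t) = of_bool (s = t)"
    using V by (auto simp: unitary_on_def)
  have finT: "finite T" and fin\<Omega>: "finite \<Omega>" using T \<Omega> finite_subset by auto
  have P_idem: "P * P = P"
    unfolding P_def matrix_op_mult
  proof (rule matrix_op_cong)
    fix i j assume "i < n" "j < n"
    have "(\<Sum>l<n. ?G i l * ?G l j) =
        (\<Sum>l<n. \<Sum>s\<in>T. \<Sum>t\<in>T. V i s * cnj (V j t) * (cnj (V l s) * V l t))"
      unfolding column_gram_def sum_product by (intro sum.cong refl) (simp only: ac_simps)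
    also have "\<dots> = (\<Sum>s\<in>T. \<Sum>t\<in>T. \<Sum>l<n. V i s * cnj (V j t) * (cnj (V l s) * V l t))"
      by (subst sum.swap, rule sum.cong[OF refl], subst sum.swap) simp
    also have "\<dots> = (\<Sum>s\<in>T. \<Sum>t\<in>T. V i s * cnj (V j t) * of_bool (s = t))"
      using T by (auto simp: sum_distrib_left[symmetric] cols subset_eq intro!: sum.cong)
    also have "\<dots> = ?G i j"
      using finT by (simp add: column_gram_def of_bool_def if_distrib[of "(*) _"] cong: if_cong)
    finally show "(\<Sum>l<n. ?G i l * ?G l j) = ?G i j" .
  qed
  have Q_idem: "Q * Q = Q"
    unfolding Q_def matrix_op_mult
  proof (rule matrix_op_cong)
    fix i j assume ij: "i < n" "j < n"
    have "(\<Sum>l<n. of_bool (i = l \<and> i \<in> \<Omega>) * of_bool (l = j \<and> l \<in> \<Omega>)) =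
        (\<Sum>l<n. if l = i then of_bool (i = j \<and> i \<in> \<Omega>) else 0 :: complex)"
      by (intro sum.cong) auto
    then show "(\<Sum>l<n. of_bool (i = l \<and> i \<in> \<Omega>) * of_bool (l = j \<and> l \<in> \<Omega>)) =
        (of_bool (i = j \<and> i \<in> \<Omega>) :: complex)"
      using ij by simp
  qed
  interpret two_projections P Q "block_ops n" "op_trace n"
  proof
    show "f * g \<in> block_ops n" if "f \<in> block_ops n" "g \<in> block_ops n" for f g
      using that unfolding block_ops_def[of n] mem_Collect_eq
      by (auto simp: entry_mult[OF that(2)] block_ops_def)
    show "P * P = P" "Q * Q = Q" by (fact P_idem Q_idem)+
    show "op_trace n (f * g) = op_trace n (g * f)" if "f \<in> block_ops n" "g \<in> block_ops n" for f g
      using that by (rule op_trace_mult_commute)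
    show "op_trace n (f + g) = op_trace n f + op_trace n g"
      "op_trace n (r *\<^sub>R f) = of_real r * op_trace n f" for f g r
      by (simp_all add: op_trace_def sum.distrib sum_distrib_left)
  qed (auto simp: P_def Q_def block_ops_def)
  have mom: "entry ((Q * P) ^ j * Q) i l = (if i \<in> \<Omega> \<and> l \<in> \<Omega> then matrix_pow \<Omega> ?G j i l else 0)"
    if "i < n" "l < n" for i j l using that
  proof (induction j arbitrary: i)
    case (Suc j)
    have QP: "entry (Q * P) i m = (if i \<in> \<Omega> then ?G i m else 0)" if "m < n" for m
      using that Suc.prems by (subst entry_mult[OF P_in])
        (auto simp: Q_def P_def of_bool_def if_distrib[of "\<lambda>x. x * _"] cong: if_cong)
    have "entry ((Q * P) ^ Suc j * Q) i l = entry ((Q * P) * ((Q * P) ^ j * Q)) i l"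
      by (simp add: mult.assoc)
    also have "\<dots> = (\<Sum>m<n. entry (Q * P) i m * entry ((Q * P) ^ j * Q) m l)"
      by (rule entry_mult) (use Suc.prems in \<open>auto intro!: in_S\<close>)
    also have "\<dots> = (\<Sum>m<n. if m \<in> \<Omega> then (if i \<in> \<Omega> \<and> l \<in> \<Omega> then ?G i m * matrix_pow \<Omega> ?G j m l else 0) else 0)"
      using Suc by (auto simp: QP intro!: sum.cong)
    also have "\<dots> = (\<Sum>m\<in>\<Omega>. if i \<in> \<Omega> \<and> l \<in> \<Omega> then ?G i m * matrix_pow \<Omega> ?G j m l else 0)"
      using \<Omega> by (simp add: sum.If_cases Int_absorb1)
    finally show ?case by auto
  qed (auto simp: Q_def)
  have momE: "two_projections.mom P Q (op_trace n) j = (\<Sum>x\<in>#E. of_real (x ^ j))" for j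
  proof -
    have "mom j = (\<Sum>i<n. if i \<in> \<Omega> then matrix_pow \<Omega> ?G j i i else 0)"
      by (simp add: mom_def op_trace_def mom)
    also have "\<dots> = (\<Sum>i\<in>\<Omega>. matrix_pow \<Omega> ?G j i i)"
      using \<Omega> by (simp add: sum.If_cases Int_absorb1)
    finally show ?thesis using E by simp
  qed
  have trP: "op_trace n P = of_nat (card T)"
  proof -
    have "op_trace n P = (\<Sum>t\<in>T. \<Sum>i<n. cnj (V i t) * V i t)"
      by (subst sum.swap) (simp add: op_trace_def P_def column_gram_def mult.commute)
    also have "\<dots> = (\<Sum>t\<in>T. 1)" using T by (intro sum.cong) (auto simp: cols)
    finally show ?thesis by simp
  qed
  have trQ: "op_trace n Q = of_nat (card \<Omega>)"
  proof -
    have "op_trace n Q = (\<Sum>i\<in>{..<n}. if i \<in> \<Omega> then 1 else 0)"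
      unfolding op_trace_def by (rule sum.cong) (auto simp: Q_def)
    also have "\<dots> = of_nat (card \<Omega>)" using \<Omega> by (simp add: sum.If_cases Int_absorb1 del: sum_of_bool_eq)
    finally show ?thesis .
  qed
  define M where "M = centered_product n V (\<lambda>i. indicator \<Omega> i - \<alpha>) (\<lambda>t. indicator T t - \<beta>)"
  have X_in: "X \<alpha> \<beta> \<in> block_ops n"
    unfolding X_def by (intro in_S)
  have X_entry: "entry (X \<alpha> \<beta>) i l = M i l" if il: "i < n" "l < n" for i l
  proof -
    have "entry (X \<alpha> \<beta>) i l = (\<Sum>m<n. entry (Q - \<alpha> *\<^sub>R 1) i m * entry (P - \<beta> *\<^sub>R 1) m l)"
      unfolding X_def by (rule entry_mult) (use il in \<open>auto intro!: in_S\<close>)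
    also have "\<dots> = (\<Sum>m<n. if m = i then of_real (indicator \<Omega> i - \<alpha>) * (?G i l - of_real \<beta> * of_bool (i = l)) else 0)"
      using il by (intro sum.cong) (auto simp: Q_def P_def indicator_def)
    also have "\<dots> = of_real (indicator \<Omega> i - \<alpha>) * (?G i l - of_real \<beta> * (\<Sum>t<n. V i t * cnj (V l t)))"
      using il by (simp add: rows)
    also have "?G i l = (\<Sum>t<n. of_real (indicator T t) * (V i t * cnj (V l t)))"
      using T by (simp add: column_gram_def indicator_def of_bool_def if_distrib[of of_real] if_distrib[of "\<lambda>x. x * _"] sum.If_cases Int_absorb1 cong: if_cong)
    finally show ?thesis
      by (simp add: M_def centered_product_def sum_distrib_left sum_subtractf algebra_simps)
  qed
  have X_pow: "entry (X \<alpha> \<beta> ^ k) i l = matrix_pow {..<n} M k i l" if "i < n" "l < n" for i l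
    using that
  proof (induction k arbitrary: i)
    case (Suc k)
    have "entry (X \<alpha> \<beta> ^ Suc k) i l = (\<Sum>m<n. entry (X \<alpha> \<beta>) i m * entry (X \<alpha> \<beta> ^ k) m l)"
      unfolding power_Suc by (rule entry_mult) (use Suc.prems in \<open>auto intro!: in_S X_in\<close>)
    then show ?case using Suc by (simp add: X_entry)
  qed simp
  have "(\<Sum>i<n. matrix_pow {..<n} M k i i) = op_trace n (Z ^ 0 * X \<alpha> \<beta> ^ k)"
    by (simp add: op_trace_def X_pow)
  also have "\<dots> = (\<Sum>x\<in>#E. of_real (x ^ 0 * centered_cheb c D k x))
     + of_real ((\<alpha> * \<beta>) ^ k) * op_trace n C + of_real ((- \<alpha> * (1 - \<beta>)) ^ k) * op_trace n R"
    by (subst tr_Z_power_X_power[OF c D momE]) simp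
  also have "op_trace n C = of_nat n - of_nat (card T) - of_nat (card \<Omega>)"
    by (simp add: C_def tr_diff trP trQ) (simp add: op_trace_def)
  also have "op_trace n R = of_nat (card T) - of_nat (card \<Omega>)"
    by (simp add: R_def tr_diff trP trQ)
  finally show ?thesis by (simp add: M_def)
qed

section \<open>Eigenvalues, power sums and singular values of complex matrices\<close>

lemma trace_mult_commute:
  fixes A B :: "complex mat"
  assumes A: "A \<in> carrier_mat m n" and B: "B \<in> carrier_mat n m"
  shows "(\<Sum>i<m. (A * B) $$ (i, i)) = (\<Sum>i<n. (B * A) $$ (i, i))"
proof -
  have "(\<Sum>i<m. (A * B) $$ (i, i)) = (\<Sum>i<m. \<Sum>l<n. A $$ (i, l) * B $$ (l, i))"
    using A B by (auto simp: scalar_prod_def atLeast0LessThan intro!: sum.cong)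
  also have "\<dots> = (\<Sum>l<n. \<Sum>i<m. B $$ (l, i) * A $$ (i, l))"
    by (subst sum.swap) (simp add: mult.commute)
  also have "\<dots> = (\<Sum>i<n. (B * A) $$ (i, i))"
    using A B by (auto simp: scalar_prod_def atLeast0LessThan intro!: sum.cong)
  finally show ?thesis .
qed

lemma upper_triangular_mult_diag:
  fixes A B :: "complex mat"
  assumes A: "A \<in> carrier_mat m m" "upper_triangular A" and B: "B \<in> carrier_mat m m" "upper_triangular B"
  shows "upper_triangular (A * B)" and "i < m \<Longrightarrow> (A * B) $$ (i, i) = A $$ (i, i) * B $$ (i, i)"
proof -
  have idx: "(A * B) $$ (i, j) = (\<Sum>l<m. A $$ (i, l) * B $$ (l, j))" if "i < m" "j < m" for i j
    using A B that by (auto simp: scalar_prod_def atLeast0LessThan intro!: sum.cong)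
  show "upper_triangular (A * B)"
  proof (rule upper_triangularI)
    fix i j assume ij: "j < i" "i < dim_row (A * B)"
    then have "(\<Sum>l<m. A $$ (i, l) * B $$ (l, j)) = (\<Sum>l<m. 0)"
      using A B by (intro sum.cong) (auto, metis linorder_neqE_nat order.strict_trans upper_triangularD carrier_matD(1))
    then show "(A * B) $$ (i, j) = 0" using ij A B by (subst idx) auto
  qed
  assume i: "i < m"
  have "(\<Sum>l<m. A $$ (i, l) * B $$ (l, i)) = (\<Sum>l<m. if l = i then A $$ (i, i) * B $$ (i, i) else 0)"
    using A B i by (intro sum.cong) (auto, metis linorder_neqE_nat upper_triangularD carrier_matD(1))
  then show "(A * B) $$ (i, i) = A $$ (i, i) * B $$ (i, i)" using i by (simp add: idx)
qed

lemma upper_triangular_pow_diag: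
  fixes A :: "complex mat"
  assumes A: "A \<in> carrier_mat m m" "upper_triangular A"
  shows "upper_triangular (A ^\<^sub>m k) \<and> (\<forall>i<m. (A ^\<^sub>m k) $$ (i, i) = A $$ (i, i) ^ k)"
proof (induction k)
  case (Suc k)
  have c: "A ^\<^sub>m k \<in> carrier_mat m m" using A by simp
  show ?case
    using upper_triangular_mult_diag[OF c _ A] Suc by (simp add: mult.commute)
qed (use A in auto)

text \<open>Schur triangularisation: powers of a triangular matrix have the powered diagonal, so
  algebraic multiplicities come out right without diagonalising.\<close>

lemma trace_pow_eq_sum_proots:
  fixes G :: "complex mat"
  assumes G: "G \<in> carrier_mat m m"
  shows "(\<Sum>i<m. (G ^\<^sub>m k) $$ (i, i)) = (\<Sum>z\<in>#proots (char_poly G). z ^ k)"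
proof -
  obtain as where as: "char_poly G = (\<Prod>a\<leftarrow>as. [:- a, 1:])" "length as = m"
    using char_poly_factorized[OF G] by blast
  obtain B P Q where s: "schur_decomposition G as = (B, P, Q)" by (metis prod_cases3)
  from schur_decomposition[OF G as(1) s]
  have w: "similar_mat_wit G B P Q" and ut: "upper_triangular B" and dg: "diag_mat B = as" by auto
  from w G have c: "B \<in> carrier_mat m m" "P \<in> carrier_mat m m" "Q \<in> carrier_mat m m"
    and QP: "Q * P = 1\<^sub>m m"
    unfolding similar_mat_wit_def Let_def by auto
  have Bk: "B ^\<^sub>m k \<in> carrier_mat m m" using c by simp
  have "(\<Sum>i<m. (G ^\<^sub>m k) $$ (i, i)) = (\<Sum>i<m. (P * B ^\<^sub>m k * Q) $$ (i, i))"
    using similar_mat_wit_pow_id[OF w] by simp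
  also have "\<dots> = (\<Sum>i<m. (Q * (P * B ^\<^sub>m k)) $$ (i, i))"
    using c Bk by (intro trace_mult_commute) auto
  also have "Q * (P * B ^\<^sub>m k) = B ^\<^sub>m k"
    using c Bk QP by (simp add: assoc_mult_mat[symmetric, of Q m m P m "B ^\<^sub>m k" m])
  also have "(\<Sum>i<m. (B ^\<^sub>m k) $$ (i, i)) = (\<Sum>i<m. B $$ (i, i) ^ k)"
    using upper_triangular_pow_diag[OF c(1) ut, of k] by simp
  also have "\<dots> = (\<Sum>a\<leftarrow>as. a ^ k)"
    using c unfolding dg[symmetric]
    by (simp add: diag_mat_def interv_sum_list_conv_sum_set_nat atLeast0LessThan comp_def)
  also have "\<dots> = (\<Sum>z\<in>#mset as. z ^ k)" by (metis mset_map sum_mset_sum_list)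
  also have "mset as = proots (char_poly G)"
  proof -
    have "proots (\<Prod>a\<leftarrow>bs. [:- a, 1:]) = mset bs" for bs :: "complex list"
    proof (induction bs)
      case (Cons a bs)
      have "(\<Prod>a\<leftarrow>bs. [:- a, 1:]) \<noteq> 0" by (auto simp: prod_list_zero_iff)
      then have "proots ([:- a, 1:] * (\<Prod>a\<leftarrow>bs. [:- a, 1:])) = {#a#} + mset bs"
        by (subst proots_mult) (simp_all add: Cons)
      then show ?case by simp
    qed simp
    then show ?thesis using as by simp
  qed
  finally show ?thesis .
qed

lemma pow_mat_commute:
  fixes G :: "complex mat"
  assumes G: "G \<in> carrier_mat m m"
  shows "G * G ^\<^sub>m k = G ^\<^sub>m k * G"
proof (induction k)
  case (Suc k)
  have "G * (G ^\<^sub>m k * G) = G * G ^\<^sub>m k * G"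
    by (rule assoc_mult_mat[symmetric, OF G pow_carrier_mat[OF G] G])
  then show ?case using Suc by simp
qed (use G in auto)

lemma pow_mat_index:
  fixes G :: "complex mat"
  assumes G: "G \<in> carrier_mat m m" and "i < m" "l < m"
    and F: "\<And>i l. i < m \<Longrightarrow> l < m \<Longrightarrow> G $$ (i, l) = F (h i) (h l)" and h: "inj_on h {..<m}"
  shows "(G ^\<^sub>m k) $$ (i, l) = matrix_pow (h ` {..<m}) F k (h i) (h l)"
  using assms(2,3)
proof (induction k arbitrary: i l)
  case 0
  then show ?case using G h by (auto simp: inj_on_def)
next
  case (Suc k)
  have c: "G ^\<^sub>m k \<in> carrier_mat m m" using G by simp
  have "(G ^\<^sub>m Suc k) $$ (i, l) = (G * G ^\<^sub>m k) $$ (i, l)" using pow_mat_commute[OF G] by simp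
  also have "\<dots> = (\<Sum>j<m. G $$ (i, j) * (G ^\<^sub>m k) $$ (j, l))"
    using G c Suc.prems by (auto simp: scalar_prod_def atLeast0LessThan intro!: sum.cong)
  also have "\<dots> = (\<Sum>j<m. F (h i) (h j) * matrix_pow (h ` {..<m}) F k (h j) (h l))"
    using Suc by (auto simp: F intro!: sum.cong)
  also have "\<dots> = (\<Sum>j\<in>h ` {..<m}. F (h i) j * matrix_pow (h ` {..<m}) F k j (h l))"
    using h by (simp add: sum.reindex)
  finally show ?case by simp
qed

lemma bij_betw_pick:
  assumes "finite S"
  shows "bij_betw (pick S) {..<card S} S"
  unfolding bij_betw_def
proof
  show inj: "inj_on (pick S) {..<card S}"
    by (auto simp: inj_on_def) (metis linorder_neqE_nat less_irrefl pick_mono_le)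
  show "pick S ` {..<card S} = S"
    by (rule card_subset_eq) (use assms in \<open>auto simp: pick_in_set_le card_image[OF inj]\<close>)
qed

text \<open>The exponent is positive because at 0 the two traces are m and n.\<close>

lemma trace_pow_mult_commute:
  fixes A B :: "complex mat"
  assumes A: "A \<in> carrier_mat m n" and B: "B \<in> carrier_mat n m"
  shows "(\<Sum>i<m. ((A * B) ^\<^sub>m Suc k) $$ (i, i)) = (\<Sum>i<n. ((B * A) ^\<^sub>m Suc k) $$ (i, i))"
proof -
  have AB: "A * B \<in> carrier_mat m m" and BA: "B * A \<in> carrier_mat n n" using A B by auto
  have ABk: "(A * B) ^\<^sub>m k \<in> carrier_mat m m" and BAk: "(B * A) ^\<^sub>m k \<in> carrier_mat n n" for k
    using pow_carrier_mat[OF AB] pow_carrier_mat[OF BA] by auto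
  have push: "(A * B) ^\<^sub>m k * A = A * (B * A) ^\<^sub>m k" for k
  proof (induction k)
    case (Suc k)
    have "(A * B) ^\<^sub>m Suc k * A = (A * B) ^\<^sub>m k * (A * (B * A))"
      by (simp add: assoc_mult_mat[OF ABk AB A] assoc_mult_mat[OF A B A])
    also have "\<dots> = A * (B * A) ^\<^sub>m k * (B * A)"
      by (simp add: assoc_mult_mat[OF ABk A BA, symmetric] Suc)
    finally show ?case by (simp add: assoc_mult_mat[OF A BAk BA])
  qed (use A B in auto)
  have "(A * B) ^\<^sub>m Suc k = A * ((B * A) ^\<^sub>m k * B)"
    by (simp add: assoc_mult_mat[OF ABk A B, symmetric] push assoc_mult_mat[OF A BAk B])
  then have "(\<Sum>i<m. ((A * B) ^\<^sub>m Suc k) $$ (i, i)) = (\<Sum>i<n. ((B * A) ^\<^sub>m k * B * A) $$ (i, i))"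
    using trace_mult_commute[OF A mult_carrier_mat[OF BAk B]] by simp
  then show ?thesis by (simp add: assoc_mult_mat[OF BAk B A])
qed

text \<open>Power sums of positive order determine the sum of z f(z) for every polynomial f. Letting
  f vanish at all other elements isolates the multiplicity of one nonzero point; the multiplicity of
  0 stays invisible.\<close>

lemma nonzero_filter_eq_if_power_sums_eq:
  fixes E F :: "complex multiset"
  assumes "\<And>k. (\<Sum>z\<in>#E. z ^ Suc k) = (\<Sum>z\<in>#F. z ^ Suc k)"
  shows "filter_mset (\<lambda>z. z \<noteq> 0) E = filter_mset (\<lambda>z. z \<noteq> 0) F"
proof (rule multiset_eqI)
  fix a
  have poly_sums: "(\<Sum>z\<in>#E. z * poly f z) = (\<Sum>z\<in>#F. z * poly f z)" for f :: "complex poly"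
  proof -
    have *: "(\<Sum>z\<in>#G. z * poly f z) = (\<Sum>k\<le>degree f. coeff f k * (\<Sum>z\<in>#G. z ^ Suc k))" for G :: "complex multiset"
      by (induction G) (simp_all add: poly_altdef sum_distrib_left distrib_left sum.distrib ac_simps)
    show ?thesis unfolding * assms ..
  qed
  show "count (filter_mset (\<lambda>z. z \<noteq> 0) E) a = count (filter_mset (\<lambda>z. z \<noteq> 0) F) a"
  proof (cases "a = 0")
    case False
    define S where "S = (set_mset E \<union> set_mset F) - {a}"
    define f where "f = (\<Prod>s\<in>S. [:- s, 1:])"
    have fin: "finite S" by (simp add: S_def)
    have zero: "poly f z = 0" if "z \<in> S" for z
      using that fin by (auto simp: f_def poly_prod)
    have nz: "poly f a \<noteq> 0" using fin by (auto simp: f_def poly_prod S_def)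
    have *: "(\<Sum>z\<in>#G. z * poly f z) = of_nat (count G a) * (a * poly f a)"
      if "set_mset G - {a} \<subseteq> S" for G
      using that
    proof (induction G)
      case (add x G)
      show ?case
      proof (cases "x = a")
        case False
        then have "x \<in> S" "set_mset G - {a} \<subseteq> S" using add.prems by auto
        then show ?thesis using False add.IH by (simp add: zero)
      qed (use add in \<open>auto simp: algebra_simps\<close>)
    qed simp
    have "of_nat (count E a) * (a * poly f a) = of_nat (count F a) * (a * poly f a)"
      using poly_sums[of f] by (subst (asm) (1 2) *) (auto simp: S_def)
    then show ?thesis using nz False by simp
  qed simp
qed

lemma unitary_group_imp_unitary_on:
  assumes "V \<in> unitary_group n"
  shows "unitary_on n (\<lambda>i j. V $$ (i, j))"
proof -
  have V: "V \<in> carrier_mat n n" "V * mat_adjoint V = 1\<^sub>m n" "mat_adjoint V * V = 1\<^sub>m n"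
    using assms by (auto simp: unitary_group_def)
  note c = mat_adjoint_carrier[OF V(1)]
  have "(\<Sum>t<n. V $$ (i, t) * cnj (V $$ (j, t))) = of_bool (i = j)" if "i < n" "j < n" for i j
  proof -
    have "(V * mat_adjoint V) $$ (i, j) = (\<Sum>t<n. V $$ (i, t) * cnj (V $$ (j, t)))"
      using V(1) c that by (auto simp: scalar_prod_def atLeast0LessThan mat_adjoint_index intro!: sum.cong)
    from this[symmetric] show ?thesis unfolding V(2) using that by simp
  qed
  moreover have "(\<Sum>i<n. cnj (V $$ (i, s)) * V $$ (i, t)) = of_bool (s = t)" if "s < n" "t < n" for s t
  proof -
    have "(mat_adjoint V * V) $$ (s, t) = (\<Sum>i<n. cnj (V $$ (i, s)) * V $$ (i, t))"
      using V(1) c that by (auto simp: scalar_prod_def atLeast0LessThan mat_adjoint_index intro!: sum.cong)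
    from this[symmetric] show ?thesis unfolding V(3) using that by simp
  qed
  ultimately show ?thesis by (simp add: unitary_on_def)
qed

text \<open>Pairing the eigenvalue equation with its eigenvector v gives |y|^2 = z |v|^2, where y is
  the adjoint of \<open>B\<close> applied to v. This makes z real and nonnegative, and the
  contraction hypothesis bounds it by 1.\<close>

lemma eigenvalue_gram_bounds:
  fixes B :: "complex mat"
  assumes B: "B \<in> carrier_mat m k"
    and contraction: "\<And>v. (\<Sum>t<k. (cmod (\<Sum>i<m. cnj (B $$ (i, t)) * v i))\<^sup>2) \<le> (\<Sum>i<m. (cmod (v i))\<^sup>2)"
    and z: "poly (char_poly (B * mat_adjoint B)) z = 0"
  shows "Im z = 0 \<and> 0 \<le> Re z \<and> Re z \<le> 1"
proof -
  have Bc: "mat_adjoint B \<in> carrier_mat k m" using mat_adjoint_carrier[OF B] .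
  have G: "B * mat_adjoint B \<in> carrier_mat m m" using B Bc by simp
  from z eigenvalue_root_char_poly[OF G] obtain v where
    v: "v \<in> carrier_vec m" "v \<noteq> 0\<^sub>v m" "(B * mat_adjoint B) *\<^sub>v v = z \<cdot>\<^sub>v v"
    unfolding eigenvalue_def eigenvector_def carrier_matD(1)[OF G] by blast
  define u where "u i = vec_index v i" for i
  define y where "y t = (\<Sum>i<m. cnj (B $$ (i, t)) * u i)" for t
  have eig: "(\<Sum>t<k. B $$ (i, t) * y t) = z * u i" if i: "i < m" for i
  proof -
    have "(B * mat_adjoint B) *\<^sub>v v = B *\<^sub>v (mat_adjoint B *\<^sub>v v)"
      by (rule assoc_mult_mat_vec[OF B Bc v(1)])
    with v(3) have "B *\<^sub>v (mat_adjoint B *\<^sub>v v) = z \<cdot>\<^sub>v v" by simp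
    then have "vec_index (B *\<^sub>v (mat_adjoint B *\<^sub>v v)) i = z * u i"
      using i carrier_vecD[OF v(1)] by (simp add: u_def index_smult_vec)
    moreover have "vec_index (B *\<^sub>v (mat_adjoint B *\<^sub>v v)) i = (\<Sum>t<k. B $$ (i, t) * y t)"
      using B Bc v(1) i
      by (auto simp: scalar_prod_def atLeast0LessThan y_def u_def mat_adjoint_index[OF B] intro!: sum.cong)
    ultimately show ?thesis by simp
  qed
  define N where "N = (\<Sum>i<m. (cmod (u i))\<^sup>2)"
  define N' where "N' = (\<Sum>t<k. (cmod (y t))\<^sup>2)"
  have "of_real N' = (\<Sum>t<k. cnj (y t) * y t)"
    unfolding N'_def of_real_sum by (intro sum.cong refl) (metis complex_norm_square mult.commute of_real_power)
  also have "\<dots> = (\<Sum>i<m. \<Sum>t<k. cnj (u i) * (B $$ (i, t) * y t))"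
    by (subst sum.swap) (simp add: y_def[of "_"] sum_distrib_right mult.assoc mult.left_commute)
  also have "\<dots> = (\<Sum>i<m. cnj (u i) * (z * u i))"
    by (simp add: sum_distrib_left[symmetric] eig)
  also have "\<dots> = z * of_real N"
    unfolding N_def of_real_sum sum_distrib_left
    by (intro sum.cong refl) (metis complex_norm_square mult.commute mult.left_commute of_real_power)
  finally have zN: "of_real N' = z * of_real N" .
  have "\<exists>i<m. u i \<noteq> 0" using v unfolding u_def by (metis carrier_vecD eq_vecI index_zero_vec)
  then have "N > 0" unfolding N_def by (auto intro!: sum_pos2)
  moreover have "N' \<ge> 0" "N' \<le> N"
    unfolding N_def N'_def y_def by (auto intro: sum_nonneg contraction)
  ultimately have "z = of_real (N' / N)" "0 \<le> N' / N" "N' / N \<le> 1"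
    using zN by (auto simp: field_simps)
  then show ?thesis by simp
qed

text \<open>Extend v by zero to all rows: the full adjoint is isometric, and dropping columns only
  loses terms.\<close>

lemma unitary_on_contraction:
  fixes m k n :: nat
  assumes V: "unitary_on n V" and h: "inj_on h {..<m}" "h ` {..<m} \<subseteq> {..<n}"
    and g: "inj_on g {..<k}" "g ` {..<k} \<subseteq> {..<n}"
  shows "(\<Sum>t<k. (cmod (\<Sum>i<m. cnj (V (h i) (g t)) * v i))\<^sup>2) \<le> (\<Sum>i<m. (cmod (v i))\<^sup>2)"
proof -
  let ?y = "\<lambda>t. \<Sum>i<m. cnj (V (h i) t) * v i"
  have "(\<Sum>t<k. (cmod (?y (g t)))\<^sup>2) = (\<Sum>t\<in>g ` {..<k}. (cmod (?y t))\<^sup>2)"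
    using g by (simp add: sum.reindex)
  also have "\<dots> \<le> (\<Sum>t<n. (cmod (?y t))\<^sup>2)"
    using g by (intro sum_mono2) auto
  also have "\<dots> = (\<Sum>i<m. (cmod (v i))\<^sup>2)"
  proof -
    have "complex_of_real (\<Sum>t<n. (cmod (?y t))\<^sup>2) = (\<Sum>t<n. ?y t * cnj (?y t))"
      by (simp only: of_real_sum complex_norm_square)
    also have "\<dots> = (\<Sum>t<n. \<Sum>i<m. \<Sum>l<m. v i * cnj (v l) * (V (h l) t * cnj (V (h i) t)))"
      unfolding cnj_sum sum_product by (intro sum.cong refl) (simp add: ac_simps)
    also have "\<dots> = (\<Sum>i<m. \<Sum>l<m. v i * cnj (v l) * (\<Sum>t<n. V (h l) t * cnj (V (h i) t)))"
      by (subst sum.swap, rule sum.cong[OF refl], subst sum.swap) (simp add: sum_distrib_left)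
    also have "\<dots> = (\<Sum>i<m. \<Sum>l<m. if l = i then v i * cnj (v i) else 0)"
    proof (intro sum.cong refl)
      fix i l assume "i \<in> {..<m}" "l \<in> {..<m}"
      then have "h i < n" "h l < n" "h l = h i \<longleftrightarrow> l = i" using h by (auto simp: inj_on_def)
      then show "v i * cnj (v l) * (\<Sum>t<n. V (h l) t * cnj (V (h i) t)) = (if l = i then v i * cnj (v i) else 0)"
        using V by (auto simp: unitary_on_def)
    qed
    also have "\<dots> = (\<Sum>i<m. v i * cnj (v i))"
      by (subst sum.delta) auto
    also have "\<dots> = of_real (\<Sum>i<m. (cmod (v i))\<^sup>2)"
      by (simp only: of_real_sum complex_norm_square)
    finally show ?thesis by (simp only: of_real_eq_iff)
  qed
  finally show ?thesis .
qed

lemma sorted_rev_drop_zeros: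
  fixes ys :: "real list"
  assumes "sorted ys" "\<forall>y\<in>set ys. 0 \<le> y" "length (filter (\<lambda>y. y \<noteq> 0) ys) \<le> r"
  shows "\<forall>y\<in>set (drop r (rev ys)). y = 0"
proof
  fix y assume "y \<in> set (drop r (rev ys))"
  then obtain j where j: "j < length ys - r" "y = rev ys ! (r + j)"
    by (auto simp: in_set_conv_nth)
  define i where "i = length ys - Suc (r + j)"
  have yi: "y = ys ! i" "i < length ys" using j by (auto simp: rev_nth i_def)
  show "y = 0"
  proof (rule ccontr)
    assume "y \<noteq> 0"
    then have "y > 0" using assms yi by (metis nth_mem order_le_less)
    have "x \<noteq> 0" if x: "x \<in> set (drop i ys)" for x
    proof -
      obtain l where "l < length ys - i" "x = ys ! (i + l)"
        using x by (auto simp: in_set_conv_nth)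
      then have "ys ! i \<le> x" using assms(1) by (auto intro: sorted_nth_mono)
      then show ?thesis using \<open>y > 0\<close> yi by simp
    qed
    then have "filter (\<lambda>y. y \<noteq> 0) (drop i ys) = drop i ys" by (simp add: filter_id_conv)
    moreover have "length (filter (\<lambda>y. y \<noteq> 0) ys) =
        length (filter (\<lambda>y. y \<noteq> 0) (take i ys)) + length (filter (\<lambda>y. y \<noteq> 0) (drop i ys))"
      by (metis append_take_drop_id filter_append length_append)
    ultimately have "length ys - i \<le> r" using assms(3) by simp
    then show False using j by (simp add: i_def)
  qed
qed

text \<open>\<open>E\<close> holds all eigenvalues of the Gram matrix, one per element of \<Omega>
  and zeros included, because the trace formula sees them. The list keeps only the largest ones;
  those it discards are zero by the rank bound, whence the correction by \<open>f 0\<close>.\<close>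

lemma singular_values_submatrix:
  assumes V: "V \<in> unitary_group n" and \<Omega>: "\<Omega> \<subseteq> {..<n}" and T: "T \<subseteq> {..<n}"
  defines "xs \<equiv> take (min (card T) (card \<Omega>)) (singular_values (submatrix V \<Omega> T))"
  obtains E :: "real multiset" where
    "\<And>x. x \<in># E \<Longrightarrow> 0 \<le> x \<and> x \<le> 1"
    "\<And>j. (\<Sum>i\<in>\<Omega>. matrix_pow \<Omega> (column_gram (\<lambda>i j. V $$ (i, j)) T) j i i) = (\<Sum>x\<in>#E. of_real (x ^ j))"
    "length xs = min (card T) (card \<Omega>)"
    "\<And>f. (\<Sum>x\<leftarrow>xs. f x) = (\<Sum>x\<in>#E. f (sqrt x)) - (real (card \<Omega>) - min (card T) (card \<Omega>)) * f 0"
proof -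
  have fin: "finite \<Omega>" "finite T" using \<Omega> T finite_subset by auto
  define m where "m = card \<Omega>"
  define k where "k = card T"
  define B where "B = submatrix V \<Omega> T"
  define G where "G = B * mat_adjoint B"
  let ?V = "\<lambda>i j. V $$ (i, j)"
  have Vc: "V \<in> carrier_mat n n" using V by (simp add: unitary_group_def)
  have set_eq: "{i. i < n \<and> i \<in> \<Omega>} = \<Omega>" "{i. i < n \<and> i \<in> T} = T" using \<Omega> T by auto
  have B: "B \<in> carrier_mat m k"
    using Vc set_eq unfolding B_def m_def k_def carrier_mat_def by (simp add: dim_submatrix)
  have B_idx: "B $$ (i, t) = V $$ (pick \<Omega> i, pick T t)" if "i < m" "t < k" for i t
    unfolding B_def using that Vc set_eq[THEN arg_cong, of card] by (intro submatrix_index) (auto simp: m_def k_def)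
  note Bc = mat_adjoint_carrier[OF B]
  have G: "G \<in> carrier_mat m m" using B Bc by (simp add: G_def)
  have bij: "bij_betw (pick \<Omega>) {..<m} \<Omega>" "bij_betw (pick T) {..<k} T"
    unfolding m_def k_def using fin by (auto intro: bij_betw_pick)
  have G_idx: "G $$ (i, l) = column_gram ?V T (pick \<Omega> i) (pick \<Omega> l)" if "i < m" "l < m" for i l
  proof -
    have "G $$ (i, l) = (\<Sum>t<k. V $$ (pick \<Omega> i, pick T t) * cnj (V $$ (pick \<Omega> l, pick T t)))"
      using B Bc that by (auto simp: G_def scalar_prod_def atLeast0LessThan mat_adjoint_index B_idx intro!: sum.cong)
    also have "\<dots> = column_gram ?V T (pick \<Omega> i) (pick \<Omega> l)"
      unfolding column_gram_def by (rule sum.reindex_bij_betw[OF bij(2)])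
    finally show ?thesis .
  qed
  define C where "C = proots (char_poly G)"
  have monic: "degree (char_poly G) = m" "char_poly G \<noteq> 0"
    using degree_monic_char_poly[OF G] by auto
  have sizeC: "size C = m" by (simp add: C_def size_proots_complex monic)
  have C_bounds: "Im z = 0 \<and> 0 \<le> Re z \<and> Re z \<le> 1" if "z \<in># C" for z
  proof (rule eigenvalue_gram_bounds[OF B])
    show "poly (char_poly (B * mat_adjoint B)) z = 0"
      using that monic by (simp add: C_def G_def)
    fix v
    have "(\<Sum>t<k. (cmod (\<Sum>i<m. cnj (?V (pick \<Omega> i) (pick T t)) * v i))\<^sup>2) \<le> (\<Sum>i<m. (cmod (v i))\<^sup>2)"
      using bij \<Omega> T by (intro unitary_on_contraction[OF unitary_group_imp_unitary_on[OF V]])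
        (auto simp: bij_betw_def)
    then show "(\<Sum>t<k. (cmod (\<Sum>i<m. cnj (B $$ (i, t)) * v i))\<^sup>2) \<le> (\<Sum>i<m. (cmod (v i))\<^sup>2)"
      by (simp add: B_idx)
  qed
  define E where "E = image_mset Re C"
  have moments: "(\<Sum>i\<in>\<Omega>. matrix_pow \<Omega> (column_gram ?V T) j i i) = (\<Sum>x\<in>#E. of_real (x ^ j))" for j
  proof -
    have "(\<Sum>i\<in>\<Omega>. matrix_pow \<Omega> (column_gram ?V T) j i i) =
        (\<Sum>i<m. matrix_pow \<Omega> (column_gram ?V T) j (pick \<Omega> i) (pick \<Omega> i))"
      by (rule sum.reindex_bij_betw[OF bij(1), symmetric])
    also have "\<dots> = (\<Sum>i<m. (G ^\<^sub>m j) $$ (i, i))"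
    proof (rule sum.cong[OF refl])
      fix i assume "i \<in> {..<m}"
      then have "(G ^\<^sub>m j) $$ (i, i) =
          matrix_pow (pick \<Omega> ` {..<m}) (column_gram ?V T) j (pick \<Omega> i) (pick \<Omega> i)"
        using bij(1) by (intro pow_mat_index[OF G] G_idx) (auto simp: bij_betw_def)
      then show "matrix_pow \<Omega> (column_gram ?V T) j (pick \<Omega> i) (pick \<Omega> i) = (G ^\<^sub>m j) $$ (i, i)"
        using bij(1) by (simp add: bij_betw_def)
    qed
    also have "\<dots> = (\<Sum>z\<in>#C. z ^ j)" unfolding C_def by (rule trace_pow_eq_sum_proots[OF G])
    also have "\<dots> = (\<Sum>z\<in>#C. of_real (Re z ^ j))"
    proof (intro arg_cong[of _ _ sum_mset] image_mset_cong)
      fix z assume "z \<in># C"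
      then have "z = of_real (Re z)" using C_bounds by (simp add: complex_eq_iff)
      then show "z ^ j = of_real (Re z ^ j)" by (metis of_real_power)
    qed
    finally show ?thesis by (simp add: E_def image_mset.compositionality comp_def)
  qed
  \<comment> \<open>The rank bound: the nonzero eigenvalues agree with those of the k by k product
    in the other order, which has only k eigenvalues.\<close>
  have size_nz: "size (filter_mset (\<lambda>z. z \<noteq> 0) C) \<le> k"
  proof -
    define G' where "G' = mat_adjoint B * B"
    have G': "G' \<in> carrier_mat k k" using B Bc by (simp add: G'_def)
    have "(\<Sum>z\<in>#proots (char_poly G). z ^ Suc j) = (\<Sum>z\<in>#proots (char_poly G'). z ^ Suc j)" for j
      unfolding trace_pow_eq_sum_proots[OF G, symmetric] trace_pow_eq_sum_proots[OF G', symmetric]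
      unfolding G_def G'_def by (rule trace_pow_mult_commute[OF B Bc])
    then have "filter_mset (\<lambda>z. z \<noteq> 0) C = filter_mset (\<lambda>z. z \<noteq> 0) (proots (char_poly G'))"
      unfolding C_def by (rule nonzero_filter_eq_if_power_sums_eq)
    then have "size (filter_mset (\<lambda>z. z \<noteq> 0) C) \<le> size (proots (char_poly G'))"
      by (simp add: size_filter_mset_lesseq)
    then show ?thesis using degree_monic_char_poly[OF G'] by (simp add: size_proots_complex)
  qed
  define ys where "ys = sorted_list_of_multiset (image_mset (\<lambda>z. sqrt (Re z)) C)"
  have mset_ys: "mset ys = image_mset sqrt E"
    by (simp add: ys_def E_def image_mset.compositionality comp_def)
  have sv: "singular_values (submatrix V \<Omega> T) = rev ys"
    by (simp add: singular_values_def ys_def C_def G_def B_def)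
  have len: "length ys = m"
    using arg_cong[OF mset_ys, of size] by (simp add: E_def sizeC)
  have "\<forall>y\<in>set ys. 0 \<le> y"
  proof -
    have "set ys = sqrt ` set_mset E" using arg_cong[OF mset_ys, of set_mset] by simp
    then show ?thesis using C_bounds by (auto simp: E_def)
  qed
  moreover have "length (filter (\<lambda>y. y \<noteq> 0) ys) \<le> min k m"
  proof -
    have "length (filter (\<lambda>y. y \<noteq> 0) ys) = size (filter_mset (\<lambda>y. y \<noteq> 0) (mset ys))"
      by (metis mset_filter size_mset)
    also have "\<dots> = size (filter_mset (\<lambda>z. sqrt (Re z) \<noteq> 0) C)"
      by (simp add: mset_ys E_def filter_mset_image_mset image_mset.compositionality comp_def)
    also have "filter_mset (\<lambda>z. sqrt (Re z) \<noteq> 0) C = filter_mset (\<lambda>z. z \<noteq> 0) C"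
      using C_bounds by (intro filter_mset_cong refl) (auto simp: complex_eq_iff)
    finally show ?thesis using size_nz size_filter_mset_lesseq[of "\<lambda>z. z \<noteq> 0" C] sizeC by simp
  qed
  ultimately have zeros: "\<forall>y\<in>set (drop (min k m) (rev ys)). y = 0"
    by (intro sorted_rev_drop_zeros) (auto simp: ys_def)
  have xs: "xs = take (min k m) (rev ys)" by (simp add: xs_def sv k_def m_def)
  have lenxs: "length xs = min k m" using len by (simp add: xs)
  show thesis
  proof (rule that[of E])
    show "0 \<le> x \<and> x \<le> 1" if "x \<in># E" for x using that C_bounds by (auto simp: E_def)
    show "length xs = min (card T) (card \<Omega>)" using lenxs by (simp add: k_def m_def)
    fix f :: "real \<Rightarrow> real"
    have "(\<Sum>x\<in>#E. f (sqrt x)) = (\<Sum>y\<in>#mset ys. f y)"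
      by (simp add: mset_ys image_mset.compositionality comp_def)
    also have "\<dots> = (\<Sum>y\<leftarrow>rev ys. f y)" by (metis mset_map mset_rev sum_mset_sum_list)
    also have "\<dots> = (\<Sum>y\<leftarrow>xs. f y) + (\<Sum>y\<leftarrow>drop (min k m) (rev ys). f y)"
      unfolding xs by (metis append_take_drop_id map_append sum_list_append)
    also have "(\<Sum>y\<leftarrow>drop (min k m) (rev ys). f y) = (\<Sum>y\<leftarrow>drop (min k m) (rev ys). f 0)"
      using zeros by (intro arg_cong[of _ _ sum_list] map_cong) auto
    also have "\<dots> = (real m - min k m) * f 0"
      by (simp add: sum_list_const_mult[where f = "\<lambda>_. 1"] sum_list_triv len of_nat_diff)
    finally show "(\<Sum>x\<leftarrow>xs. f x) = (\<Sum>x\<in>#E. f (sqrt x)) - (real (card \<Omega>) - min (card T) (card \<Omega>)) * f 0"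
      by (simp add: k_def m_def)
  qed (rule moments)
qed

section \<open>The limit measure\<close>

definition "angle_measure = restrict_space lborel {0..pi}"

lemma finite_measure_angle: "finite_measure angle_measure"
  unfolding angle_measure_def
  by (rule finite_measureI) (simp add: emeasure_restrict_space space_restrict_space)

interpretation angle: finite_measure angle_measure
  by (rule finite_measure_angle)

lemma borel_measurable_angle [measurable (raw)]:
  "f \<in> borel_measurable borel \<Longrightarrow> f \<in> borel_measurable angle_measure"
  by (simp add: angle_measure_def measurable_restrict_space1)

lemma integrable_angle:
  fixes f :: "real \<Rightarrow> real"
  assumes "f \<in> borel_measurable borel" "\<And>x. \<bar>f x\<bar> \<le> B"
  shows "integrable angle_measure f"
  using assms by (intro angle.integrable_const_bound[where B = B]) auto

lemma integral_angle: "integral\<^sup>L angle_measure f = (LINT x:{0..pi}|lborel. f x)"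
  for f :: "real \<Rightarrow> real"
  by (simp add: angle_measure_def integral_restrict_space set_lebesgue_integral_def)

lemma integral_angle_cos: "(\<integral>x. cos (real k * x) \<partial>angle_measure) = (if k = 0 then pi else 0)"
proof (cases "k = 0")
  case False
  have "(\<integral>x. cos (real k * x) * indicator {0..pi} x \<partial>lborel) = sin (real k * pi) / k - sin (real k * 0) / k"
    using False by (intro integral_FTC_Icc_real) (auto intro!: derivative_eq_intros continuous_intros)
  then show ?thesis
    using False by (simp add: integral_angle set_lebesgue_integral_def mult.commute sin_npi)
next
  case True
  have "measure angle_measure (space angle_measure) = pi"
    by (simp add: angle_measure_def measure_restrict_space space_restrict_space)
  then show ?thesis using True by simp
qed

text \<open>The denominator is |1 - r exp(i x)|^2, that of the Poisson kernel. The squared sine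
  keeps the quotient bounded also for |r| = 1, a case that occurs for p = q and for p + q =
  1.\<close>

definition poisson_weight :: "real \<Rightarrow> real \<Rightarrow> real" where
  "poisson_weight r x = (sin x)\<^sup>2 / (1 - 2 * r * cos x + r\<^sup>2)"

lemma poisson_denominator_ge: "(sin x)\<^sup>2 \<le> 1 - 2 * r * cos x + (r::real)\<^sup>2"
proof -
  have "1 - 2 * r * cos x + r\<^sup>2 - (sin x)\<^sup>2 = (r - cos x)\<^sup>2"
    by (simp add: sin_squared_eq power2_diff algebra_simps)
  then show ?thesis by (metis diff_ge_0_iff_ge zero_le_power2)
qed

lemma poisson_weight_bounds: "0 \<le> poisson_weight r x" "poisson_weight r x \<le> 1"
proof -
  have d: "0 \<le> 1 - 2 * r * cos x + r\<^sup>2"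
    by (rule order_trans[OF zero_le_power2 poisson_denominator_ge])
  show "0 \<le> poisson_weight r x"
    unfolding poisson_weight_def by (rule divide_nonneg_nonneg[OF zero_le_power2 d])
  show "poisson_weight r x \<le> 1"
  proof (cases "1 - 2 * r * cos x + r\<^sup>2 = 0")
    case False
    then have "0 < 1 - 2 * r * cos x + r\<^sup>2" using d by linarith
    then show ?thesis
      unfolding poisson_weight_def using poisson_denominator_ge by (simp only: divide_le_eq_1_pos)
  qed (simp add: poisson_weight_def)
qed

text \<open>Valid also at a zero of the denominator: there the sine vanishes too.\<close>

lemma poisson_weight_mult: "poisson_weight r x * (1 - 2 * r * cos x + r\<^sup>2) = (sin x)\<^sup>2"
proof (cases "1 - 2 * r * cos x + r\<^sup>2 = 0")
  case True
  then have "(sin x)\<^sup>2 \<le> 0" using poisson_denominator_ge[of x r] by simp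
  then show ?thesis using True by simp
qed (simp add: poisson_weight_def)

lemma poisson_weight_measurable [measurable]: "poisson_weight r \<in> borel_measurable borel"
  unfolding poisson_weight_def by measurable

definition poisson_moment :: "real \<Rightarrow> nat \<Rightarrow> real" where
  "poisson_moment r k = (\<integral>x. poisson_weight r x * cos (real k * x) \<partial>angle_measure)"

lemma abs_mult_cos_le: "\<bar>a\<bar> \<le> 1 \<Longrightarrow> \<bar>a * cos y\<bar> \<le> (1::real)"
  using mult_mono[of "\<bar>a\<bar>" 1 "\<bar>cos y\<bar>" 1] by (simp add: abs_mult)

lemma abs_poisson_weight_cos: "\<bar>poisson_weight r x * cos y\<bar> \<le> 1"
  using poisson_weight_bounds[of r x] by (intro abs_mult_cos_le) auto

lemma integrable_poisson: "integrable angle_measure (\<lambda>x. poisson_weight r x * cos (real k * x))"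
  by (rule integrable_angle[where B = 1]) (auto simp: abs_poisson_weight_cos)

lemma integrable_cos: "integrable angle_measure (\<lambda>x. cos (real k * x))"
  by (rule integrable_angle[where B = 1]) auto

lemma abs_poisson_moment_le: "\<bar>poisson_moment r k\<bar> \<le> pi"
proof -
  have "\<bar>poisson_moment r k\<bar> \<le> (\<integral>x. \<bar>poisson_weight r x * cos (real k * x)\<bar> \<partial>angle_measure)"
    unfolding poisson_moment_def by (rule integral_abs_bound)
  also have "\<dots> \<le> (\<integral>x. 1 \<partial>angle_measure)"
    by (intro integral_mono integrable_abs integrable_poisson) (auto simp: abs_poisson_weight_cos)
  also have "\<dots> = pi" using integral_angle_cos[of 0] by simp
  finally show ?thesis .
qed

lemma integral_linear_combination3:
  fixes f g h :: "'a \<Rightarrow> real"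
  assumes "integrable M f" "integrable M g" "integrable M h"
  shows "(\<integral>x. a * f x + b * g x + c * h x \<partial>M) = a * integral\<^sup>L M f + b * integral\<^sup>L M g + c * integral\<^sup>L M h"
  using assms by simp

lemma integral_angle_sin_square_cos:
  "(\<integral>x. (sin x)\<^sup>2 * cos (real k * x) \<partial>angle_measure) = (if k = 0 then pi / 2 else if k = 2 then - pi / 4 else 0)"
proof -
  \<comment> \<open>The absolute value of k - 2 as a natural number: the product formula yields the
    frequencies k + 2 and k - 2, and the cosine is even.\<close>
  define j where "j = (if k = 0 then 2 else if k = 1 then 1 else k - 2)"
  have j: "cos (real j * x) = cos (real k * x - 2 * x)" for x
  proof -
    consider "k = 0" | "k = 1" | "k \<ge> 2" by linarith
    then show ?thesis
    proof cases
      case 2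
      have "cos (x - 2 * x) = cos x" using cos_minus[of x] by simp
      then show ?thesis using 2 by (simp add: j_def)
    qed (auto simp: j_def of_nat_diff algebra_simps)
  qed
  have *: "(sin x)\<^sup>2 * cos (real k * x) =
      1 / 2 * cos (real k * x) + - 1 / 4 * cos (real (k + 2) * x) + - 1 / 4 * cos (real j * x)" for x
  proof -
    have "(sin x)\<^sup>2 * cos (real k * x) = (1 - cos (2 * x)) / 2 * cos (real k * x)"
      using cos_double_sin[of x] by simp
    moreover have "cos (real (k + 2) * x) + cos (real j * x) = 2 * cos (2 * x) * cos (real k * x)"
      unfolding j using cos_add[of "real k * x" "2 * x"] cos_diff[of "real k * x" "2 * x"]
      by (simp add: algebra_simps)
    ultimately show ?thesis by (simp add: field_simps)
  qed
  have "(\<integral>x. (sin x)\<^sup>2 * cos (real k * x) \<partial>angle_measure) =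
      1 / 2 * (if k = 0 then pi else 0) + - 1 / 4 * (if k + 2 = 0 then pi else 0)
        + - 1 / 4 * (if j = 0 then pi else 0)"
    unfolding * integral_linear_combination3[OF integrable_cos integrable_cos integrable_cos]
      integral_angle_cos ..
  then show ?thesis by (auto simp: j_def split: if_splits)
qed

text \<open>Multiplying the weight by its denominator turns 2 cos x into a shift of the frequency by
  one in both directions. The right side is the cosine coefficient of the squared sine at frequency
  k + 1, nonzero only at frequency 2.\<close>

lemma poisson_moment_recurrence:
  "(1 + r\<^sup>2) * poisson_moment r (Suc k) - r * (poisson_moment r (Suc (Suc k)) + poisson_moment r k) =
     (if k = 1 then - pi / 4 else 0)"
proof -
  have *: "(sin x)\<^sup>2 * cos (real (Suc k) * x) =
      (1 + r\<^sup>2) * (poisson_weight r x * cos (real (Suc k) * x)) +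
      - r * (poisson_weight r x * cos (real (Suc (Suc k)) * x)) +
      - r * (poisson_weight r x * cos (real k * x))" for x
  proof -
    have "cos (real (Suc (Suc k)) * x) + cos (real k * x) = 2 * cos x * cos (real (Suc k) * x)"
      using cos_add[of "real (Suc k) * x" x] cos_diff[of "real (Suc k) * x" x] by (simp add: algebra_simps)
    then have *: "cos (real (Suc (Suc k)) * x) = 2 * cos x * cos (real (Suc k) * x) - cos (real k * x)"
      by simp
    show ?thesis
      unfolding poisson_weight_mult[of r x, symmetric] *
      by (simp add: algebra_simps del: of_nat_Suc)
  qed
  have "(\<integral>x. (sin x)\<^sup>2 * cos (real (Suc k) * x) \<partial>angle_measure) =
    (1 + r\<^sup>2) * poisson_moment r (Suc k) + - r * poisson_moment r (Suc (Suc k)) + - r * poisson_moment r k"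
    unfolding * poisson_moment_def
    by (rule integral_linear_combination3[OF integrable_poisson integrable_poisson integrable_poisson])
  then have "(1 + r\<^sup>2) * poisson_moment r (Suc k) - r * (poisson_moment r (Suc (Suc k)) + poisson_moment r k) =
      (\<integral>x. (sin x)\<^sup>2 * cos (real (Suc k) * x) \<partial>angle_measure)"
    by (simp add: algebra_simps)
  then show ?thesis
    unfolding integral_angle_sin_square_cos by (auto split: if_splits)
qed

lemma poisson_moment_recurrence_0:
  "(1 + r\<^sup>2) * poisson_moment r 0 - 2 * r * poisson_moment r 1 = pi / 2"
proof -
  have *: "(sin x)\<^sup>2 * cos (real 0 * x) =
      (1 + r\<^sup>2) * (poisson_weight r x * cos (real 0 * x)) + - 2 * r * (poisson_weight r x * cos (real 1 * x))
        + 0 * (poisson_weight r x * cos (real 0 * x))" for x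
    unfolding poisson_weight_mult[of r x, symmetric] by (simp add: algebra_simps)
  have "(\<integral>x. (sin x)\<^sup>2 * cos (real 0 * x) \<partial>angle_measure) =
    (1 + r\<^sup>2) * poisson_moment r 0 + - 2 * r * poisson_moment r 1 + 0 * poisson_moment r 0"
    unfolding * poisson_moment_def
    by (rule integral_linear_combination3[OF integrable_poisson integrable_poisson integrable_poisson])
  then show ?thesis
    unfolding integral_angle_sin_square_cos by simp
qed

text \<open>The recurrence has the characteristic roots r and 1 / r, and the moments are bounded.
  For |r| < 1 boundedness excludes the growing solution. For |r| = 1 it excludes nothing, but then
  the weight is (1 + r cos x) / 2 almost everywhere and is integrated directly.\<close>

lemma poisson_moment_eq:
  assumes r: "\<bar>r\<bar> \<le> 1" "r \<noteq> 0"
  shows "poisson_moment r 0 = pi / 2" (is ?A) and "poisson_moment r 1 = r * pi / 4" (is ?B)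
    and "poisson_moment r (k + 2) = pi / 4 * (r ^ (k + 2) - r ^ k)" (is ?C)
proof -
  have "?A \<and> ?B \<and> (\<forall>k. poisson_moment r (k + 2) = pi / 4 * (r ^ (k + 2) - r ^ k))"
  proof (cases "\<bar>r\<bar> = 1")
    case True
    have r2: "r * r = 1" using True by (metis abs_mult_self_eq mult_1)
    \<comment> \<open>At the endpoint with r cos x = 1 the weight is 0 / 0 = 0, whereas the formula
      gives 1.\<close>
    have "AE x in lborel. x \<noteq> (0::real) \<and> x \<noteq> pi"
      using AE_lborel_singleton[of 0] AE_lborel_singleton[of pi] by auto
    then have "AE x in angle_measure. x \<noteq> 0 \<and> x \<noteq> pi"
      unfolding angle_measure_def by (subst AE_restrict_space_iff) auto
    moreover have "AE x in angle_measure. x \<in> {0..pi}"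
      by (rule AE_I2) (simp add: angle_measure_def space_restrict_space)
    ultimately have AE: "AE x in angle_measure. poisson_weight r x = (1 + r * cos x) / 2"
    proof eventually_elim
      case (elim x)
      have "cos x \<noteq> 1" "cos x \<noteq> - 1"
        using elim cos_inj_pi[of x 0] cos_inj_pi[of x pi] by auto
      then have ne: "1 - r * cos x \<noteq> 0" using True by (auto simp: abs_if split: if_splits)
      have "2 * (1 - r * cos x) * poisson_weight r x = (1 - r * cos x) * (1 + r * cos x)"
      proof -
        have r2': "r\<^sup>2 = 1" using r2 by (simp add: power2_eq_square)
        have "2 * (1 - r * cos x) * poisson_weight r x = poisson_weight r x * (1 - 2 * r * cos x + r\<^sup>2)"
          unfolding r2' by (simp add: algebra_simps)
        also have "\<dots> = 1 - r\<^sup>2 * (cos x)\<^sup>2"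
          unfolding poisson_weight_mult unfolding r2' by (simp add: sin_squared_eq)
        also have "\<dots> = (1 - r * cos x) * (1 + r * cos x)"
          by (simp add: algebra_simps power2_eq_square)
        finally show ?thesis .
      qed
      then have "(1 - r * cos x) * (2 * poisson_weight r x) = (1 - r * cos x) * (1 + r * cos x)"
        by (simp only: ac_simps)
      then have "2 * poisson_weight r x = 1 + r * cos x" using ne by simp
      then show ?case by simp
    qed
    have mom: "poisson_moment r k = (\<integral>x. (1 + r * cos x) / 2 * cos (real k * x) \<partial>angle_measure)" for k
      unfolding poisson_moment_def by (intro integral_cong_AE) (use AE in auto)
    have mom_Suc: "poisson_moment r (Suc k) = r / 4 * (if k = 0 then pi else 0)" for k
    proof -
      have *: "(1 + r * cos x) / 2 * cos (real (Suc k) * x) =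
         1 / 2 * cos (real (Suc k) * x) + r / 4 * cos (real (Suc (Suc k)) * x) + r / 4 * cos (real k * x)" for x
      proof -
        have "cos (real (Suc (Suc k)) * x) + cos (real k * x) = 2 * cos x * cos (real (Suc k) * x)"
          using cos_add[of "real (Suc k) * x" x] cos_diff[of "real (Suc k) * x" x] by (simp add: algebra_simps)
        then have *: "cos (real (Suc (Suc k)) * x) = 2 * cos x * cos (real (Suc k) * x) - cos (real k * x)"
          by simp
        show ?thesis unfolding * by (simp add: algebra_simps add_divide_distrib del: of_nat_Suc)
      qed
      show ?thesis
        unfolding mom * integral_linear_combination3[OF integrable_cos integrable_cos integrable_cos]
          integral_angle_cos by simp
    qed
    have *: "(1 + r * cos x) / 2 * cos (real 0 * x) =
        1 / 2 * cos (real 0 * x) + r / 2 * cos (real 1 * x) + 0 * cos (real 0 * x)" for x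
      by (simp add: algebra_simps)
    have "poisson_moment r 0 = pi / 2"
      unfolding mom * integral_linear_combination3[OF integrable_cos integrable_cos integrable_cos]
        integral_angle_cos by simp
    moreover have "r ^ (k + 2) - r ^ k = 0" for k using r2 by (simp add: mult.assoc[symmetric])
    ultimately show ?thesis using mom_Suc[of 0] mom_Suc[of "Suc _"] by auto
  next
    case False
    then have r1: "\<bar>r\<bar> < 1" using r by simp
    \<comment> \<open>Splits off the root r. What remains is of first order with ratio 1 / r beyond
      the inhomogeneity, so boundedness forces \<open>G\<close> to vanish from index 2 on.\<close>
    define G where "G k = poisson_moment r (Suc k) - r * poisson_moment r k" for k
    have step: "r * G (Suc k) = G k - (if k = 1 then - pi / 4 else 0)" for k
      using poisson_moment_recurrence[of r k] unfolding G_def by (simp add: algebra_simps power2_eq_square)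
    have bound: "\<bar>G k\<bar> \<le> 2 * pi" for k
    proof -
      have "\<bar>r * poisson_moment r k\<bar> \<le> 1 * pi"
        unfolding abs_mult using r abs_poisson_moment_le[of r k] by (intro mult_mono) auto
      then show ?thesis using abs_poisson_moment_le[of r "Suc k"] unfolding G_def by linarith
    qed
    have iter: "G 2 = r ^ j * G (j + 2)" for j
    proof (induction j)
      case (Suc j)
      have "r * G (Suc (j + 2)) = G (j + 2)" using step[of "j + 2"] by simp
      moreover have "r ^ Suc j * G (Suc j + 2) = r ^ j * (r * G (Suc (j + 2)))"
        by (simp add: ac_simps)
      ultimately show ?case using Suc by simp
    qed (simp add: numeral_2_eq_2)
    have "(\<lambda>j. \<bar>r\<bar> ^ j * (2 * pi)) \<longlonglongrightarrow> 0 * (2 * pi)"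
      using r1 by (intro tendsto_intros LIMSEQ_power_zero) auto
    moreover have "\<bar>G 2\<bar> \<le> \<bar>r\<bar> ^ j * (2 * pi)" for j
      using bound[of "j + 2"] by (subst iter[of j]) (auto simp: abs_mult power_abs intro!: mult_left_mono)
    ultimately have "\<bar>G 2\<bar> \<le> 0"
      using LIMSEQ_le_const[of "\<lambda>j. \<bar>r\<bar> ^ j * (2 * pi)" 0 "\<bar>G 2\<bar>"] by auto
    then have G2: "G 2 = 0" by simp
    have Gk: "G (k + 2) = 0" for k using iter[of k] G2 r by simp
    have G1: "G 1 = - pi / 4" using step[of 1] G2 by (simp add: numeral_2_eq_2)
    have G0: "G 0 = - r * pi / 4" using step[of 0] G1 by simp
    have m1: "poisson_moment r 1 = G 0 + r * poisson_moment r 0" by (simp add: G_def)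
    have "(1 - r\<^sup>2) * poisson_moment r 0 = (1 - r\<^sup>2) * (pi / 2)"
      using poisson_moment_recurrence_0[of r] unfolding m1 G0 by (simp add: algebra_simps power2_eq_square)
    moreover have "1 - r\<^sup>2 \<noteq> 0" using r1 by (simp add: abs_square_eq_1)
    ultimately have A: ?A by simp
    have B: ?B using m1 G0 A by (simp add: field_simps)
    have "poisson_moment r (k + 2) = pi / 4 * (r ^ (k + 2) - r ^ k)" for k
    proof (induction k)
      case 0
      have "poisson_moment r 2 - r * (r * pi / 4) = - pi / 4"
        using G1 unfolding G_def B[symmetric] by (simp add: numeral_2_eq_2)
      then have "poisson_moment r 2 = - pi / 4 + r * (r * pi / 4)" by linarith
      then show ?case by (simp add: field_simps power2_eq_square numeral_2_eq_2)
    next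
      case (Suc k)
      have "poisson_moment r (Suc k + 2) = r * poisson_moment r (k + 2)"
        using Gk[of k] by (simp add: G_def)
      then show ?case unfolding Suc by (simp add: algebra_simps)
    qed
    with A B show ?thesis by blast
  qed
  then show ?A ?B ?C by auto
qed

lemma centered_cheb_sum_powers:
  assumes "v + w = x - c" "v * w = D"
  shows "centered_cheb c D k x = v ^ k + w ^ k"
proof (induction k rule: induct_nat_012)
  case (ge2 k)
  have "(x - c) * (v ^ Suc k + w ^ Suc k) - D * (v ^ k + w ^ k) = v ^ Suc (Suc k) + w ^ Suc (Suc k)"
    unfolding assms[symmetric] by (simp add: algebra_simps)
  then show ?case using ge2 by simp
qed (use assms in auto)

text \<open>The two roots are - d exp(i t) and - d exp(- i t), which links the polynomials to
  Chebyshev polynomials of the first kind.\<close>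

lemma centered_cheb_cos:
  "centered_cheb c (d\<^sup>2) k (c - 2 * d * cos t) = 2 * (- d) ^ k * cos (real k * t)"
proof (induction k rule: induct_nat_012)
  case (ge2 k)
  have "cos (real (Suc (Suc k)) * t) + cos (real k * t) = 2 * cos t * cos (real (Suc k) * t)"
    using cos_add[of "real (Suc k) * t" t] cos_diff[of "real (Suc k) * t" t] by (simp add: algebra_simps)
  then have *: "cos (real (Suc (Suc k)) * t) = 2 * cos t * cos (real (Suc k) * t) - cos (real k * t)"
    by simp
  show ?case
    unfolding centered_cheb.simps ge2 *
    by (simp add: algebra_simps power2_eq_square del: of_nat_Suc)
qed simp_all

text \<open>The denominator is max(a, b) |1 - r exp(i t)|^2 with r = e min(a, b) / d, because d^2 is
  the product of the minimum and the maximum. Putting the minimum into r ensures |r| <= 1.\<close>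

lemma poisson_kernel_scaled:
  fixes a b d e :: real
  assumes ab: "0 < a" "0 < b" and d: "0 < d" "d\<^sup>2 = a * b" and e: "e\<^sup>2 = 1"
  shows "(sin t)\<^sup>2 / (a + b - 2 * e * d * cos t) = min a b / d\<^sup>2 * poisson_weight (e * min a b / d) t"
proof -
  have mM: "min a b * max a b = d\<^sup>2" using d by (auto simp: min_def max_def)
  have M: "max a b > 0" using ab by simp
  have "max a b * (1 - 2 * (e * min a b / d) * cos t + (e * min a b / d)\<^sup>2)
      = max a b - 2 * e * (min a b * max a b / d) * cos t + e\<^sup>2 * (min a b * (min a b * max a b) / d\<^sup>2)"
    by (simp add: algebra_simps power2_eq_square)
  also have "\<dots> = a + b - 2 * e * d * cos t"
    unfolding mM e using d(1) by (simp add: power2_eq_square min_def max_def)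
  finally have "a + b - 2 * e * d * cos t = max a b * (1 - 2 * (e * min a b / d) * cos t + (e * min a b / d)\<^sup>2)" ..
  moreover have "1 / max a b = min a b / d\<^sup>2"
    using mM M d ab by (simp add: field_simps)
  ultimately show ?thesis
    unfolding poisson_weight_def by (metis mult_1 times_divide_times_eq)
qed

text \<open>The sign e = 1 serves 1 / x and e = -1 serves 1 / (1 - x). The extra terms at k = 0 and
  k = 1 arise because the moments of these orders do not follow the general pattern.\<close>

lemma integral_poisson_kernel_scaled:
  fixes a b d e :: real
  assumes ab: "0 < a" "0 < b" and d: "0 < d" "d\<^sup>2 = a * b" and e: "e = 1 \<or> e = - 1"
  shows "(\<integral>t. 2 * d\<^sup>2 / pi * ((sin t)\<^sup>2 / (a + b - 2 * e * d * cos t)) * (2 * (- d) ^ k * cos (real k * t)) \<partial>angle_measure)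
    = (- e * min a b) ^ k * (min a b - max a b) + (if k = 0 then a + b else if k = 1 then - e * d\<^sup>2 else 0)"
proof -
  define m where "m = min a b"
  define M where "M = max a b"
  define r where "r = e * m / d"
  have m: "0 < m" "m * M = d\<^sup>2" "m + M = a + b" "m \<le> M"
    using ab d by (auto simp: m_def M_def min_def max_def)
  have e2: "e\<^sup>2 = 1" using e by auto
  have "m * m \<le> m * M" using m by (intro mult_left_mono) auto
  then have "m\<^sup>2 \<le> d\<^sup>2" using m(2) by (simp add: power2_eq_square)
  then have "m \<le> d" by (rule power2_le_imp_le) (use d(1) in simp)
  moreover have "\<bar>r\<bar> = m / d" using m(1) d(1) e by (auto simp: r_def)
  ultimately have r: "\<bar>r\<bar> \<le> 1" "r \<noteq> 0" using m(1) d(1) by auto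
  have "(\<integral>t. 2 * d\<^sup>2 / pi * ((sin t)\<^sup>2 / (a + b - 2 * e * d * cos t)) * (2 * (- d) ^ k * cos (real k * t)) \<partial>angle_measure)
     = (\<integral>t. 4 * m / pi * (- d) ^ k * (poisson_weight r t * cos (real k * t)) \<partial>angle_measure)"
    unfolding poisson_kernel_scaled[OF ab d e2] m_def[symmetric] r_def[symmetric]
    using d ab by (intro Bochner_Integration.integral_cong refl) simp
  also have "\<dots> = 4 * m / pi * (- d) ^ k * poisson_moment r k"
    unfolding poisson_moment_def by (rule integral_mult_right_zero)
  also have "\<dots> = (- e * m) ^ k * (m - M) + (if k = 0 then a + b else if k = 1 then - e * d\<^sup>2 else 0)"
  proof -
    consider "k = 0" | "k = 1" | j where "k = j + 2" by (metis One_nat_def add_2_eq_Suc' not0_implies_Suc)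
    then show ?thesis
    proof cases
      case 1
      then show ?thesis using m(3) by (simp add: poisson_moment_eq[OF r])
    next
      case 2
      then show ?thesis
        using d(1) m(2) poisson_moment_eq(2)[OF r] by (simp add: r_def field_simps)
    next
      case 3
      have "4 * m / pi * (- d) ^ k * poisson_moment r k = m * ((- d) ^ j * r ^ j) * (d\<^sup>2 * r\<^sup>2 - d\<^sup>2)"
        unfolding 3 poisson_moment_eq(3)[OF r] by (simp add: power_add algebra_simps power2_eq_square)
      also have "(- d) ^ j * r ^ j = (- e * m) ^ j"
        using d(1) by (simp add: r_def flip: power_mult_distrib)
      also have "d\<^sup>2 * r\<^sup>2 = m\<^sup>2"
        using d(1) e2 by (simp add: r_def power_mult_distrib power_divide)
      also have "m * (- e * m) ^ j * (m\<^sup>2 - d\<^sup>2) = (- e * m) ^ k * (m - M)"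
      proof -
        have "(- e * m) ^ k = (- e * m) ^ j * m\<^sup>2"
        proof -
          have "(- e * m)\<^sup>2 = m\<^sup>2" using e2 by (simp add: power_mult_distrib)
          then show ?thesis by (simp only: 3 power_add)
        qed
        then show ?thesis
          by (simp only: m(2)[symmetric]) (simp add: algebra_simps power2_eq_square)
      qed
      finally show ?thesis using 3 by simp
    qed
  qed
  finally show ?thesis by (simp add: m_def M_def)
qed

section \<open>The limit law in the angle variable\<close>

locale wachter_parameters =
  fixes p q :: real
  assumes p: "0 < p" "p < 1" and q: "0 < q" "q < 1"
begin

definition "edge_radius = sqrt (p * (1 - q)) * sqrt (q * (1 - p))"
definition "edge_mean = p + q - 2 * p * q"
definition "spectral_point t = edge_mean - 2 * edge_radius * cos t"
text \<open>The absolutely continuous part of the limit law in the variable t, scaled by 1 - max p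
  q. Splitting 1 / (x (1 - x)) into partial fractions separates two Poisson kernels.\<close>

definition "spectral_weight t = 2 * edge_radius\<^sup>2 / pi * ((sin t)\<^sup>2 / spectral_point t + (sin t)\<^sup>2 / (1 - spectral_point t))"

lemma edge_radius_pos: "0 < edge_radius"
  and edge_radius_square: "edge_radius\<^sup>2 = (p * (1 - q)) * (q * (1 - p))"
  using p q by (auto simp: edge_radius_def power_mult_distrib)

lemma r_minus_square: "(r_minus p q)\<^sup>2 = edge_mean - 2 * edge_radius"
  and r_plus_square: "(r_plus p q)\<^sup>2 = edge_mean + 2 * edge_radius"
  using p q unfolding r_minus_def r_plus_def edge_mean_def edge_radius_def
  by (simp_all add: power2_diff power2_sum algebra_simps)

lemma r_nonneg: "0 \<le> r_minus p q" "0 \<le> r_plus p q"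
  using p q by (auto simp: r_minus_def r_plus_def)

lemma r_plus_le_1: "r_plus p q \<le> 1"
proof -
  have "0 \<le> (sqrt ((1 - p) * (1 - q)) - sqrt (p * q))\<^sup>2" by simp
  also have "\<dots> = (1 - p) * (1 - q) + p * q - 2 * (sqrt ((1 - p) * (1 - q)) * sqrt (p * q))"
    using p q by (simp add: power2_diff)
  also have "sqrt ((1 - p) * (1 - q)) * sqrt (p * q) = edge_radius"
    unfolding edge_radius_def by (simp add: ac_simps flip: real_sqrt_mult)
  finally have "(r_plus p q)\<^sup>2 \<le> 1\<^sup>2"
    unfolding r_plus_square edge_mean_def by (simp add: algebra_simps)
  then show ?thesis by (rule power2_le_imp_le) simp
qed

lemma spectral_point_bounds:
  assumes "0 < t" "t < pi"
  shows "(r_minus p q)\<^sup>2 < spectral_point t" "spectral_point t < (r_plus p q)\<^sup>2"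
    "0 < spectral_point t" "spectral_point t < 1"
proof -
  have "cos t < 1" "- 1 < cos t"
    using cos_monotone_0_pi[of 0 t] cos_monotone_0_pi[of t pi] assms by auto
  then show *: "(r_minus p q)\<^sup>2 < spectral_point t" "spectral_point t < (r_plus p q)\<^sup>2"
    using mult_strict_left_mono[of "cos t" 1 edge_radius] mult_strict_left_mono[of "-1" "cos t" edge_radius] edge_radius_pos
    unfolding r_minus_square r_plus_square spectral_point_def by linarith+
  show "0 < spectral_point t" using *(1) by (rule order_le_less_trans[OF zero_le_power2])
  have "(r_plus p q)\<^sup>2 \<le> 1" using r_plus_le_1 r_nonneg by (simp add: power_le_one)
  then show "spectral_point t < 1" using *(2) by simp
qed

text \<open>Makes sign and boundedness visible, although 1 / x or 1 / (1 - x) blows up at an edge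
  when p = q or p + q = 1.\<close>

lemma spectral_weight_poisson:
  "spectral_weight t = 2 / pi * (min (p * (1 - q)) (q * (1 - p)) * poisson_weight (min (p * (1 - q)) (q * (1 - p)) / edge_radius) t
    + min ((1 - p) * (1 - q)) (p * q) * poisson_weight (- min ((1 - p) * (1 - q)) (p * q) / edge_radius) t)"
proof -
  have 1: "spectral_point t = p * (1 - q) + q * (1 - p) - 2 * 1 * edge_radius * cos t"
    by (simp add: spectral_point_def edge_mean_def algebra_simps)
  have 2: "1 - spectral_point t = (1 - p) * (1 - q) + p * q - 2 * (- 1) * edge_radius * cos t"
    by (simp add: spectral_point_def edge_mean_def algebra_simps)
  have 3: "edge_radius\<^sup>2 = ((1 - p) * (1 - q)) * (p * q)"
    by (simp add: edge_radius_square)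
  have *: "2 * E / pi * (x / E * v + y / E * w) = 2 / pi * (x * v + y * w)" if "E \<noteq> 0" for E x y v w :: real
    using that by (simp add: field_simps)
  have e1: "(sin t)\<^sup>2 / spectral_point t =
      min (p * (1 - q)) (q * (1 - p)) / edge_radius\<^sup>2 * poisson_weight (1 * min (p * (1 - q)) (q * (1 - p)) / edge_radius) t"
    unfolding 1 by (rule poisson_kernel_scaled) (use p q edge_radius_pos edge_radius_square in auto)
  have e2: "(sin t)\<^sup>2 / (1 - spectral_point t) =
      min ((1 - p) * (1 - q)) (p * q) / edge_radius\<^sup>2 * poisson_weight (- 1 * min ((1 - p) * (1 - q)) (p * q) / edge_radius) t"
    unfolding 2 by (rule poisson_kernel_scaled) (use p q edge_radius_pos 3 in auto)
  have "edge_radius\<^sup>2 \<noteq> 0" using edge_radius_pos by simp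
  then show ?thesis
    unfolding spectral_weight_def e1 e2 by (subst *) simp_all
qed

lemma spectral_weight_measurable [measurable]: "spectral_weight \<in> borel_measurable borel"
  unfolding spectral_weight_def[abs_def] spectral_point_def by measurable

lemma spectral_weight_nonneg: "0 \<le> spectral_weight t"
  unfolding spectral_weight_poisson using p q poisson_weight_bounds(1)
  by (auto intro!: mult_nonneg_nonneg add_nonneg_nonneg)

lemma spectral_weight_le: "spectral_weight t \<le> 2"
proof -
  have "min (p * (1 - q)) (q * (1 - p)) \<le> 1" "min ((1 - p) * (1 - q)) (p * q) \<le> 1"
    using mult_le_one[of p "1 - q"] mult_le_one[of p q] p q by (auto simp: min_le_iff_disj)
  moreover have "0 \<le> min (p * (1 - q)) (q * (1 - p))" "0 \<le> min ((1 - p) * (1 - q)) (p * q)"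
    using p q by auto
  ultimately have "min (p * (1 - q)) (q * (1 - p)) * poisson_weight (min (p * (1 - q)) (q * (1 - p)) / edge_radius) t \<le> 1 * 1"
    "min ((1 - p) * (1 - q)) (p * q) * poisson_weight (- min ((1 - p) * (1 - q)) (p * q) / edge_radius) t \<le> 1 * 1"
    using poisson_weight_bounds by (intro mult_mono; simp)+
  then have "spectral_weight t \<le> 2 / pi * 2"
    unfolding spectral_weight_poisson by (intro mult_left_mono) auto
  also have "\<dots> \<le> 2" using pi_ge_two by (simp add: field_simps)
  finally show ?thesis .
qed

text \<open>The right side is what the trace formula predicts for the averages when the trace of the
  k-th power, divided by n, tends to 0 for k >= 1 and the densities of \<Omega> and T tend to
  \<alpha> and \<beta>. The continuous part alone yields expressions in minima and maxima; the atoms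
  at 1 and 0 turn them into formulas valid for every order of the parameters.\<close>

lemma integral_spectral_cheb:
  fixes \<alpha> \<beta> c D :: real
  assumes \<alpha>: "\<alpha> = 1 - q" and \<beta>: "\<beta> = 1 - p"
    and c: "c = \<alpha> + \<beta> - 2 * \<alpha> * \<beta>" and D: "D = \<alpha> * \<beta> * (1 - \<alpha>) * (1 - \<beta>)"
  shows "(\<integral>t. spectral_weight t * centered_cheb c D k (spectral_point t) \<partial>angle_measure)
      + max 0 (1 - (p + q)) * centered_cheb c D k 1 + max 0 (p - q) * centered_cheb c D k 0
    = of_bool (k = 0) + (\<alpha> + \<beta> - 1) * (\<alpha> * \<beta>) ^ k + (\<alpha> - \<beta>) * (- \<alpha> * (1 - \<beta>)) ^ k"
proof -
  let ?d = edge_radius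
  have cm: "c = edge_mean" by (simp add: c \<alpha> \<beta> edge_mean_def algebra_simps)
  have Dd: "D = ?d\<^sup>2" by (simp add: D \<alpha> \<beta> edge_radius_square)
  have cheb: "centered_cheb c D k (spectral_point t) = 2 * (- ?d) ^ k * cos (real k * t)" for t
    unfolding spectral_point_def cm Dd by (rule centered_cheb_cos)
  define a b a' b' where ab: "a = p * (1 - q)" "b = q * (1 - p)" "a' = (1 - p) * (1 - q)" "b' = p * q"
  have pos: "0 < a" "0 < b" "0 < a'" "0 < b'" using p q by (auto simp: ab)
  have d2: "?d\<^sup>2 = a * b" "?d\<^sup>2 = a' * b'" by (simp_all add: edge_radius_square ab)
  have 1: "spectral_point t = a + b - 2 * 1 * ?d * cos t" for t
    by (simp add: spectral_point_def edge_mean_def ab algebra_simps)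
  have 2: "1 - spectral_point t = a' + b' - 2 * (- 1) * ?d * cos t" for t
    by (simp add: spectral_point_def edge_mean_def ab algebra_simps)
  let ?f = "\<lambda>a b e t. 2 * ?d\<^sup>2 / pi * ((sin t)\<^sup>2 / (a + b - 2 * e * ?d * cos t)) * (2 * (- ?d) ^ k * cos (real k * t))"
  have int: "integrable angle_measure (?f a b e)" if "0 < a" "0 < b" "?d\<^sup>2 = a * b" "e\<^sup>2 = 1" for a b e
  proof -
    have *: "?f a b e t = 2 / pi * (min a b) * (2 * (- ?d) ^ k) * (poisson_weight (e * min a b / ?d) t * cos (real k * t))" for t
      unfolding poisson_kernel_scaled[OF that(1,2) edge_radius_pos that(3,4)]
      using edge_radius_pos by simp
    show ?thesis unfolding * by (intro integrable_mult_right integrable_poisson)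
  qed
  have "(\<integral>t. spectral_weight t * centered_cheb c D k (spectral_point t) \<partial>angle_measure)
      = (\<integral>t. ?f a b 1 t + ?f a' b' (- 1) t \<partial>angle_measure)"
    unfolding spectral_weight_def cheb 2 unfolding 1 by (simp only: distrib_left distrib_right)
  also have "\<dots> = (\<integral>t. ?f a b 1 t \<partial>angle_measure) + (\<integral>t. ?f a' b' (- 1) t \<partial>angle_measure)"
    by (rule Bochner_Integration.integral_add) (intro int pos d2; simp)+
  also have "\<dots> = (- 1 * min a b) ^ k * (min a b - max a b) + (if k = 0 then a + b else if k = 1 then - 1 * ?d\<^sup>2 else 0)
     + ((- (- 1) * min a' b') ^ k * (min a' b' - max a' b') + (if k = 0 then a' + b' else if k = 1 then - (- 1) * ?d\<^sup>2 else 0))"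
    by (intro arg_cong2[of _ _ _ _ "(+)"] integral_poisson_kernel_scaled pos edge_radius_pos d2) auto
  also have "\<dots> = (- min a b) ^ k * (min a b - max a b) + (min a' b') ^ k * (min a' b' - max a' b') + of_bool (k = 0)"
    by (auto simp: ab algebra_simps)
  finally have I: "(\<integral>t. spectral_weight t * centered_cheb c D k (spectral_point t) \<partial>angle_measure) =
      (- min a b) ^ k * (min a b - max a b) + (min a' b') ^ k * (min a' b' - max a' b') + of_bool (k = 0)" .
  have c1: "centered_cheb c D k 1 = a' ^ k + b' ^ k"
    by (rule centered_cheb_sum_powers) (simp_all add: c D ab \<alpha> \<beta> algebra_simps)
  have c0: "centered_cheb c D k 0 = (- a) ^ k + (- b) ^ k"
    by (rule centered_cheb_sum_powers) (simp_all add: c D ab \<alpha> \<beta> algebra_simps)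
  \<comment> \<open>The continuous part carries f at the smaller argument; an atom of mass max 0 (x
    - y) converts it to \<open>f x\<close> in either order.\<close>
  have *: "f (min x y) * (min x y - max x y) + max 0 (x - y) * (f x + f y) = (x - y) * f x"
    for x y :: real and f :: "real \<Rightarrow> real"
    by (cases "x \<le> y") (simp_all add: min_def max_def algebra_simps)
  have diffs: "p - q = a - b" "1 - (p + q) = a' - b'" by (simp_all add: ab algebra_simps)
  have A: "(- min a b) ^ k * (min a b - max a b) + max 0 (p - q) * ((- a) ^ k + (- b) ^ k) = (p - q) * (- a) ^ k"
    unfolding diffs by (rule *[of "\<lambda>x. (- x) ^ k"])
  have B: "(min a' b') ^ k * (min a' b' - max a' b') + max 0 (1 - (p + q)) * (a' ^ k + b' ^ k) = (1 - (p + q)) * a' ^ k"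
    unfolding diffs by (rule *[of "\<lambda>x. x ^ k"])
  have params: "\<alpha> + \<beta> - 1 = 1 - (p + q)" "\<alpha> - \<beta> = p - q" "\<alpha> * \<beta> = a'" "- \<alpha> * (1 - \<beta>) = - a"
    by (simp_all add: \<alpha> \<beta> ab algebra_simps)
  show ?thesis unfolding I c0 c1 params using A B by linarith
qed

end

text \<open>\<open>fs_measure\<close> is given by its values on sets, so the integral is built up
  from indicators.\<close>

lemma nn_integral_fs_measure:
  assumes [measurable]: "f \<in> borel_measurable borel"
  shows "(\<integral>\<^sup>+x. f x \<partial>fs_measure p q) =
    (\<integral>\<^sup>+x. ennreal (fs_density p q x) * f x \<partial>lborel) + ennreal (fs_atom p q) * f 1"
proof -
  have sets: "sets (fs_measure p q) = sets borel" "space (fs_measure p q) = UNIV"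
    by (simp_all add: fs_measure_def sets_measure_of_conv sets.sigma_sets_eq[of borel, simplified] space_measure_of_conv)
  have [measurable]: "fs_density p q \<in> borel_measurable borel"
    unfolding fs_density_def[abs_def] by measurable
  show ?thesis using assms
  proof (induction rule: borel_measurable_induct)
    case (cong f g)
    then have "f = g" by (auto simp: fun_eq_iff)
    then show ?case using cong by simp
  next
    case (set A)
    then show ?case
      using emeasure_fs_measure[of A p q] sets by simp
  next
    case (mult u c)
    have "(\<integral>\<^sup>+x. c * u x \<partial>fs_measure p q) = c * (\<integral>\<^sup>+x. u x \<partial>fs_measure p q)"
      using mult(2) sets by (intro nn_integral_cmult) (simp cong: measurable_cong_sets)
    moreover have "(\<integral>\<^sup>+x. ennreal (fs_density p q x) * (c * u x) \<partial>lborel) =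
        c * (\<integral>\<^sup>+x. ennreal (fs_density p q x) * u x \<partial>lborel)"
      using mult(2) by (subst nn_integral_cmult[symmetric]) (auto simp: ac_simps)
    ultimately show ?case using mult by (simp add: distrib_left ac_simps)
  next
    case (add u v)
    have "(\<integral>\<^sup>+x. v x + u x \<partial>fs_measure p q) = (\<integral>\<^sup>+x. v x \<partial>fs_measure p q) + (\<integral>\<^sup>+x. u x \<partial>fs_measure p q)"
      using add sets by (intro nn_integral_add) (simp_all cong: measurable_cong_sets)
    moreover have "(\<integral>\<^sup>+x. ennreal (fs_density p q x) * (v x + u x) \<partial>lborel) =
        (\<integral>\<^sup>+x. ennreal (fs_density p q x) * v x \<partial>lborel) + (\<integral>\<^sup>+x. ennreal (fs_density p q x) * u x \<partial>lborel)"
      using add by (subst nn_integral_add[symmetric]) (auto simp: distrib_left)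
    ultimately show ?case using add by (simp add: distrib_left ac_simps)
  next
    case (seq U)
    have incs: "incseq U" by fact
    have mono: "U i x \<le> U (Suc i) x" for i x using incseq_SucD[OF incs] by (simp add: le_fun_def)
    have "(\<integral>\<^sup>+x. (SUP i. U i) x \<partial>fs_measure p q) = (SUP i. \<integral>\<^sup>+x. U i x \<partial>fs_measure p q)"
      unfolding SUP_apply using seq sets
      by (intro nn_integral_monotone_convergence_SUP) (simp_all cong: measurable_cong_sets)
    also have "\<dots> = (SUP i. (\<integral>\<^sup>+x. ennreal (fs_density p q x) * U i x \<partial>lborel) + ennreal (fs_atom p q) * U i 1)"
      using seq by simp
    also have "\<dots> = (SUP i. \<integral>\<^sup>+x. ennreal (fs_density p q x) * U i x \<partial>lborel) + (SUP i. ennreal (fs_atom p q) * U i 1)"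
      using mono by (intro ennreal_SUP_add)
        (auto simp: incseq_Suc_iff intro!: nn_integral_mono mult_left_mono)
    also have "(SUP i. ennreal (fs_atom p q) * U i 1) = ennreal (fs_atom p q) * (SUP i. U i) 1"
      unfolding SUP_apply by (rule SUP_mult_left_ennreal[symmetric])
    also have "(SUP i. \<integral>\<^sup>+x. ennreal (fs_density p q x) * U i x \<partial>lborel) =
        (\<integral>\<^sup>+x. (SUP i. ennreal (fs_density p q x) * U i x) \<partial>lborel)"
      using seq mono by (intro nn_integral_monotone_convergence_SUP[symmetric])
        (auto simp: incseq_Suc_iff le_fun_def intro!: mult_left_mono)
    also have "\<dots> = (\<integral>\<^sup>+x. ennreal (fs_density p q x) * (SUP i. U i) x \<partial>lborel)"
      unfolding SUP_apply by (simp add: SUP_mult_left_ennreal)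
    finally show ?case .
  qed
qed

context wachter_parameters
begin

lemma has_derivative_sqrt_spectral_point:
  assumes "0 < t" "t < pi"
  shows "((\<lambda>t. sqrt (spectral_point t)) has_real_derivative edge_radius * sin t / sqrt (spectral_point t)) (at t)"
  using spectral_point_bounds(3)[OF assms] unfolding spectral_point_def
  by (auto intro!: derivative_eq_intros simp: field_simps)

lemma sqrt_spectral_point_bounds:
  assumes "0 < t" "t < pi"
  shows "r_minus p q < sqrt (spectral_point t)" "sqrt (spectral_point t) < r_plus p q"
  using spectral_point_bounds[OF assms] r_nonneg by (auto intro!: real_less_rsqrt real_less_lsqrt)

text \<open>The Jacobian identity. With y = \<open>spectral_point t\<close>, the product of y -
  r_minus^2 and r_plus^2 - y is the square of 2 \<open>edge_radius\<close> sin t, so the radical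
  resolves; the remaining root of y pairs with the one in the derivative.\<close>

lemma fs_density_spectral_point:
  assumes t: "0 < t" "t < pi"
  shows "fs_density p q (sqrt (spectral_point t)) * (edge_radius * sin t / sqrt (spectral_point t)) =
    spectral_weight t / (1 - max p q)"
proof -
  let ?y = "spectral_point t"
  note y = spectral_point_bounds[OF t]
  have s: "0 < sin t" using t by (rule sin_gt_zero)
  have "?y * (1 - (r_minus p q)\<^sup>2 / ?y) * ((r_plus p q)\<^sup>2 / ?y - 1) = (?y - (r_minus p q)\<^sup>2) * ((r_plus p q)\<^sup>2 - ?y) / ?y"
    using y by (simp add: field_simps)
  also have "(?y - (r_minus p q)\<^sup>2) * ((r_plus p q)\<^sup>2 - ?y) = (2 * edge_radius * sin t)\<^sup>2"
    unfolding r_minus_square r_plus_square spectral_point_def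
    by (simp add: power_mult_distrib sin_squared_eq) (simp add: algebra_simps power2_eq_square)
  finally have "sqrt (?y * (1 - (r_minus p q)\<^sup>2 / ?y) * ((r_plus p q)\<^sup>2 / ?y - 1)) = 2 * edge_radius * sin t / sqrt ?y"
    using s edge_radius_pos by (simp add: real_sqrt_divide)
  then have "fs_density p q (sqrt ?y) = 2 * edge_radius * sin t / sqrt ?y / (pi * (1 - ?y) * (1 - max p q))"
    using y sqrt_spectral_point_bounds[OF t] by (simp add: fs_density_def)
  then have "fs_density p q (sqrt ?y) * (edge_radius * sin t / sqrt ?y) =
      2 * edge_radius\<^sup>2 * (sin t)\<^sup>2 / (sqrt ?y * sqrt ?y) / (pi * (1 - ?y) * (1 - max p q))"
  proof -
    have gen: "2 * e * u / v / w * (e * u / v) = 2 * e\<^sup>2 * u\<^sup>2 / (v * v) / w" for e u v w :: real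
      by (simp add: power2_eq_square ac_simps)
    show ?thesis unfolding \<open>fs_density p q (sqrt ?y) = _\<close> by (rule gen)
  qed
  also have "sqrt ?y * sqrt ?y = ?y" using y by simp
  also have "2 * edge_radius\<^sup>2 * (sin t)\<^sup>2 / ?y / (pi * (1 - ?y) * (1 - max p q)) = spectral_weight t / (1 - max p q)"
  proof -
    have "1 / ?y + 1 / (1 - ?y) = 1 / (?y * (1 - ?y))"
      using y by (simp add: field_simps)
    then have "(sin t)\<^sup>2 / ?y + (sin t)\<^sup>2 / (1 - ?y) = (sin t)\<^sup>2 / (?y * (1 - ?y))"
      by (metis (no_types, lifting) distrib_left mult.right_neutral times_divide_eq_right)
    then have w: "spectral_weight t = 2 * edge_radius\<^sup>2 / pi * ((sin t)\<^sup>2 / (?y * (1 - ?y)))"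
      unfolding spectral_weight_def by (rule arg_cong)
    have gen: "e * u / v / (a * b * m) = e / a * (u / (v * b)) / m" for e u v a b m :: real
      by simp
    show ?thesis unfolding w by (rule gen)
  qed
  finally show ?thesis .
qed

lemma isCont_fs_density:
  assumes "r_minus p q < x" "x < r_plus p q"
  shows "isCont (fs_density p q) x"
proof -
  let ?I = "{r_minus p q<..<r_plus p q}"
  have "continuous_on ?I (\<lambda>x. sqrt (x\<^sup>2 * (1 - (r_minus p q)\<^sup>2 / x\<^sup>2) * ((r_plus p q)\<^sup>2 / x\<^sup>2 - 1)) /
       (pi * (1 - x\<^sup>2) * (1 - max p q)))"
  proof (intro continuous_intros ballI)
    fix x assume x: "x \<in> ?I"
    then have "0 < x" "x < 1" using r_nonneg r_plus_le_1 by auto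
    then show "x\<^sup>2 \<noteq> 0" "x\<^sup>2 \<noteq> 0" "pi * (1 - x\<^sup>2) * (1 - max p q) \<noteq> 0"
      using p q by (auto simp: power2_eq_1_iff)
  qed
  then have "continuous_on ?I (fs_density p q)"
    by (rule continuous_on_eq) (simp add: fs_density_def)
  then show ?thesis
    using assms by (simp add: continuous_on_eq_continuous_at)
qed

lemma fs_density_nonneg: "0 \<le> fs_density p q x"
proof (cases "x \<in> {r_minus p q<..<r_plus p q}")
  case True
  then have x: "0 < x" "x < 1" using r_nonneg r_plus_le_1 by auto
  have "(r_minus p q)\<^sup>2 \<le> x\<^sup>2" "x\<^sup>2 \<le> (r_plus p q)\<^sup>2"
    using True r_nonneg x by (auto intro!: power_mono)
  moreover have "x\<^sup>2 \<le> 1" using x by (simp add: power_le_one)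
  ultimately show ?thesis
    using x p q unfolding fs_density_def
    by (intro mult_nonneg_nonneg divide_nonneg_nonneg real_sqrt_ge_zero) (auto simp: field_simps)
qed (simp add: fs_density_def)

lemma spectral_point_unit: "0 \<le> spectral_point t" "spectral_point t \<le> 1"
proof -
  have "edge_radius * cos t \<le> edge_radius * 1" "edge_radius * - 1 \<le> edge_radius * cos t"
    using edge_radius_pos by (intro mult_left_mono; simp)+
  then have "(r_minus p q)\<^sup>2 \<le> spectral_point t" "spectral_point t \<le> (r_plus p q)\<^sup>2"
    unfolding spectral_point_def r_minus_square r_plus_square by linarith+
  moreover have "0 \<le> (r_minus p q)\<^sup>2" "(r_plus p q)\<^sup>2 \<le> 1"
    using r_plus_le_1 r_nonneg by (simp_all add: power_le_one)
  ultimately show "0 \<le> spectral_point t" "spectral_point t \<le> 1" by linarith+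
qed

text \<open>The substitution runs over the open interval because at the end points the density may
  be unbounded and the derivative degenerate. Integrability of the density is not known beforehand:
  it comes out of the nonnegative substitution rule, fed by the bounded integrand on the angle
  side.\<close>

lemma integral_fs_measure:
  assumes f: "continuous_on UNIV f" "\<And>x. 0 \<le> f x" "\<And>x. f x \<le> B"
  shows "(1 - max p q) * (\<integral>x. f x \<partial>fs_measure p q) =
    (\<integral>t. spectral_weight t * f (sqrt (spectral_point t)) \<partial>angle_measure) + max 0 (1 - (p + q)) * f 1"
proof -
  let ?g = "\<lambda>t. sqrt (spectral_point t)"
  let ?g' = "\<lambda>t. edge_radius * sin t / ?g t"
  let ?F = "\<lambda>x. fs_density p q x * f x"
  have m[measurable]: "f \<in> borel_measurable borel"
    using f(1) by (rule borel_measurable_continuous_onI)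
  have sp[measurable]: "spectral_point \<in> borel_measurable borel"
    unfolding spectral_point_def[abs_def] by measurable
  have fs[measurable]: "fs_density p q \<in> borel_measurable borel"
    unfolding fs_density_def[abs_def] by measurable
  have pos: "0 < 1 - max p q" using p q by simp
  have prod: "?F (?g t) * ?g' t = spectral_weight t * f (?g t) / (1 - max p q)" if "0 < t" "t < pi" for t
  proof -
    have "?F (?g t) * ?g' t = (fs_density p q (?g t) * ?g' t) * f (?g t)" by (simp only: ac_simps)
    then show ?thesis unfolding fs_density_spectral_point[OF that] by simp
  qed
  have g_cont: "continuous_on UNIV ?g"
    unfolding spectral_point_def by (intro continuous_intros)
  have int_angle: "integrable angle_measure (\<lambda>t. spectral_weight t * f (?g t))"
  proof (rule integrable_angle[where B = "2 * B"])
    show "\<bar>spectral_weight t * f (?g t)\<bar> \<le> 2 * B" for t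
      using spectral_weight_nonneg[of t] spectral_weight_le[of t] f(2,3)[of "?g t"]
      by (auto simp: abs_mult intro!: mult_mono)
  qed measurable
  have subst_hyp: "set_integrable lborel (einterval (ereal 0) (ereal pi)) (\<lambda>t. ?F (?g t) * ?g' t)"
  proof -
    have "set_integrable lborel {0..pi} (\<lambda>t. spectral_weight t * f (?g t))"
      using int_angle by (simp add: angle_measure_def set_integrable_def integrable_restrict_space)
    then have "set_integrable lborel {0..pi} (\<lambda>t. spectral_weight t * f (?g t) / (1 - max p q))"
      by (rule set_integrable_divide)
    then have "set_integrable lborel {0<..<pi} (\<lambda>t. spectral_weight t * f (?g t) / (1 - max p q))"
      by (rule set_integrable_subset) auto
    also have "?this \<longleftrightarrow> set_integrable lborel {0<..<pi} (\<lambda>t. ?F (?g t) * ?g' t)"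
    proof (rule set_integrable_cong)
      fix t assume "t \<in> {0<..<pi}"
      then show "spectral_weight t * f (?g t) / (1 - max p q) = ?F (?g t) * ?g' t"
        by (intro prod[symmetric]) auto
    qed auto
    finally show ?thesis by (simp add: einterval_eq)
  qed
  have g0: "?g 0 = r_minus p q" and gpi: "?g pi = r_plus p q"
    unfolding spectral_point_def
    by (simp_all add: r_nonneg flip: r_minus_square r_plus_square)
  have lim0: "((ereal \<circ> ?g \<circ> real_of_ereal) \<longlongrightarrow> ereal (r_minus p q)) (at_right (ereal 0))"
  proof -
    have "isCont ?g 0" using g_cont by (simp add: continuous_on_eq_continuous_at)
    then have "(?g \<longlongrightarrow> ?g 0) (at_right 0)"
      unfolding isCont_def by (rule tendsto_within_subset) simp
    then show ?thesis unfolding g0 ereal_tendsto_simps by (simp add: comp_def)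
  qed
  have limpi: "((ereal \<circ> ?g \<circ> real_of_ereal) \<longlongrightarrow> ereal (r_plus p q)) (at_left (ereal pi))"
  proof -
    have "isCont ?g pi" using g_cont by (simp add: continuous_on_eq_continuous_at)
    then have "(?g \<longlongrightarrow> ?g pi) (at_left pi)"
      unfolding isCont_def by (rule tendsto_within_subset) simp
    then show ?thesis unfolding gpi ereal_tendsto_simps by (simp add: comp_def)
  qed
  have deriv: "(?g has_real_derivative ?g' t) (at t)" if "ereal 0 < ereal t" "ereal t < ereal pi" for t
    using that by (intro has_derivative_sqrt_spectral_point) simp_all
  have contF: "isCont ?F (?g t)" if "ereal 0 < ereal t" "ereal t < ereal pi" for t
  proof -
    have "isCont f (?g t)" using f(1) by (simp add: continuous_on_eq_continuous_at)
    moreover have "isCont (fs_density p q) (?g t)"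
      using that by (intro isCont_fs_density sqrt_spectral_point_bounds) simp_all
    ultimately show ?thesis by (intro isCont_mult)
  qed
  have cont_g': "isCont ?g' t" if "ereal 0 < ereal t" "ereal t < ereal pi" for t
  proof -
    have "isCont ?g t" using g_cont by (simp add: continuous_on_eq_continuous_at)
    moreover have "?g t \<noteq> 0" using spectral_point_bounds(3)[of t] that by simp
    ultimately show ?thesis by (intro isCont_divide isCont_mult continuous_const isCont_sin) auto
  qed
  have F_nonneg: "0 \<le> ?F (?g t)" for t
    using fs_density_nonneg f(2) by simp
  have g'_nonneg: "0 \<le> ?g' t" if "ereal 0 \<le> ereal t" "ereal t \<le> ereal pi" for t
    using that sin_ge_zero[of t] edge_radius_pos spectral_point_unit(1)[of t] by simp
  have "ereal 0 < ereal pi" by simp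
  note concl = interval_integral_substitution_nonneg[of "ereal 0" "ereal pi" ?g ?g' ?F,
      OF this deriv contF cont_g' F_nonneg g'_nonneg lim0 limpi subst_hyp]
  have le: "ereal (r_minus p q) \<le> ereal (r_plus p q)"
    using sqrt_spectral_point_bounds[of "pi / 2"] pi_gt_zero by simp
  have F_ind: "indicator (einterval (ereal (r_minus p q)) (ereal (r_plus p q))) x *\<^sub>R ?F x = ?F x" for x
    by (auto simp: einterval_eq fs_density_def indicator_def)
  have F_int: "integrable lborel ?F" and F_eq: "(\<integral>x. ?F x \<partial>lborel) = (LBINT t=ereal 0..ereal pi. ?F (?g t) * ?g' t)"
    using concl le unfolding set_integrable_def interval_lebesgue_integral_def set_lebesgue_integral_def F_ind
    by (auto split: if_splits)
  have "(LBINT t=ereal 0..ereal pi. ?F (?g t) * ?g' t) =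
      (LBINT t=ereal 0..ereal pi. spectral_weight t * f (?g t) / (1 - max p q))"
  proof (rule interval_integral_cong)
    fix t assume "t \<in> einterval (min (ereal 0) (ereal pi)) (max (ereal 0) (ereal pi))"
    then show "?F (?g t) * ?g' t = spectral_weight t * f (?g t) / (1 - max p q)"
      by (intro prod) (auto simp: einterval_eq)
  qed
  also have "\<dots> = (LBINT t:{0..pi}. spectral_weight t * f (?g t) / (1 - max p q))"
    by (rule interval_integral_Icc) simp
  also have "\<dots> = (\<integral>t. spectral_weight t * f (?g t) \<partial>angle_measure) / (1 - max p q)"
    unfolding integral_angle by (simp only: set_integral_divide_zero)
  finally have F: "(\<integral>x. ?F x \<partial>lborel) = (\<integral>t. spectral_weight t * f (?g t) \<partial>angle_measure) / (1 - max p q)"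
    unfolding F_eq .
  have atom: "0 \<le> fs_atom p q" using pos by (simp add: fs_atom_def)
  have Fnn: "0 \<le> (\<integral>x. ?F x \<partial>lborel)" using fs_density_nonneg f(2) by (intro integral_nonneg_AE) auto
  have "(\<integral>\<^sup>+x. ennreal (f x) \<partial>fs_measure p q) =
      (\<integral>\<^sup>+x. ennreal (?F x) \<partial>lborel) + ennreal (fs_atom p q * f 1)"
    by (subst nn_integral_fs_measure) (auto simp: ennreal_mult fs_density_nonneg f(2) atom)
  also have "(\<integral>\<^sup>+x. ennreal (?F x) \<partial>lborel) = ennreal (\<integral>x. ?F x \<partial>lborel)"
    using F_int fs_density_nonneg f(2) by (intro nn_integral_eq_integral) auto
  finally have "(\<integral>\<^sup>+x. ennreal (f x) \<partial>fs_measure p q) = ennreal ((\<integral>x. ?F x \<partial>lborel) + fs_atom p q * f 1)"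
    using Fnn atom f(2) by (simp add: ennreal_plus)
  moreover have "(\<integral>x. f x \<partial>fs_measure p q) = enn2real (\<integral>\<^sup>+x. ennreal (f x) \<partial>fs_measure p q)"
    using f(2) by (intro integral_eq_nn_integral)
      (auto simp: fs_measure_def sets_measure_of_conv sets.sigma_sets_eq[of borel, simplified] cong: measurable_cong_sets)
  moreover have "0 \<le> (\<integral>x. ?F x \<partial>lborel) + fs_atom p q * f 1"
    using Fnn atom f(2) by simp
  ultimately have "(\<integral>x. f x \<partial>fs_measure p q) = (\<integral>x. ?F x \<partial>lborel) + fs_atom p q * f 1"
    by (simp only: enn2real_ennreal)
  moreover have "(1 - max p q) * (x / (1 - max p q) + y / (1 - max p q) * z) = x + y * z" for x y z
    using less_imp_neq[OF pos] by (simp add: distrib_left)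
  ultimately show ?thesis
    unfolding F fs_atom_def by simp
qed

text \<open>The total mass is read off from the Chebyshev identity at k = 0, where the polynomial is
  the constant 2, instead of integrating the density.\<close>

lemma real_distribution_fs_measure: "real_distribution (fs_measure p q)"
proof -
  define \<alpha> \<beta> c D where ab: "\<alpha> = 1 - q" "\<beta> = 1 - p" "c = \<alpha> + \<beta> - 2 * \<alpha> * \<beta>" "D = \<alpha> * \<beta> * (1 - \<alpha>) * (1 - \<beta>)"
  have "2 * (\<integral>t. spectral_weight t \<partial>angle_measure) =
      1 + (\<alpha> + \<beta> - 1) + (\<alpha> - \<beta>) - 2 * max 0 (1 - (p + q)) - 2 * max 0 (p - q)"
    using integral_spectral_cheb[OF ab, of 0] by (simp add: mult.commute)
  then have *: "(\<integral>t. spectral_weight t \<partial>angle_measure) = 1 - q - max 0 (1 - (p + q)) - max 0 (p - q)"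
    by (simp add: ab)
  have "(1 - max p q) * (\<integral>x. 1 \<partial>fs_measure p q) =
      (\<integral>t. spectral_weight t * 1 \<partial>angle_measure) + max 0 (1 - (p + q)) * 1"
    by (rule integral_fs_measure[where B = 1 and f = "\<lambda>_. 1"]) auto
  also have "\<dots> = 1 - max p q"
    unfolding mult_1_right * by (simp add: max_def)
  finally have "(1 - max p q) * (\<integral>x. 1 \<partial>fs_measure p q) = 1 - max p q" .
  moreover have "1 - max p q \<noteq> 0" using p q by (simp add: max_def)
  ultimately have "(\<integral>x. 1 \<partial>fs_measure p q) = (1::real)"
    by (metis mult_cancel_left mult.right_neutral)
  then have m1: "measure (fs_measure p q) (space (fs_measure p q)) = 1"
    by simp
  \<comment> \<open>An infinite total mass would give \<open>measure\<close> the value 0.\<close>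
  then have "emeasure (fs_measure p q) (space (fs_measure p q)) \<noteq> \<top>"
    by (auto simp: measure_def)
  then have "emeasure (fs_measure p q) (space (fs_measure p q)) = 1"
    using m1 by (simp add: emeasure_eq_ennreal_measure)
  then have "prob_space (fs_measure p q)" by (rule prob_spaceI)
  then show ?thesis
    by (auto simp: real_distribution_def real_distribution_axioms_def fs_measure_def sets_measure_of_conv
        sets.sigma_sets_eq[of borel, simplified] space_measure_of_conv)
qed

text \<open>The limit of 1 / n times the sum of f over all squared singular values, including those
  forced to be zero by a lack of columns. Hence the atom at 0, and the total mass 1 - q.\<close>

definition limit_functional :: "(real \<Rightarrow> real) \<Rightarrow> real" where
  "limit_functional f = (\<integral>t. spectral_weight t * f (spectral_point t) \<partial>angle_measure)
     + max 0 (1 - (p + q)) * f 1 + max 0 (p - q) * f 0"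

lemma integrable_spectral:
  assumes "continuous_on UNIV f"
  shows "integrable angle_measure (\<lambda>t. spectral_weight t * f (spectral_point t))"
proof -
  have "compact (f ` {0..1})"
    using continuous_on_subset[OF assms, of "{0..1}"] by (intro compact_continuous_image) auto
  then have "bounded (f ` {0..1})" by (rule compact_imp_bounded)
  then obtain B where "\<forall>y\<in>f ` {0..1}. norm y \<le> B" unfolding bounded_iff by blast
  then have B: "\<bar>f x\<bar> \<le> B" if "x \<in> {0..1}" for x using that by auto
  have [measurable]: "f \<in> borel_measurable borel"
    using assms by (rule borel_measurable_continuous_onI)
  have [measurable]: "spectral_point \<in> borel_measurable borel"
    unfolding spectral_point_def[abs_def] by measurable
  show ?thesis
  proof (rule integrable_angle[where B = "2 * B"])
    show "\<bar>spectral_weight t * f (spectral_point t)\<bar> \<le> 2 * B" for t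
      unfolding abs_mult
      using spectral_weight_nonneg[of t] spectral_weight_le[of t] B[of "spectral_point t"] spectral_point_unit[of t]
      by (intro mult_mono) auto
  qed measurable
qed

lemma limit_functional_linear:
  assumes "continuous_on UNIV f" "continuous_on UNIV g"
  shows "limit_functional (\<lambda>x. a * f x + b * g x) = a * limit_functional f + b * limit_functional g"
proof -
  have "(\<integral>t. spectral_weight t * (a * f (spectral_point t) + b * g (spectral_point t)) \<partial>angle_measure) =
      (\<integral>t. a * (spectral_weight t * f (spectral_point t)) + b * (spectral_weight t * g (spectral_point t)) \<partial>angle_measure)"
    by (intro Bochner_Integration.integral_cong refl) (simp add: algebra_simps)
  also have "\<dots> = a * (\<integral>t. spectral_weight t * f (spectral_point t) \<partial>angle_measure)
      + b * (\<integral>t. spectral_weight t * g (spectral_point t) \<partial>angle_measure)"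
    using integrable_spectral[OF assms(1)] integrable_spectral[OF assms(2)] by simp
  finally show ?thesis unfolding limit_functional_def by (simp add: algebra_simps)
qed

lemma limit_functional_mono:
  assumes "continuous_on UNIV f" "continuous_on UNIV g" "\<And>x. 0 \<le> x \<Longrightarrow> x \<le> 1 \<Longrightarrow> f x \<le> g x"
  shows "limit_functional f \<le> limit_functional g"
proof -
  have "(\<integral>t. spectral_weight t * f (spectral_point t) \<partial>angle_measure) \<le> (\<integral>t. spectral_weight t * g (spectral_point t) \<partial>angle_measure)"
    using assms spectral_weight_nonneg spectral_point_unit
    by (intro integral_mono integrable_spectral mult_left_mono) auto
  moreover have "max 0 (1 - (p + q)) * f 1 \<le> max 0 (1 - (p + q)) * g 1" "max 0 (p - q) * f 0 \<le> max 0 (p - q) * g 0"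
    using assms(3) by (auto intro!: mult_left_mono)
  ultimately show ?thesis unfolding limit_functional_def by linarith
qed

lemma limit_functional_close:
  assumes f: "continuous_on UNIV f" and g: "continuous_on UNIV g"
    and close: "\<And>x. 0 \<le> x \<Longrightarrow> x \<le> 1 \<Longrightarrow> \<bar>f x - g x\<bar> \<le> e"
  shows "\<bar>limit_functional f - limit_functional g\<bar> \<le> e * limit_functional (\<lambda>_. 1)"
proof -
  have const: "continuous_on UNIV (\<lambda>_. 1 :: real)" by simp
  have "limit_functional f \<le> limit_functional (\<lambda>x. 1 * g x + e * 1)"
    using close by (intro limit_functional_mono f continuous_intros g) (auto simp: abs_le_iff algebra_simps)
  moreover have "limit_functional g \<le> limit_functional (\<lambda>x. 1 * f x + e * 1)"
    using close by (intro limit_functional_mono f continuous_intros g) (auto simp: abs_le_iff algebra_simps)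
  ultimately show ?thesis
    unfolding limit_functional_linear[OF g const] limit_functional_linear[OF f const] by auto
qed

end

section \<open>Weak convergence from Chebyshev averages\<close>

lemma continuous_on_centered_cheb: "continuous_on A (centered_cheb c D k)"
  by (induction k rule: induct_nat_012) (auto intro!: continuous_intros)

lemma sum_mset_linear:
  "(\<Sum>x\<in>#E. a * f x + b * g x) = a * (\<Sum>x\<in>#E. f x) + (b * (\<Sum>x\<in>#E. g x) :: real)"
  by (induction E) (simp_all add: algebra_simps)

lemma sum_mset_close:
  fixes f g :: "real \<Rightarrow> real"
  assumes "\<And>x. x \<in># E \<Longrightarrow> \<bar>f x - g x\<bar> \<le> e"
  shows "\<bar>(\<Sum>x\<in>#E. f x) - (\<Sum>x\<in>#E. g x)\<bar> \<le> e * size E"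
  using assms
proof (induction E)
  case (add x E)
  have "\<bar>(\<Sum>x\<in>#E. f x) - (\<Sum>x\<in>#E. g x)\<bar> \<le> e * size E" "\<bar>f x - g x\<bar> \<le> e"
    using add by auto
  then show ?case by (simp add: algebra_simps abs_le_iff)
qed simp

context wachter_parameters
begin

lemma cheb_averages_imp_continuous_averages:
  fixes E :: "nat \<Rightarrow> real multiset"
  assumes E: "\<And>n x. n \<ge> 1 \<Longrightarrow> x \<in># E n \<Longrightarrow> 0 \<le> x \<and> x \<le> 1" "\<And>n. n \<ge> 1 \<Longrightarrow> size (E n) \<le> n"
    and cheb: "\<And>k. (\<lambda>n. (\<Sum>x\<in>#E n. centered_cheb c D k x) / n) \<longlonglongrightarrow> limit_functional (centered_cheb c D k)"
    and f: "continuous_on UNIV f"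
  shows "(\<lambda>n. (\<Sum>x\<in>#E n. f x) / n) \<longlonglongrightarrow> limit_functional f"
proof -
  define conv where "conv g \<longleftrightarrow> continuous_on UNIV g \<and> (\<lambda>n. (\<Sum>x\<in>#E n. g x) / n) \<longlonglongrightarrow> limit_functional g" for g
  have lin: "conv (\<lambda>x. a * g x + b * h x)" if "conv g" "conv h" for g h a b
  proof -
    have "(\<lambda>n. a * ((\<Sum>x\<in>#E n. g x) / n) + b * ((\<Sum>x\<in>#E n. h x) / n)) \<longlonglongrightarrow> a * limit_functional g + b * limit_functional h"
      using that unfolding conv_def by (intro tendsto_intros) auto
    moreover have "a * ((\<Sum>x\<in>#E n. g x) / n) + b * ((\<Sum>x\<in>#E n. h x) / n) = (\<Sum>x\<in>#E n. a * g x + b * h x) / n" for n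
      by (simp add: sum_mset_linear add_divide_distrib)
    ultimately show ?thesis
      using that unfolding conv_def by (auto simp: limit_functional_linear intro!: continuous_intros)
  qed
  \<comment> \<open>Read backwards, the recursion expresses x times a Chebyshev polynomial through
    its neighbours, so convergence spreads to all powers of x.\<close>
  have cheb_conv: "conv (\<lambda>x. x ^ j * centered_cheb c D k x)" for j k
  proof (induction j arbitrary: k)
    case 0
    show ?case using cheb by (simp add: conv_def continuous_on_centered_cheb)
  next
    case (Suc j)
    show ?case
    proof (cases k)
      case 0
      have "conv (\<lambda>x. 2 * (x ^ j * centered_cheb c D 1 x) + c * (x ^ j * centered_cheb c D 0 x))"
        by (intro lin Suc)
      moreover have "2 * (x ^ j * centered_cheb c D 1 x) + c * (x ^ j * centered_cheb c D 0 x)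
          = x ^ Suc j * centered_cheb c D k x" for x
        by (simp add: 0 algebra_simps)
      ultimately show ?thesis by simp
    next
      case (Suc i)
      have "conv (\<lambda>x. 1 * (1 * (x ^ j * centered_cheb c D (Suc (Suc i)) x) + c * (x ^ j * centered_cheb c D (Suc i) x))
          + D * (x ^ j * centered_cheb c D i x))"
        by (intro lin Suc.IH)
      moreover have "1 * (1 * (x ^ j * centered_cheb c D (Suc (Suc i)) x) + c * (x ^ j * centered_cheb c D (Suc i) x))
          + D * (x ^ j * centered_cheb c D i x) = x ^ Suc j * centered_cheb c D k x" for x
        by (simp add: Suc algebra_simps)
      ultimately show ?thesis by simp
    qed
  qed
  \<comment> \<open>Two quarters of \<open>centered_cheb\<close> at index 0, the constant 2, give
    the factor 1.\<close>
  have mono_conv: "conv (\<lambda>x. x ^ j)" for j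
    using lin[OF cheb_conv[of j 0] cheb_conv[of j 0], of "1 / 4" "1 / 4"] by simp
  have poly_conv: "conv (\<lambda>x. \<Sum>i\<le>m. a i * x ^ i)" for a m
  proof (induction m)
    case 0
    show ?case using lin[OF mono_conv[of 0] mono_conv[of 0], of "a 0" 0] by simp
  next
    case (Suc m)
    show ?case using lin[OF Suc mono_conv[of "Suc m"], of 1 "a (Suc m)"] by simp
  qed
  show ?thesis
  proof (rule LIMSEQ_I)
    fix e :: real assume e: "0 < e"
    let ?L = "limit_functional (\<lambda>_. 1)"
    have "?L \<ge> 0"
      using spectral_weight_nonneg unfolding limit_functional_def
      by (auto intro!: add_nonneg_nonneg integral_nonneg_AE)
    \<comment> \<open>A uniform error d costs at most d in the averages, since \<open>E n\<close>
      has at most n elements, and d times \<open>?L\<close> in the limit. This choice keeps both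
      below e / 3, also for \<open>?L\<close> = 0.\<close>
    define d where "d = e / (3 * (1 + ?L))"
    have d: "0 < d" "d \<le> e / 3" "d * ?L \<le> e / 3"
    proof -
      show "0 < d" unfolding d_def using e \<open>?L \<ge> 0\<close> by (intro divide_pos_pos) auto
      have "d * (1 + ?L) = e / 3" unfolding d_def using \<open>?L \<ge> 0\<close> by (simp add: field_simps)
      moreover have "d * 1 \<le> d * (1 + ?L)" "d * ?L \<le> d * (1 + ?L)"
        using \<open>?L \<ge> 0\<close> \<open>0 < d\<close> by (auto intro!: mult_left_mono)
      ultimately show "d \<le> e / 3" "d * ?L \<le> e / 3" by simp_all
    qed
    obtain g where g: "real_polynomial_function g" "\<And>x. x \<in> {0..1} \<Longrightarrow> \<bar>f x - g x\<bar> < d"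
      using Stone_Weierstrass_real_polynomial_function[of "{0..1::real}" f d] d f
      by (auto intro: continuous_on_subset)
    then obtain a m where gm: "g = (\<lambda>x. \<Sum>i\<le>m. a i * x ^ i)"
      by (auto simp: real_polynomial_function_iff_sum)
    have cg: "conv g" using poly_conv gm by simp
    then obtain N where N: "\<And>n. n \<ge> N \<Longrightarrow> \<bar>(\<Sum>x\<in>#E n. g x) / n - limit_functional g\<bar> < e / 3"
    proof -
      have "0 < e / 3" using e by simp
      from LIMSEQ_D[OF conjunct2[OF cg[unfolded conv_def]] this] that show thesis
        unfolding real_norm_def by blast
    qed
    have "\<bar>limit_functional f - limit_functional g\<bar> \<le> d * ?L"
      using g(2) cg by (intro limit_functional_close f) (auto simp: conv_def less_imp_le)
    then have 1: "\<bar>limit_functional f - limit_functional g\<bar> \<le> e / 3" using d by linarith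
    show "\<exists>N. \<forall>n\<ge>N. norm ((\<Sum>x\<in>#E n. f x) / n - limit_functional f) < e"
    proof (intro exI allI impI)
      fix n assume n: "n \<ge> max 1 N"
      have "\<bar>(\<Sum>x\<in>#E n. f x) - (\<Sum>x\<in>#E n. g x)\<bar> \<le> d * size (E n)"
        using E(1)[of n] g(2) n by (intro sum_mset_close) (auto simp: less_imp_le)
      also have "\<dots> \<le> d * n" using d E(2)[of n] n by (intro mult_left_mono) auto
      finally have "\<bar>(\<Sum>x\<in>#E n. f x) / n - (\<Sum>x\<in>#E n. g x) / n\<bar> \<le> d"
        using n by (simp add: diff_divide_distrib[symmetric] field_simps)
      then show "norm ((\<Sum>x\<in>#E n. f x) / n - limit_functional f) < e"
        using N[of n] n 1 d unfolding real_norm_def by linarith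
    qed
  qed
qed

end

lemma real_distribution_empirical:
  assumes "xs \<noteq> []"
  shows "real_distribution (empirical_distribution xs)"
proof -
  interpret U: prob_space "uniform_count_measure {..<length xs}"
    using assms by (intro prob_space_uniform_count_measure) auto
  show ?thesis
    unfolding empirical_distribution_def
    by (intro U.real_distribution_distr) (auto simp: measurable_def space_uniform_count_measure sets_uniform_count_measure)
qed

lemma integral_empirical:
  fixes f :: "real \<Rightarrow> real"
  assumes "f \<in> borel_measurable borel"
  shows "integral\<^sup>L (empirical_distribution xs) f = (\<Sum>x\<leftarrow>xs. f x) / length xs"
proof -
  have "integral\<^sup>L (empirical_distribution xs) f = (\<integral>i. f (xs ! i) \<partial>uniform_count_measure {..<length xs})"
    unfolding empirical_distribution_def using assms by (intro integral_distr) auto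
  also have "\<dots> = (\<Sum>i<length xs. f (xs ! i)) / length xs"
    by (simp add: integral_uniform_count_measure)
  also have "(\<Sum>i<length xs. f (xs ! i)) = (\<Sum>x\<leftarrow>xs. f x)"
    by (simp add: sum_list_sum_nth atLeast0LessThan)
  finally show ?thesis .
qed

context wachter_parameters
begin

lemma weak_conv_empirical:
  fixes E :: "nat \<Rightarrow> real multiset" and xs :: "nat \<Rightarrow> real list" and m r :: "nat \<Rightarrow> nat"
  assumes E: "\<And>n x. n \<ge> 1 \<Longrightarrow> x \<in># E n \<Longrightarrow> 0 \<le> x \<and> x \<le> 1" "\<And>n. n \<ge> 1 \<Longrightarrow> size (E n) \<le> n"
    and cheb: "\<And>k. (\<lambda>n. (\<Sum>x\<in>#E n. centered_cheb c D k x) / n) \<longlonglongrightarrow> limit_functional (centered_cheb c D k)"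
    and m: "(\<lambda>n. m n / n) \<longlonglongrightarrow> 1 - q" and r: "(\<lambda>n. r n / n) \<longlonglongrightarrow> 1 - max p q"
    and len: "\<And>n. n \<ge> 1 \<Longrightarrow> length (xs n) = r n"
    and sums: "\<And>n f. n \<ge> 1 \<Longrightarrow> (\<Sum>x\<leftarrow>xs n. f x) = (\<Sum>x\<in>#E n. f (sqrt x)) - (real (m n) - real (r n)) * f 0"
  shows "weak_conv_m (\<lambda>n. empirical_distribution (xs n)) (fs_measure p q)"
proof -
  have pos: "0 < 1 - max p q" using p q by simp
  have "eventually (\<lambda>n. r n / n > 0) sequentially"
    using order_tendstoD(1)[OF r pos] .
  then have ev: "eventually (\<lambda>n. n \<ge> 1 \<and> xs n \<noteq> []) sequentially"
    using eventually_ge_at_top[of 1]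
  proof eventually_elim
    case (elim n)
    then show ?case using len[of n] by auto
  qed
  have conv: "(\<lambda>n. integral\<^sup>L (empirical_distribution (xs n)) f) \<longlonglongrightarrow> integral\<^sup>L (fs_measure p q) f"
    if f: "continuous_on UNIV f" "\<And>x. 0 \<le> f x" "\<And>x. f x \<le> B" for f :: "real \<Rightarrow> real" and B
  proof -
    have fm: "f \<in> borel_measurable borel" using f(1) by (rule borel_measurable_continuous_onI)
    have fs: "continuous_on UNIV (\<lambda>x. f (sqrt x))"
      using continuous_on_compose2[OF f(1), of UNIV sqrt] by (simp add: continuous_on_real_sqrt)
    have L: "(\<lambda>n. (\<Sum>x\<in>#E n. f (sqrt x)) / n) \<longlonglongrightarrow> limit_functional (\<lambda>x. f (sqrt x))"
      by (rule cheb_averages_imp_continuous_averages[OF E cheb fs])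
    have "(\<lambda>n. ((\<Sum>x\<in>#E n. f (sqrt x)) / n - (m n / n - r n / n) * f 0) / (r n / n)) \<longlonglongrightarrow>
        (limit_functional (\<lambda>x. f (sqrt x)) - ((1 - q) - (1 - max p q)) * f 0) / (1 - max p q)"
      using pos by (intro tendsto_intros L m r) auto
    \<comment> \<open>Removing the surplus zeros removes the atom at 0, because max p q - q = max 0
      (p - q).\<close>
    moreover have "limit_functional (\<lambda>x. f (sqrt x)) - ((1 - q) - (1 - max p q)) * f 0 = (1 - max p q) * integral\<^sup>L (fs_measure p q) f"
      unfolding integral_fs_measure[OF f] limit_functional_def by (simp add: max_def algebra_simps)
    ultimately have lim: "(\<lambda>n. ((\<Sum>x\<in>#E n. f (sqrt x)) / n - (m n / n - r n / n) * f 0) / (r n / n)) \<longlonglongrightarrow> integral\<^sup>L (fs_measure p q) f"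
      using less_imp_neq[OF pos] by simp
    show ?thesis
    proof (rule Lim_transform_eventually[OF lim])
      show "eventually (\<lambda>n. ((\<Sum>x\<in>#E n. f (sqrt x)) / n - (m n / n - r n / n) * f 0) / (r n / n) =
          integral\<^sup>L (empirical_distribution (xs n)) f) sequentially"
        using ev
      proof eventually_elim
        case (elim n)
        have "((\<Sum>x\<in>#E n. f (sqrt x)) / n - (m n / n - r n / n) * f 0) =
            ((\<Sum>x\<in>#E n. f (sqrt x)) - (real (m n) - real (r n)) * f 0) / n"
          by (simp add: diff_divide_distrib left_diff_distrib)
        then show ?case
          using elim len[of n] sums[of n f] by (simp add: integral_empirical[OF fm])
      qed
    qed
  qed
  \<comment> \<open>An empty list gives the zero measure, which is not a distribution. At the
    finitely many n concerned the limit itself is put in.\<close>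
  define N where "N n = (if n \<ge> 1 \<and> xs n \<noteq> [] then empirical_distribution (xs n) else fs_measure p q)" for n
  have N_ev: "eventually (\<lambda>n. N n = empirical_distribution (xs n)) sequentially"
    using ev by eventually_elim (simp add: N_def)
  have "weak_conv_m N (fs_measure p q)"
  proof (rule integral_cts_step_conv_imp_weak_conv)
    show "real_distribution (N n)" for n
      by (auto simp: N_def real_distribution_empirical real_distribution_fs_measure)
    show "real_distribution (fs_measure p q)" by (rule real_distribution_fs_measure)
    fix x y :: real assume "x < y"
    then have "continuous_on UNIV (cts_step x y)"
      by (intro uniformly_continuous_imp_continuous cts_step_uniformly_continuous)
    then have "(\<lambda>n. integral\<^sup>L (empirical_distribution (xs n)) (cts_step x y)) \<longlonglongrightarrow> integral\<^sup>L (fs_measure p q) (cts_step x y)"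
      using \<open>x < y\<close> by (intro conv[where B = 1]) (auto simp: cts_step_def divide_le_eq)
    then show "(\<lambda>n. integral\<^sup>L (N n) (cts_step x y)) \<longlonglongrightarrow> integral\<^sup>L (fs_measure p q) (cts_step x y)"
      by (rule Lim_transform_eventually) (use N_ev in eventually_elim, simp)
  qed
  then show ?thesis
    unfolding weak_conv_m_def weak_conv_def
  proof (intro allI impI)
    fix x assume *: "\<forall>x. isCont (cdf (fs_measure p q)) x \<longrightarrow> (\<lambda>n. cdf (N n) x) \<longlonglongrightarrow> cdf (fs_measure p q) x"
      and "isCont (cdf (fs_measure p q)) x"
    then have "(\<lambda>n. cdf (N n) x) \<longlonglongrightarrow> cdf (fs_measure p q) x" by blast
    then show "(\<lambda>n. cdf (empirical_distribution (xs n)) x) \<longlonglongrightarrow> cdf (fs_measure p q) x"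
      by (rule Lim_transform_eventually) (use N_ev in eventually_elim, simp)
  qed
qed

end

section \<open>Trace moments\<close>

definition lists_of :: "nat \<Rightarrow> nat \<Rightarrow> nat list set" where
  "lists_of n k = {xs. set xs \<subseteq> {..<n} \<and> length xs = k}"

text \<open>Only such index words survive the expectation of a product of independent centred
  factors.\<close>

definition repeating :: "'a list \<Rightarrow> bool" where
  "repeating xs \<longleftrightarrow> (\<forall>x\<in>set xs. count_list xs x \<noteq> 1)"

lemma finite_lists_of [simp]: "finite (lists_of n k)"
  by (simp add: lists_of_def finite_lists_length_eq)

lemma card_lists_of: "card (lists_of n k) = n ^ k"
  by (simp add: lists_of_def card_lists_length_eq)

lemma sum_lists_of_0 [simp]: "(\<Sum>xs\<in>lists_of n 0. f xs) = f []"
proof -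
  have "lists_of n 0 = {[]}" by (auto simp: lists_of_def)
  then show ?thesis by simp
qed

lemma sum_lists_of_Suc: "(\<Sum>xs\<in>lists_of n (Suc k). f xs) = (\<Sum>x<n. \<Sum>xs\<in>lists_of n k. f (x # xs))"
proof -
  have "(\<Sum>xs\<in>lists_of n (Suc k). f xs) = (\<Sum>(xs, x)\<in>lists_of n k \<times> {..<n}. f (x # xs))"
    unfolding lists_of_def lists_length_Suc_eq
    by (subst sum.reindex) (auto simp: inj_on_def case_prod_beta)
  also have "\<dots> = (\<Sum>x<n. \<Sum>xs\<in>lists_of n k. f (x # xs))"
    by (subst sum.cartesian_product[symmetric]) (rule sum.swap)
  finally show ?thesis .
qed

lemma card_set_repeating:
  assumes "repeating xs"
  shows "2 * card (set xs) \<le> length xs"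
proof -
  have "2 * card (set xs) = (\<Sum>x\<in>set xs. 2)" by simp
  also have "\<dots> \<le> (\<Sum>x\<in>set xs. count_list xs x)"
  proof (rule sum_mono)
    fix x assume x: "x \<in> set xs"
    then have "count_list xs x \<noteq> 0" by (simp add: count_list_0_iff)
    moreover have "count_list xs x \<noteq> 1" using x assms unfolding repeating_def by blast
    ultimately show "2 \<le> count_list xs x" by linarith
  qed
  also have "\<dots> = length xs" by (rule sum_count_set[OF subset_refl finite_set])
  finally show ?thesis .
qed

text \<open>A word of length 2 k without single letters has at most k distinct ones, so it is coded
  by a list of k letters and 2 k positions in that list.\<close>

lemma card_repeating_lists:
  assumes "n \<ge> 1"
  shows "card {xs \<in> lists_of n (2 * k). repeating xs} \<le> n ^ k * k ^ (2 * k)"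
proof -
  let ?f = "\<lambda>(ys, is). map (\<lambda>i. ys ! i) is"
  have "{xs \<in> lists_of n (2 * k). repeating xs} \<subseteq> ?f ` (lists_of n k \<times> lists_of k (2 * k))"
  proof
    fix xs assume xs: "xs \<in> {xs \<in> lists_of n (2 * k). repeating xs}"
    obtain zs where zs: "set zs = set xs" "distinct zs" using finite_distinct_list[OF finite_set[of xs]] by auto
    have len: "length zs \<le> k"
      using card_set_repeating[of xs] xs zs(1) distinct_card[OF zs(2)] by (simp add: lists_of_def)
    \<comment> \<open>Padded to length k with 0, a legal letter since n >= 1.\<close>
    define ys where "ys = zs @ replicate (k - length zs) 0"
    have ys: "ys \<in> lists_of n k"
      using xs zs len assms by (auto simp: ys_def lists_of_def)
    have "\<exists>i<k. ys ! i = x" if "x \<in> set xs" for x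
    proof -
      have "x \<in> set zs" using that zs(1) by simp
      then obtain i where i: "i < length zs" "zs ! i = x" by (auto simp: in_set_conv_nth)
      then have "ys ! i = x" "i < k" using len by (simp_all add: ys_def nth_append)
      then show ?thesis by blast
    qed
    then have "\<forall>x\<in>set xs. \<exists>i. i < k \<and> ys ! i = x" by blast
    from bchoice[OF this] obtain g where g: "\<forall>x\<in>set xs. g x < k \<and> ys ! g x = x" by blast
    have "xs = ?f (ys, map g xs)" using g by (simp add: map_idI)
    moreover have "map g xs \<in> lists_of k (2 * k)" using xs g by (auto simp: lists_of_def)
    ultimately show "xs \<in> ?f ` (lists_of n k \<times> lists_of k (2 * k))" using ys by blast
  qed
  then have "card {xs \<in> lists_of n (2 * k). repeating xs} \<le> card (?f ` (lists_of n k \<times> lists_of k (2 * k)))"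
    by (intro card_mono) auto
  also have "\<dots> \<le> card (lists_of n k \<times> lists_of k (2 * k))" by (intro card_image_le) auto
  finally show ?thesis by (simp add: card_cartesian_product card_lists_of)
qed

text \<open>The coefficient of a row word and a column word in an entry of the matrix power: the
  product of V i1 j1, cnj (V i2 j1), V i2 j2 and so on. The intermediate vertex z is summed freely
  as in a matrix product; the indicator of the following step fixes it to the next row
  index.\<close>

fun walk_weight :: "nat \<Rightarrow> (nat \<Rightarrow> nat \<Rightarrow> complex) \<Rightarrow> nat list \<Rightarrow> nat list \<Rightarrow> nat \<Rightarrow> nat \<Rightarrow> complex" where
  "walk_weight n V (i # is) (j # js) x y =
     of_bool (i = x) * (\<Sum>z<n. V i j * cnj (V z j) * walk_weight n V is js z y)"
| "walk_weight n V is js x y = of_bool (x = y)"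

definition loop_weight :: "nat \<Rightarrow> (nat \<Rightarrow> nat \<Rightarrow> complex) \<Rightarrow> nat list \<Rightarrow> nat list \<Rightarrow> complex" where
  "loop_weight n V is js = (\<Sum>x<n. walk_weight n V is js x x)"

lemma sum_triple_product:
  fixes c :: "'a :: comm_semiring_0"
  shows "(c * (\<Sum>j\<in>J. t j)) * (\<Sum>i\<in>I. \<Sum>l\<in>L. u i l) = (\<Sum>j\<in>J. \<Sum>i\<in>I. \<Sum>l\<in>L. c * t j * u i l)"
proof -
  have c: "c * (\<Sum>j\<in>J. t j) = (\<Sum>j\<in>J. c * t j)" by (rule sum_distrib_left)
  show ?thesis
    unfolding c sum_product by (intro sum.cong refl) (rule sum_distrib_left)
qed

lemma matrix_pow_centered_product:
  assumes "x < n"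
  shows "matrix_pow {..<n} (centered_product n V a b) k x y =
    (\<Sum>is\<in>lists_of n k. \<Sum>js\<in>lists_of n k.
      walk_weight n V is js x y * of_real (prod_list (map a is) * prod_list (map b js)))"
  using assms
proof (induction k arbitrary: x)
  case (Suc k)
  let ?w = "\<lambda>is js z. walk_weight n V is js z y"
  let ?p = "\<lambda>is js. of_real (prod_list (map a is) * prod_list (map b js))"
  have "matrix_pow {..<n} (centered_product n V a b) (Suc k) x y =
      (\<Sum>z<n. (of_real (a x) * (\<Sum>j<n. of_real (b j) * (V x j * cnj (V z j)))) *
        (\<Sum>is\<in>lists_of n k. \<Sum>js\<in>lists_of n k. ?w is js z * ?p is js))"
    unfolding matrix_pow.simps
  proof (intro sum.cong refl arg_cong2[of _ _ _ _ "(*)"])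
    fix z assume "z \<in> {..<n}"
    then show "matrix_pow {..<n} (centered_product n V a b) k z y =
        (\<Sum>is\<in>lists_of n k. \<Sum>js\<in>lists_of n k. ?w is js z * ?p is js)"
      by (intro Suc.IH) simp
  qed (rule centered_product_def)
  also have "\<dots> = (\<Sum>z<n. \<Sum>j<n. \<Sum>is\<in>lists_of n k. \<Sum>js\<in>lists_of n k.
      of_real (a x) * of_real (b j) * ?p is js * (V x j * cnj (V z j) * ?w is js z))"
    unfolding sum_triple_product by (intro sum.cong refl) (simp only: ac_simps)
  also have "\<dots> = (\<Sum>j<n. \<Sum>z<n. \<Sum>is\<in>lists_of n k. \<Sum>js\<in>lists_of n k.
      of_real (a x) * of_real (b j) * ?p is js * (V x j * cnj (V z j) * ?w is js z))"
    by (rule sum.swap)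
  also have "\<dots> = (\<Sum>j<n. \<Sum>is\<in>lists_of n k. \<Sum>js\<in>lists_of n k. \<Sum>z<n.
      of_real (a x) * of_real (b j) * ?p is js * (V x j * cnj (V z j) * ?w is js z))"
    by (intro sum.cong refl, subst sum.swap, intro sum.cong refl, subst sum.swap) (rule refl)
  also have "\<dots> = (\<Sum>is\<in>lists_of n k. \<Sum>j<n. \<Sum>js\<in>lists_of n k.
      (\<Sum>z<n. V x j * cnj (V z j) * ?w is js z) * ?p (x # is) (j # js))"
    unfolding sum_distrib_left[symmetric]
    by (subst sum.swap) (intro sum.cong refl, simp add: mult.commute mult.left_commute)
  also have "\<dots> = (\<Sum>is\<in>lists_of n k. \<Sum>js\<in>lists_of n (Suc k). walk_weight n V (x # is) js x y * ?p (x # is) js)"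
    by (simp add: sum_lists_of_Suc)
  also have "\<dots> = (\<Sum>i<n. if i = x then
      (\<Sum>is\<in>lists_of n k. \<Sum>js\<in>lists_of n (Suc k). walk_weight n V (x # is) js x y * ?p (x # is) js) else 0)"
    using Suc.prems by simp
  also have "\<dots> = (\<Sum>i<n. \<Sum>is\<in>lists_of n k. \<Sum>js\<in>lists_of n (Suc k). walk_weight n V (i # is) js x y * ?p (i # is) js)"
    by (intro sum.cong refl) (auto simp: sum_lists_of_Suc)
  also have "\<dots> = (\<Sum>is\<in>lists_of n (Suc k). \<Sum>js\<in>lists_of n (Suc k). ?w is js x * ?p is js)"
    by (simp only: sum_lists_of_Suc[of _ n k])
  finally show ?case .
qed simp

lemma trace_matrix_pow_centered_product:
  "(\<Sum>x<n. matrix_pow {..<n} (centered_product n V a b) k x x) =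
    (\<Sum>is\<in>lists_of n k. \<Sum>js\<in>lists_of n k.
      loop_weight n V is js * of_real (prod_list (map a is) * prod_list (map b js)))"
proof -
  have "(\<Sum>x<n. matrix_pow {..<n} (centered_product n V a b) k x x) =
    (\<Sum>x<n. \<Sum>is\<in>lists_of n k. \<Sum>js\<in>lists_of n k.
      walk_weight n V is js x x * of_real (prod_list (map a is) * prod_list (map b js)))"
    by (intro sum.cong refl matrix_pow_centered_product) simp
  also have "\<dots> = (\<Sum>is\<in>lists_of n k. \<Sum>js\<in>lists_of n k. \<Sum>x<n.
      walk_weight n V is js x x * of_real (prod_list (map a is) * prod_list (map b js)))"
    by (subst sum.swap, intro sum.cong refl, rule sum.swap)
  finally show ?thesis by (simp add: loop_weight_def sum_distrib_right)
qed

text \<open>Keeps a factor n out of the estimates: sums over an intermediate vertex have at most one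
  nonzero term.\<close>

lemma norm_sum_single:
  fixes f :: "nat \<Rightarrow> complex"
  assumes "\<And>z. z < n \<Longrightarrow> z \<noteq> z0 \<Longrightarrow> f z = 0" "\<And>z. z < n \<Longrightarrow> cmod (f z) \<le> B" "0 \<le> B"
  shows "cmod (\<Sum>z<n. f z) \<le> B"
proof -
  have "(\<Sum>z<n. f z) = (\<Sum>z<n. if z = z0 then f z else 0)"
    using assms(1) by (intro sum.cong) auto
  also have "\<dots> = (if z0 < n then f z0 else 0)" by simp
  finally show ?thesis using assms(2,3) by auto
qed

lemma walk_weight_eq_0:
  assumes "length is = length js" "x \<noteq> (case is of [] \<Rightarrow> y | i # _ \<Rightarrow> i)"
  shows "walk_weight n V is js x y = 0"
  using assms by (cases "is"; cases js) auto

lemma norm_walk_weight_le: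
  assumes V: "\<And>i j. i < n \<Longrightarrow> j < n \<Longrightarrow> cmod (V i j) \<le> \<kappa>" and "0 \<le> \<kappa>"
    and "is \<in> lists_of n k" "js \<in> lists_of n k"
  shows "cmod (walk_weight n V is js x y) \<le> \<kappa> ^ (2 * k)"
  using assms(3,4)
proof (induction k arbitrary: "is" js x)
  case (Suc k)
  then obtain i is' j js' where eq: "is = i # is'" "js = j # js'" "i < n" "j < n"
    "is' \<in> lists_of n k" "js' \<in> lists_of n k"
    by (auto simp: lists_of_def length_Suc_conv)
  have "cmod (\<Sum>z<n. V i j * cnj (V z j) * walk_weight n V is' js' z y) \<le> \<kappa> * \<kappa> * \<kappa> ^ (2 * k)"
  proof (rule norm_sum_single[where ?z0.0 = "case is' of [] \<Rightarrow> y | i # _ \<Rightarrow> i"])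
    fix z assume "z < n"
    then show "cmod (V i j * cnj (V z j) * walk_weight n V is' js' z y) \<le> \<kappa> * \<kappa> * \<kappa> ^ (2 * k)"
      unfolding norm_mult using eq \<open>0 \<le> \<kappa>\<close> V[of i j] V[of z j] Suc.IH[of is' js' z]
      by (intro mult_mono) auto
  qed (use eq \<open>0 \<le> \<kappa>\<close> in \<open>auto simp: lists_of_def walk_weight_eq_0\<close>)
  then show ?case using \<open>0 \<le> \<kappa>\<close> by (auto simp: eq norm_mult power_add power2_eq_square ac_simps)
qed (auto simp: lists_of_def)

text \<open>The empty loop has weight n, hence k >= 1. For longer words the first row index fixes
  the base point of the loop.\<close>

lemma norm_loop_weight_le:
  assumes V: "\<And>i j. i < n \<Longrightarrow> j < n \<Longrightarrow> cmod (V i j) \<le> \<kappa>" and \<kappa>: "0 \<le> \<kappa>"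
    and k: "k \<ge> 1" and l: "is \<in> lists_of n k" "js \<in> lists_of n k"
  shows "cmod (loop_weight n V is js) \<le> \<kappa> ^ (2 * k)"
  unfolding loop_weight_def
proof (rule norm_sum_single[where ?z0.0 = "hd is"])
  fix z assume "z \<noteq> hd is"
  then show "walk_weight n V is js z z = 0"
    using k l by (intro walk_weight_eq_0) (auto simp: lists_of_def split: list.split)
qed (use norm_walk_weight_le[OF V \<kappa> l] \<kappa> in auto)

lemma walk_weight_measurable:
  assumes "\<And>i j. (\<lambda>x. V x i j) \<in> borel_measurable N"
  shows "(\<lambda>x. walk_weight n (V x) is js u y) \<in> borel_measurable N"
proof (induction "is" arbitrary: js u)
  case (Cons i "is")
  show ?case
  proof (cases js)
    case (Cons j js')
    have cnj: "(\<lambda>x. cnj (V x z j)) \<in> borel_measurable N" for z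
    proof -
      have "cnj \<in> borel_measurable borel"
        by (intro borel_measurable_continuous_onI continuous_intros)
      then show ?thesis by (rule measurable_compose[OF assms])
    qed
    have "(\<lambda>v. of_bool (i = u) * (\<Sum>z<n. V v i j * cnj (V v z j) * walk_weight n (V v) is js' z y)) \<in> borel_measurable N"
      by (intro borel_measurable_times borel_measurable_const borel_measurable_sum assms cnj Cons.IH)
    then show ?thesis unfolding Cons walk_weight.simps .
  qed (simp only: walk_weight.simps borel_measurable_const)
qed (simp only: walk_weight.simps borel_measurable_const)

lemma loop_weight_measurable:
  assumes "\<And>i j. (\<lambda>x. V x i j) \<in> borel_measurable N"
  shows "(\<lambda>x. loop_weight n (V x) is js) \<in> borel_measurable N"
  unfolding loop_weight_def by (intro borel_measurable_sum walk_weight_measurable assms)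

section \<open>Expectations of products of centred indicators\<close>

context prob_space
begin

text \<open>Expanding over the subsets of \<open>I\<close> reduces the claim to the product rule for
  intersections, which is what \<open>indep_events\<close> provides.\<close>

lemma expectation_prod_affine_indicator:
  fixes u v :: "'i \<Rightarrow> real"
  assumes A: "indep_events A I" and I: "finite I"
  shows "expectation (\<lambda>\<omega>. \<Prod>e\<in>I. u e + v e * indicator (A e) \<omega>) = (\<Prod>e\<in>I. u e + v e * prob (A e))"
proof -
  have ev: "A e \<in> events" if "e \<in> I" for e
    using A that by (auto simp: indep_events_def)
  have summand: "integrable M (\<lambda>\<omega>. (\<Prod>e\<in>I-X. u e) * (\<Prod>e\<in>X. v e * indicator (A e) \<omega>)) \<and>
     expectation (\<lambda>\<omega>. (\<Prod>e\<in>I-X. u e) * (\<Prod>e\<in>X. v e * indicator (A e) \<omega>)) = (\<Prod>e\<in>I-X. u e) * (\<Prod>e\<in>X. v e * prob (A e))"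
    if X: "X \<subseteq> I" for X
  proof (cases "X = {}")
    \<comment> \<open>The product rule speaks of nonempty index sets; an empty intersection would be
      \<open>UNIV\<close>.\<close>
    case True
    then show ?thesis by (simp add: prob_space)
  next
    case False
    have finX: "finite X" using X I finite_subset by blast
    have "(\<Prod>e\<in>X. indicator (A e) \<omega> :: real) = indicator (\<Inter>e\<in>X. A e) \<omega>" for \<omega>
      using finX by (induction X) (auto simp: indicator_def)
    then have *: "(\<Prod>e\<in>I-X. u e) * (\<Prod>e\<in>X. v e * indicator (A e) \<omega>) =
        ((\<Prod>e\<in>I-X. u e) * (\<Prod>e\<in>X. v e)) * indicator (\<Inter>e\<in>X. A e) \<omega>" for \<omega>
      by (simp add: prod.distrib)
    have "(\<Inter>e\<in>X. A e) \<in> events" using finX False ev X by (intro sets.finite_INT) auto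
    moreover have "prob (\<Inter>e\<in>X. A e) = (\<Prod>e\<in>X. prob (A e))"
      using A X False finX by (auto simp: indep_events_def)
    ultimately show ?thesis
      unfolding * by (simp add: prod.distrib less_top[symmetric])
  qed
  have "expectation (\<lambda>\<omega>. \<Prod>e\<in>I. u e + v e * indicator (A e) \<omega>) =
      expectation (\<lambda>\<omega>. \<Sum>X\<in>Pow I. (\<Prod>e\<in>I-X. u e) * (\<Prod>e\<in>X. v e * indicator (A e) \<omega>))"
    by (intro Bochner_Integration.integral_cong refl)
      (subst add.commute, subst prod_add[OF I], simp add: mult.commute)
  also have "\<dots> = (\<Sum>X\<in>Pow I. expectation (\<lambda>\<omega>. (\<Prod>e\<in>I-X. u e) * (\<Prod>e\<in>X. v e * indicator (A e) \<omega>)))"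
    by (rule Bochner_Integration.integral_sum) (use summand in blast)
  also have "\<dots> = (\<Sum>X\<in>Pow I. (\<Prod>e\<in>I-X. u e) * (\<Prod>e\<in>X. v e * prob (A e)))"
    by (intro sum.cong refl) (use summand in blast)
  also have "\<dots> = (\<Prod>e\<in>I. u e + v e * prob (A e))"
    by (subst add.commute, subst prod_add[OF I]) (simp add: mult.commute)
  finally show ?thesis .
qed

lemma prod_list_eq_prod_count:
  fixes f :: "'i \<Rightarrow> real"
  assumes "finite I" "set es \<subseteq> I"
  shows "prod_list (map f es) = (\<Prod>e\<in>I. f e ^ count_list es e)"
  using assms(2)
proof (induction es)
  case (Cons x es)
  have "(\<Prod>e\<in>I. f e ^ count_list (x # es) e) = (\<Prod>e\<in>I. (if e = x then f x else 1) * f e ^ count_list es e)"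
    by (intro prod.cong) auto
  also have "\<dots> = f x * (\<Prod>e\<in>I. f e ^ count_list es e)"
    using Cons.prems assms(1) by (simp add: prod.distrib)
  finally show ?case using Cons by simp
qed simp

text \<open>A power of a centred indicator is again affine in the indicator: it equals (- prob)^m
  off the event and (1 - prob)^m on it. For m = 1 its expectation is zero, and one such factor
  annihilates the product.\<close>

lemma expectation_prod_list_centered_eq_0:
  assumes A: "indep_events A I" and I: "finite I" and es: "set es \<subseteq> I" and nr: "\<not> repeating es"
  shows "expectation (\<lambda>\<omega>. prod_list (map (\<lambda>e. indicator (A e) \<omega> - prob (A e)) es)) = 0"
proof -
  let ?u = "\<lambda>e. (- prob (A e)) ^ count_list es e"
  let ?v = "\<lambda>e. (1 - prob (A e)) ^ count_list es e - ?u e"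
  obtain e0 where e0: "e0 \<in> set es" "count_list es e0 = 1" using nr by (auto simp: repeating_def)
  have "expectation (\<lambda>\<omega>. prod_list (map (\<lambda>e. indicator (A e) \<omega> - prob (A e)) es)) =
      expectation (\<lambda>\<omega>. \<Prod>e\<in>I. ?u e + ?v e * indicator (A e) \<omega>)"
    unfolding prod_list_eq_prod_count[OF I es]
    by (intro Bochner_Integration.integral_cong prod.cong refl) (auto simp: indicator_def)
  also have "\<dots> = (\<Prod>e\<in>I. ?u e + ?v e * prob (A e))"
    by (rule expectation_prod_affine_indicator[OF A I])
  also have "\<dots> = 0"
    using I e0 es by (intro prod_zero bexI[of _ e0]) auto
  finally show ?thesis .
qed

lemma abs_prod_list_le_1:
  assumes "\<And>e. \<bar>f e :: real\<bar> \<le> 1"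
  shows "\<bar>prod_list (map f es)\<bar> \<le> 1"
proof (induction es)
  case (Cons e es)
  have "\<bar>f e\<bar> * \<bar>prod_list (map f es)\<bar> \<le> 1 * 1"
    using assms[of e] Cons by (intro mult_mono) auto
  then show ?case by (simp add: abs_mult)
qed simp

lemma abs_centered_indicator_le_1: "\<bar>indicator B \<omega> - prob C\<bar> \<le> (1::real)"
proof -
  have "(0::real) \<le> indicator B \<omega>" "indicator B \<omega> \<le> (1::real)" by (simp_all add: indicator_def)
  then show ?thesis using prob_le_1[of C] measure_nonneg[of M C] by linarith
qed

text \<open>The series of the \<open>Y n\<close> has finite expectation and therefore converges
  almost surely. Each \<open>Y n\<close> enters through its own expectation, whatever its dependence
  on the others.\<close>

lemma AE_tendsto_0_if_summable_moments:
  fixes Y :: "nat \<Rightarrow> 'a \<Rightarrow> real"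
  assumes [measurable]: "\<And>n. Y n \<in> borel_measurable M" and nn: "\<And>n \<omega>. 0 \<le> Y n \<omega>"
    and int: "\<And>n. integrable M (Y n)" and sum: "summable (\<lambda>n. expectation (Y n))"
  shows "AE \<omega> in M. (\<lambda>n. Y n \<omega>) \<longlonglongrightarrow> 0"
proof -
  have "(\<integral>\<^sup>+\<omega>. (\<Sum>n. ennreal (Y n \<omega>)) \<partial>M) = (\<Sum>n. ennreal (expectation (Y n)))"
    using int nn by (subst nn_integral_suminf) (auto simp: nn_integral_eq_integral)
  also have "\<dots> < \<infinity>"
    using sum nn by (subst suminf_ennreal2) (auto intro!: integral_nonneg_AE simp: less_top)
  finally have "AE \<omega> in M. (\<Sum>n. ennreal (Y n \<omega>)) \<noteq> \<infinity>"
    by (intro nn_integral_noteq_infinite) auto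
  then show ?thesis
  proof eventually_elim
    case (elim \<omega>)
    then have "summable (\<lambda>n. Y n \<omega>)"
      using nn by (intro summable_suminf_not_top) auto
    then show ?case by (rule summable_LIMSEQ_zero)
  qed
qed

end

lemma sum_lists_of_add:
  "(\<Sum>xs\<in>lists_of n (k + l). f xs) = (\<Sum>xs\<in>lists_of n k. \<Sum>ys\<in>lists_of n l. f (xs @ ys))"
proof (induction k arbitrary: f)
  case (Suc k)
  show ?case
    by (simp only: add_Suc sum_lists_of_Suc Suc.IH append_Cons)
qed simp

lemma sum_power_lists_of:
  fixes f :: "nat \<Rightarrow> 'a :: comm_semiring_1"
  shows "(\<Sum>i<n. f i) ^ k = (\<Sum>xs\<in>lists_of n k. prod_list (map f xs))"
proof (induction k)
  case (Suc k)
  show ?case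
    by (simp add: sum_lists_of_Suc Suc sum_product)
qed simp

lemma repeating_map_inj: "inj h \<Longrightarrow> repeating (map h xs) \<longleftrightarrow> repeating xs"
  by (auto simp: repeating_def count_list_inj_map inj_on_subset)

text \<open>Row and column events form one independent family over a disjoint union, so a letter of
  one kind can only be repeated within its own part of the word.\<close>

lemma repeating_sum_listD:
  assumes "repeating (map Inl xs @ map Inr ys)"
  shows "repeating xs \<and> repeating ys"
proof -
  let ?zs = "map Inl xs @ map Inr ys"
  have l: "count_list ?zs (Inl x) = count_list xs x" for x
    by (induction xs) (auto, induction ys, auto)
  have r: "count_list ?zs (Inr y) = count_list ys y" for y
  proof (induction xs)
    case Nil
    show ?case by (induction ys) auto
  qed auto
  have "count_list xs x \<noteq> 1" if "x \<in> set xs" for x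
  proof -
    have "Inl x \<in> set ?zs" using that by simp
    with assms have "count_list ?zs (Inl x) \<noteq> 1" unfolding repeating_def by blast
    then show ?thesis unfolding l .
  qed
  moreover have "count_list ys y \<noteq> 1" if "y \<in> set ys" for y
  proof -
    have "Inr y \<in> set ?zs" using that by simp
    with assms have "count_list ?zs (Inr y) \<noteq> 1" unfolding repeating_def by blast
    then show ?thesis unfolding r .
  qed
  ultimately show ?thesis unfolding repeating_def by blast
qed

lemma sum_of_bool_repeating_le:
  assumes "n \<ge> 1"
  shows "(\<Sum>xs\<in>lists_of n (2 * k). of_bool (repeating xs) :: real) \<le> real n ^ k * real k ^ (2 * k)"
proof -
  have "(\<Sum>xs\<in>lists_of n (2 * k). of_bool (repeating xs) :: real) = card {xs \<in> lists_of n (2 * k). repeating xs}"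
    by (simp add: Int_def)
  also have "\<dots> \<le> real (n ^ k * k ^ (2 * k))"
    using card_repeating_lists[OF assms] by (simp only: of_nat_le_iff)
  finally show ?thesis by simp
qed

context prob_space
begin

lemma expectation_prod_list_centered_le:
  assumes A: "indep_events A I" and I: "finite I" and es: "set es \<subseteq> I"
  shows "\<bar>expectation (\<lambda>\<omega>. prod_list (map (\<lambda>e. indicator (A e) \<omega> - prob (A e)) es))\<bar> \<le> of_bool (repeating es)"
proof (cases "repeating es")
  case True
  have ev: "A e \<in> events" if "e \<in> I" for e using A that by (auto simp: indep_events_def)
  have m: "(\<lambda>\<omega>. prod_list (map (\<lambda>e. indicator (A e) \<omega> - prob (A e)) es)) \<in> borel_measurable M"
    using es by (induction es) (auto intro!: borel_measurable_times borel_measurable_diff borel_measurable_indicator ev)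
  have b: "\<bar>prod_list (map (\<lambda>e. indicator (A e) \<omega> - prob (A e)) es)\<bar> \<le> (1::real)" for \<omega>
    by (rule abs_prod_list_le_1) (rule abs_centered_indicator_le_1)
  have i: "integrable M (\<lambda>\<omega>. prod_list (map (\<lambda>e. indicator (A e) \<omega> - prob (A e)) es))"
    by (rule integrable_const_bound[where B = 1]) (use m b in auto)
  have "\<bar>expectation (\<lambda>\<omega>. prod_list (map (\<lambda>e. indicator (A e) \<omega> - prob (A e)) es))\<bar>
      \<le> expectation (\<lambda>\<omega>. \<bar>prod_list (map (\<lambda>e. indicator (A e) \<omega> - prob (A e)) es)\<bar>)"
    by (rule integral_abs_bound)
  also have "\<dots> \<le> expectation (\<lambda>\<omega>. 1)"
    by (intro integral_mono integrable_abs i) (use b in auto)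
  finally show ?thesis using True by (simp add: prob_space)
qed (simp add: expectation_prod_list_centered_eq_0[OF assms])

text \<open>The second moment divided by n^2 is only of order 1 / n, which is not summable; hence
  the fourth. The constant 16 is k^(2k) at k = 2.\<close>

lemma fourth_moment_centered_sum:
  fixes h :: "nat \<Rightarrow> 'i"
  assumes A: "indep_events A I" and I: "finite I" and h: "inj h" "h ` {..<n} \<subseteq> I" and n: "n \<ge> 1"
    and \<alpha>: "\<And>i. i < n \<Longrightarrow> prob (A (h i)) = \<alpha>"
  defines "Y \<equiv> \<lambda>\<omega>. (\<Sum>i<n. indicator (A (h i)) \<omega> - \<alpha>) ^ 4 :: real"
  shows "Y \<in> borel_measurable M" and "integrable M Y" and "expectation Y \<le> 16 * real n ^ 2"
proof -
  have ev: "A (h i) \<in> events" if "i < n" for i using A h that by (auto simp: indep_events_def)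
  have Y: "Y \<omega> = (\<Sum>xs\<in>lists_of n 4. prod_list (map (\<lambda>e. indicator (A e) \<omega> - prob (A e)) (map h xs)))" for \<omega>
    unfolding Y_def sum_power_lists_of
    by (intro sum.cong refl arg_cong[of _ _ prod_list]) (auto simp: lists_of_def \<alpha>)
  have m: "(\<lambda>\<omega>. prod_list (map (\<lambda>e. indicator (A e) \<omega> - prob (A e)) (map h xs)) :: real) \<in> borel_measurable M"
    if "xs \<in> lists_of n 4" for xs
  proof -
    have "set xs \<subseteq> {..<n}" using that by (simp add: lists_of_def)
    then show ?thesis
      by (induction xs) (auto intro!: borel_measurable_times borel_measurable_diff borel_measurable_indicator ev)
  qed
  have b: "\<bar>prod_list (map (\<lambda>e. indicator (A e) \<omega> - prob (A e)) es)\<bar> \<le> (1::real)" for \<omega> es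
    by (rule abs_prod_list_le_1) (rule abs_centered_indicator_le_1)
  have i: "integrable M (\<lambda>\<omega>. prod_list (map (\<lambda>e. indicator (A e) \<omega> - prob (A e)) (map h xs)) :: real)"
    if "xs \<in> lists_of n 4" for xs
    by (rule integrable_const_bound[where B = 1, OF AE_I2 m[OF that]]) (simp only: real_norm_def b)
  show "Y \<in> borel_measurable M" unfolding Y[abs_def] using m by (intro borel_measurable_sum)
  show "integrable M Y" unfolding Y[abs_def] using i by (intro Bochner_Integration.integrable_sum)
  have "expectation Y = (\<Sum>xs\<in>lists_of n 4. expectation (\<lambda>\<omega>. prod_list (map (\<lambda>e. indicator (A e) \<omega> - prob (A e)) (map h xs))))"
    unfolding Y[abs_def] by (rule Bochner_Integration.integral_sum) (rule i)
  also have "\<dots> \<le> (\<Sum>xs\<in>lists_of n (2 * 2). of_bool (repeating xs))"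
  proof -
    have "expectation (\<lambda>\<omega>. prod_list (map (\<lambda>e. indicator (A e) \<omega> - prob (A e)) (map h xs))) \<le> of_bool (repeating xs)"
      if "xs \<in> lists_of n 4" for xs
    proof -
      have "set (map h xs) \<subseteq> I" using h(2) that by (auto simp: lists_of_def)
      from expectation_prod_list_centered_le[OF A I this] show ?thesis
        unfolding repeating_map_inj[OF h(1)] by linarith
    qed
    moreover have "lists_of n (2 * 2) = lists_of n 4" by simp
    ultimately show ?thesis by (simp only:) (intro sum_mono)
  qed
  also have "\<dots> \<le> real n ^ 2 * real 2 ^ (2 * 2)"
    by (rule sum_of_bool_repeating_le[OF n])
  finally show "expectation Y \<le> 16 * real n ^ 2" by simp
qed

text \<open>The words of the trace and of its conjugate concatenate to length 2 k, so rows and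
  columns leave at most n^k k^(2k) choices each, while the coefficients contribute 4 k entries of V.
  Independence of matrix and index sets separates the two kinds of factors before the
  counting.\<close>

lemma trace_second_moment:
  fixes X :: "'a \<Rightarrow> 'x" and N :: "'x measure" and S :: "'a \<Rightarrow> nat set \<times> nat set"
    and V :: "'x \<Rightarrow> nat \<Rightarrow> nat \<Rightarrow> complex" and \<alpha> \<beta> \<kappa> :: real
  defines "A \<equiv> case_sum (\<lambda>i. {\<omega> \<in> space M. i \<in> fst (S \<omega>)}) (\<lambda>i. {\<omega> \<in> space M. i \<in> snd (S \<omega>)})"
  assumes indep: "\<And>(f :: 'x \<Rightarrow> complex) (g :: nat set \<times> nat set \<Rightarrow> complex).
      f \<in> borel_measurable N \<Longrightarrow> indep_var borel (\<lambda>\<omega>. f (X \<omega>)) borel (\<lambda>\<omega>. g (S \<omega>))"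
    and A: "indep_events A ({..<n} <+> {..<n})"
    and \<alpha>: "\<And>i. i < n \<Longrightarrow> prob {\<omega> \<in> space M. i \<in> fst (S \<omega>)} = \<alpha>"
    and \<beta>: "\<And>i. i < n \<Longrightarrow> prob {\<omega> \<in> space M. i \<in> snd (S \<omega>)} = \<beta>"
    and V: "\<And>i j. (\<lambda>x. V x i j) \<in> borel_measurable N"
    and \<kappa>: "\<And>x i j. i < n \<Longrightarrow> j < n \<Longrightarrow> cmod (V x i j) \<le> \<kappa>" "0 \<le> \<kappa>"
    and n: "n \<ge> 1" and k: "k \<ge> 1"
  defines "Y \<equiv> \<lambda>\<omega>. \<Sum>x<n. matrix_pow {..<n} (centered_product n (V (X \<omega>))
      (\<lambda>i. indicator (fst (S \<omega>)) i - \<alpha>) (\<lambda>t. indicator (snd (S \<omega>)) t - \<beta>)) k x x"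
  shows "(\<lambda>\<omega>. (cmod (Y \<omega>))\<^sup>2) \<in> borel_measurable M" and "integrable M (\<lambda>\<omega>. (cmod (Y \<omega>))\<^sup>2)"
    and "expectation (\<lambda>\<omega>. (cmod (Y \<omega>))\<^sup>2) \<le> \<kappa> ^ (4 * k) * (real n ^ k * real k ^ (2 * k))\<^sup>2"
proof -
  let ?L = "lists_of n k"
  define P where "P = ?L \<times> ?L"
  define c where "c p x = loop_weight n (V x) (fst p) (snd p)" for p x
  define w where "w p s = prod_list (map (\<lambda>i. indicator (fst s) i - \<alpha>) (fst p)) *
    prod_list (map (\<lambda>t. indicator (snd s) t - \<beta>) (snd p))" for p :: "nat list \<times> nat list" and s :: "nat set \<times> nat set"
  define F where "F p p' \<omega> = (c p (X \<omega>) * cnj (c p' (X \<omega>))) * complex_of_real (w p (S \<omega>) * w p' (S \<omega>))" for p p' \<omega>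
  have Yc: "Y \<omega> = (\<Sum>p\<in>P. c p (X \<omega>) * of_real (w p (S \<omega>)))" for \<omega>
    unfolding Y_def trace_matrix_pow_centered_product P_def c_def w_def
    by (simp add: sum.cartesian_product case_prod_beta)
  have Y2: "complex_of_real ((cmod (Y \<omega>))\<^sup>2) = (\<Sum>p\<in>P. \<Sum>p'\<in>P. F p p' \<omega>)" for \<omega>
    unfolding complex_norm_square Yc cnj_sum sum_product F_def
    by (intro sum.cong refl) simp
  have c_bound: "cmod (c p x) \<le> \<kappa> ^ (2 * k)" if "p \<in> P" for p x
    unfolding c_def using that k by (intro norm_loop_weight_le \<kappa>) (auto simp: P_def)
  have cc_bound: "cmod (c p x * cnj (c p' x)) \<le> \<kappa> ^ (4 * k)" if "p \<in> P" "p' \<in> P" for p p' x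
  proof -
    have "cmod (c p x) * cmod (c p' x) \<le> \<kappa> ^ (2 * k) * \<kappa> ^ (2 * k)"
      using c_bound that \<kappa>(2) by (intro mult_mono) auto
    also have "\<dots> = \<kappa> ^ (4 * k)" by (simp add: power_add[symmetric])
    finally show ?thesis by (simp add: norm_mult)
  qed
  have ind_le: "\<bar>indicator B i - \<gamma>\<bar> \<le> (1::real)" if "0 \<le> \<gamma>" "\<gamma> \<le> 1" for B and i :: nat and \<gamma>
    using that by (auto simp: indicator_def)
  \<comment> \<open>Since n >= 1, the index 0 shows that \<alpha> and \<beta> are
    probabilities.\<close>
  have \<alpha>\<beta>: "0 \<le> \<alpha>" "\<alpha> \<le> 1" "0 \<le> \<beta>" "\<beta> \<le> 1"
    using \<alpha>[of 0] \<beta>[of 0] n measure_nonneg prob_le_1 by (metis less_le_trans less_one)+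
  have w_bound: "\<bar>w p s\<bar> \<le> 1" for p s
  proof -
    have "\<bar>prod_list (map (\<lambda>i. indicator (fst s) i - \<alpha>) (fst p))\<bar> * \<bar>prod_list (map (\<lambda>t. indicator (snd s) t - \<beta>) (snd p))\<bar> \<le> 1 * 1"
      using \<alpha>\<beta> by (intro mult_mono abs_prod_list_le_1 ind_le) auto
    then show ?thesis by (simp add: w_def abs_mult)
  qed
  have c_meas: "(\<lambda>x. c p x * cnj (c p' x)) \<in> borel_measurable N" for p p'
  proof -
    have cnj: "cnj \<in> borel_measurable borel"
      by (intro borel_measurable_continuous_onI continuous_intros)
    have "(\<lambda>x. c p x) \<in> borel_measurable N" for p
      unfolding c_def by (rule loop_weight_measurable[OF V])
    then show ?thesis
      by (intro borel_measurable_times measurable_compose[OF _ cnj])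
  qed
  have iv: "indep_var borel (\<lambda>\<omega>. c p (X \<omega>) * cnj (c p' (X \<omega>))) borel (\<lambda>\<omega>. complex_of_real (w p (S \<omega>) * w p' (S \<omega>)))" for p p'
    by (rule indep[OF c_meas])
  have ww_bound: "cmod (complex_of_real (w p s * w p' s)) \<le> 1" for p p' s
  proof -
    have "\<bar>w p s\<bar> * \<bar>w p' s\<bar> \<le> 1 * 1" using w_bound by (intro mult_mono) auto
    then show ?thesis unfolding norm_of_real abs_mult by simp
  qed
  have int1: "integrable M (\<lambda>\<omega>. c p (X \<omega>) * cnj (c p' (X \<omega>)))" if "p \<in> P" "p' \<in> P" for p p'
    using indep_var_rv1[OF iv[of p p']] cc_bound[OF that]
    by (intro integrable_const_bound[where B = "\<kappa> ^ (4 * k)"]) auto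
  have int2: "integrable M (\<lambda>\<omega>. complex_of_real (w p (S \<omega>) * w p' (S \<omega>)))" for p p'
    using indep_var_rv2[OF iv[of p p']] ww_bound
    by (intro integrable_const_bound[where B = 1]) auto
  have F_int: "integrable M (F p p')" if "p \<in> P" "p' \<in> P" for p p'
    unfolding F_def[abs_def] by (rule indep_var_integrable[OF iv int1[OF that] int2])
  have F_exp: "cmod (expectation (F p p')) \<le>
      \<kappa> ^ (4 * k) * (of_bool (repeating (fst p @ fst p')) * of_bool (repeating (snd p @ snd p')))"
    if p: "p \<in> P" "p' \<in> P" for p p'
  proof -
    \<comment> \<open>Rows and columns of both factors as a single word in the joint family
      \<open>A\<close>.\<close>
    let ?es = "map Inl (fst p @ fst p') @ map Inr (snd p @ snd p')"
    have E: "expectation (F p p') = expectation (\<lambda>\<omega>. c p (X \<omega>) * cnj (c p' (X \<omega>))) * expectation (\<lambda>\<omega>. complex_of_real (w p (S \<omega>) * w p' (S \<omega>)))"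
      unfolding F_def[abs_def] by (rule indep_var_lebesgue_integral[OF iv int1[OF p] int2])
    have "cmod (expectation (\<lambda>\<omega>. c p (X \<omega>) * cnj (c p' (X \<omega>)))) \<le> expectation (\<lambda>\<omega>. cmod (c p (X \<omega>) * cnj (c p' (X \<omega>))))"
      by (rule integral_norm_bound)
    also have "\<dots> \<le> expectation (\<lambda>\<omega>. \<kappa> ^ (4 * k))"
      by (intro integral_mono integrable_norm int1 p cc_bound) simp
    finally have 1: "cmod (expectation (\<lambda>\<omega>. c p (X \<omega>) * cnj (c p' (X \<omega>)))) \<le> \<kappa> ^ (4 * k)"
      by (simp add: prob_space)
    have ww: "w p (S \<omega>) * w p' (S \<omega>) = prod_list (map (\<lambda>e. indicator (A e) \<omega> - prob (A e)) ?es)"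
      if \<omega>: "\<omega> \<in> space M" for \<omega>
    proof -
      have l: "indicator (A (Inl i)) \<omega> - prob (A (Inl i)) = indicator (fst (S \<omega>)) i - \<alpha>"
        and r: "indicator (A (Inr i)) \<omega> - prob (A (Inr i)) = indicator (snd (S \<omega>)) i - \<beta>" if "i < n" for i
        using that \<omega> by (simp_all add: A_def \<alpha> \<beta> indicator_def)
      have il: "map (\<lambda>e. indicator (A e) \<omega> - prob (A e)) (map Inl xs) = map (\<lambda>i. indicator (fst (S \<omega>)) i - \<alpha>) xs"
        and ir: "map (\<lambda>e. indicator (A e) \<omega> - prob (A e)) (map Inr xs) = map (\<lambda>i. indicator (snd (S \<omega>)) i - \<beta>) xs"
        if "xs \<in> ?L" for xs
        unfolding map_map comp_def using that by (auto simp: lists_of_def subset_eq intro!: map_cong l r)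
      have "fst p \<in> ?L" "snd p \<in> ?L" "fst p' \<in> ?L" "snd p' \<in> ?L" using p by (auto simp: P_def)
      then show ?thesis
        unfolding map_append prod_list.append il ir w_def by (simp only: il ir ac_simps)
    qed
    have "expectation (\<lambda>\<omega>. complex_of_real (w p (S \<omega>) * w p' (S \<omega>))) = complex_of_real (expectation (\<lambda>\<omega>. w p (S \<omega>) * w p' (S \<omega>)))"
      by (rule integral_complex_of_real)
    also have "expectation (\<lambda>\<omega>. w p (S \<omega>) * w p' (S \<omega>)) = expectation (\<lambda>\<omega>. prod_list (map (\<lambda>e. indicator (A e) \<omega> - prob (A e)) ?es))"
      by (intro Bochner_Integration.integral_cong refl ww)
    finally have "cmod (expectation (\<lambda>\<omega>. complex_of_real (w p (S \<omega>) * w p' (S \<omega>)))) =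
        \<bar>expectation (\<lambda>\<omega>. prod_list (map (\<lambda>e. indicator (A e) \<omega> - prob (A e)) ?es))\<bar>"
      by (simp only: norm_of_real)
    also have "\<dots> \<le> of_bool (repeating ?es)"
    proof (rule expectation_prod_list_centered_le[OF A])
      show "set ?es \<subseteq> {..<n} <+> {..<n}"
        using p by (auto simp: P_def lists_of_def subset_eq)
    qed simp
    also have "\<dots> \<le> of_bool (repeating (fst p @ fst p')) * of_bool (repeating (snd p @ snd p'))"
      using repeating_sum_listD[of "fst p @ fst p'" "snd p @ snd p'"] by auto
    finally have 2: "cmod (expectation (\<lambda>\<omega>. complex_of_real (w p (S \<omega>) * w p' (S \<omega>)))) \<le>
        of_bool (repeating (fst p @ fst p')) * of_bool (repeating (snd p @ snd p'))" .
    show ?thesis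
      unfolding E norm_mult using 1 2 \<kappa>(2) by (intro mult_mono) auto
  qed
  have int_sum: "integrable M (\<lambda>\<omega>. \<Sum>p\<in>P. \<Sum>p'\<in>P. F p p' \<omega>)"
    by (intro Bochner_Integration.integrable_sum F_int)
  have Re_eq: "(cmod (Y \<omega>))\<^sup>2 = Re (\<Sum>p\<in>P. \<Sum>p'\<in>P. F p p' \<omega>)" for \<omega>
    unfolding Y2[symmetric] by simp
  show int: "integrable M (\<lambda>\<omega>. (cmod (Y \<omega>))\<^sup>2)"
    unfolding Re_eq by (rule integrable_Re[OF int_sum])
  then show "(\<lambda>\<omega>. (cmod (Y \<omega>))\<^sup>2) \<in> borel_measurable M" by (rule borel_measurable_integrable)
  define R :: real where "R = (\<Sum>xs\<in>lists_of n (2 * k). of_bool (repeating xs))"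
  have "complex_of_real (expectation (\<lambda>\<omega>. (cmod (Y \<omega>))\<^sup>2)) = (\<Sum>p\<in>P. \<Sum>p'\<in>P. expectation (F p p'))"
  proof -
    have "complex_of_real (expectation (\<lambda>\<omega>. (cmod (Y \<omega>))\<^sup>2)) = expectation (\<lambda>\<omega>. \<Sum>p\<in>P. \<Sum>p'\<in>P. F p p' \<omega>)"
      unfolding Y2[symmetric] by (rule integral_complex_of_real[symmetric])
    also have "\<dots> = (\<Sum>p\<in>P. expectation (\<lambda>\<omega>. \<Sum>p'\<in>P. F p p' \<omega>))"
      by (rule Bochner_Integration.integral_sum) (intro Bochner_Integration.integrable_sum F_int)
    also have "\<dots> = (\<Sum>p\<in>P. \<Sum>p'\<in>P. expectation (F p p'))"
      by (intro sum.cong refl Bochner_Integration.integral_sum F_int)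
    finally show ?thesis .
  qed
  then have "\<bar>expectation (\<lambda>\<omega>. (cmod (Y \<omega>))\<^sup>2)\<bar> = cmod (\<Sum>p\<in>P. \<Sum>p'\<in>P. expectation (F p p'))"
    by (metis norm_of_real)
  also have "\<dots> \<le> (\<Sum>p\<in>P. \<Sum>p'\<in>P. \<kappa> ^ (4 * k) * (of_bool (repeating (fst p @ fst p')) * of_bool (repeating (snd p @ snd p'))))"
    by (intro sum_norm_le F_exp)
  also have "\<dots> = \<kappa> ^ (4 * k) * (\<Sum>p\<in>P. \<Sum>p'\<in>P. of_bool (repeating (fst p @ fst p')) * of_bool (repeating (snd p @ snd p')))"
    by (simp only: sum_distrib_left)
  also have "(\<Sum>p\<in>P. \<Sum>p'\<in>P. of_bool (repeating (fst p @ fst p')) * of_bool (repeating (snd p @ snd p'))) = R * R"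
  proof -
    have "R = (\<Sum>xs\<in>?L. \<Sum>ys\<in>?L. of_bool (repeating (xs @ ys)))"
      unfolding R_def mult_2 sum_lists_of_add ..
    then have RR: "R * R = (\<Sum>xs\<in>?L. \<Sum>us\<in>?L. \<Sum>ys\<in>?L. \<Sum>vs\<in>?L. of_bool (repeating (xs @ ys)) * of_bool (repeating (us @ vs)))"
      by (simp only: sum_product)
    show ?thesis
      by (simp only: P_def sum.cartesian_product' fst_conv snd_conv RR)
  qed
  finally have "expectation (\<lambda>\<omega>. (cmod (Y \<omega>))\<^sup>2) \<le> \<kappa> ^ (4 * k) * R\<^sup>2"
    by (simp add: power2_eq_square)
  also have "\<dots> \<le> \<kappa> ^ (4 * k) * (real n ^ k * real k ^ (2 * k))\<^sup>2"
    using \<kappa>(2) sum_of_bool_repeating_le[OF n, of k]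
    by (intro mult_left_mono power_mono) (auto simp: R_def intro!: sum_nonneg)
  finally show "expectation (\<lambda>\<omega>. (cmod (Y \<omega>))\<^sup>2) \<le> \<kappa> ^ (4 * k) * (real n ^ k * real k ^ (2 * k))\<^sup>2" .
qed

end

section \<open>Flatness of Fourier and Haar matrices\<close>

lemma cosh_le_exp_half_square: "(exp x + exp (- x)) / 2 \<le> exp (x\<^sup>2 / 2)" for x :: real
proof -
  have *: "(exp x + exp (- x)) / 2 \<le> exp (x\<^sup>2 / 2)" if "0 \<le> x" for x :: real
  proof -
    have e: "1 + 1 / 2 * (exp (2 * x) - 1) = (1 + exp (2 * x)) / 2" by (simp add: field_simps)
    \<comment> \<open>Hoeffding's estimate for a fair two-point variable on an interval of length 2
      x; the left side is ln (cosh x).\<close>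
    have "- (2 * x) * (1 / 2) + ln (1 + 1 / 2 * (exp (2 * x) - 1)) \<le> (2 * x)\<^sup>2 / 8"
      using that by (intro Hoeffdings_lemma_aux) auto
    then have "ln ((1 + exp (2 * x)) / 2) \<le> x + x\<^sup>2 / 2"
      unfolding e by (simp add: power_mult_distrib)
    then have "exp (ln ((1 + exp (2 * x)) / 2)) \<le> exp (x + x\<^sup>2 / 2)"
      by (simp only: exp_le_cancel_iff)
    moreover have "0 < (1 + exp (2 * x)) / 2" by (simp add: add_pos_pos)
    ultimately have "(1 + exp (2 * x)) / 2 \<le> exp (x + x\<^sup>2 / 2)"
      by (simp only: exp_ln)
    then have "(1 + exp (2 * x)) / 2 * exp (- x) \<le> exp (x + x\<^sup>2 / 2) * exp (- x)"
      by (intro mult_right_mono) simp_all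
    moreover have "(1 + exp (2 * x)) / 2 * exp (- x) = (exp x + exp (- x)) / 2"
      by (simp add: distrib_right exp_add[symmetric] add.commute)
    moreover have "exp (x + x\<^sup>2 / 2) * exp (- x) = exp (x\<^sup>2 / 2)"
      by (simp add: exp_add[symmetric])
    ultimately show ?thesis by simp
  qed
  show ?thesis using *[of x] *[of "- x"] by (cases "0 \<le> x") (auto simp: add.commute)
qed

definition sign_of :: "nat set \<Rightarrow> nat \<Rightarrow> real" where
  "sign_of B l = (if l \<in> B then - 1 else 1)"

text \<open>Up to the factor 2^n, the moment generating function of a Rademacher sum. Signs are
  averaged by counting subsets, so no auxiliary probability space enters.\<close>

lemma sum_exp_signs:
  fixes x :: "nat \<Rightarrow> real"
  shows "(\<Sum>B\<in>Pow {..<n}. exp (\<Sum>l<n. sign_of B l * x l)) = (\<Prod>l<n. exp (- x l) + exp (x l))"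
proof -
  have "(\<Prod>l<n. exp (- x l) + exp (x l)) = (\<Sum>B\<in>Pow {..<n}. (\<Prod>l\<in>B. exp (- x l)) * (\<Prod>l\<in>{..<n} - B. exp (x l)))"
    by (rule prod_add) simp
  also have "\<dots> = (\<Sum>B\<in>Pow {..<n}. \<Prod>l<n. exp (sign_of B l * x l))"
  proof (intro sum.cong refl)
    fix B assume "B \<in> Pow {..<n}"
    then have B: "B \<subseteq> {..<n}" by simp
    have "(\<Prod>l<n. exp (sign_of B l * x l)) = (\<Prod>l\<in>{..<n} - B. exp (sign_of B l * x l)) * (\<Prod>l\<in>B. exp (sign_of B l * x l))"
      by (rule prod.subset_diff[OF B]) simp
    also have "(\<Prod>l\<in>{..<n} - B. exp (sign_of B l * x l)) = (\<Prod>l\<in>{..<n} - B. exp (x l))"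
      by (intro prod.cong) (auto simp: sign_of_def)
    also have "(\<Prod>l\<in>B. exp (sign_of B l * x l)) = (\<Prod>l\<in>B. exp (- x l))"
      by (intro prod.cong) (auto simp: sign_of_def)
    finally show "(\<Prod>l\<in>B. exp (- x l)) * (\<Prod>l\<in>{..<n} - B. exp (x l)) = (\<Prod>l<n. exp (sign_of B l * x l))"
      by (simp add: mult.commute)
  qed
  finally show ?thesis by (simp add: exp_sum)
qed

lemma card_signs_gt:
  fixes x :: "nat \<Rightarrow> real"
  assumes \<sigma>: "(\<Sum>l<n. (x l)\<^sup>2) \<le> s" "0 < s" and t: "0 \<le> t"
  shows "real (card {B \<in> Pow {..<n}. t < (\<Sum>l<n. sign_of B l * x l)}) \<le> 2 ^ n * exp (- (t\<^sup>2 / (2 * s)))"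
proof -
  \<comment> \<open>Minimises the Chernoff exponent u^2 s / 2 - u t.\<close>
  define u where "u = t / s"
  have u: "0 \<le> u" using t \<sigma> by (simp add: u_def)
  let ?G = "{B \<in> Pow {..<n}. t < (\<Sum>l<n. sign_of B l * x l)}"
  have "real (card ?G) * exp (u * t) = (\<Sum>B\<in>?G. exp (u * t))" by simp
  also have "\<dots> \<le> (\<Sum>B\<in>?G. exp (\<Sum>l<n. sign_of B l * (u * x l)))"
  proof (intro sum_mono)
    fix B assume "B \<in> ?G"
    then have "u * t \<le> u * (\<Sum>l<n. sign_of B l * x l)" using u by (intro mult_left_mono) auto
    then show "exp (u * t) \<le> exp (\<Sum>l<n. sign_of B l * (u * x l))"
      by (simp add: sum_distrib_left mult.left_commute)
  qed
  also have "\<dots> \<le> (\<Sum>B\<in>Pow {..<n}. exp (\<Sum>l<n. sign_of B l * (u * x l)))"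
    by (intro sum_mono2) auto
  also have "\<dots> = (\<Prod>l<n. exp (- (u * x l)) + exp (u * x l))" by (rule sum_exp_signs)
  also have "\<dots> \<le> (\<Prod>l<n. 2 * exp ((u * x l)\<^sup>2 / 2))"
  proof (intro prod_mono conjI)
    fix l
    show "exp (- (u * x l)) + exp (u * x l) \<le> 2 * exp ((u * x l)\<^sup>2 / 2)"
      using cosh_le_exp_half_square[of "u * x l"] by simp
  qed (simp add: add_nonneg_nonneg)
  also have "\<dots> = 2 ^ n * exp (u\<^sup>2 / 2 * (\<Sum>l<n. (x l)\<^sup>2))"
    by (simp add: prod.distrib exp_sum[symmetric] sum_distrib_left power_mult_distrib)
  also have "\<dots> \<le> 2 ^ n * exp (u\<^sup>2 / 2 * s)"
    using \<sigma> by (intro mult_left_mono) (auto intro!: mult_left_mono)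
  finally have **: "real (card ?G) * exp (u * t) * exp (- (u * t)) \<le> 2 ^ n * exp (u\<^sup>2 / 2 * s) * exp (- (u * t))"
    by (intro mult_right_mono) auto
  have *: "real (card ?G) * exp (u * t) * exp (- (u * t)) = real (card ?G)"
    by (simp add: mult.assoc exp_add[symmetric])
  have ***: "2 ^ n * exp (u\<^sup>2 / 2 * s) * exp (- (u * t)) = 2 ^ n * exp (- (t\<^sup>2 / (2 * s)))"
  proof -
    have "u\<^sup>2 / 2 * s + - (u * t) = - (t\<^sup>2 / (2 * s))"
      using \<sigma>(2) by (simp add: u_def field_simps power2_eq_square)
    then show ?thesis by (simp only: mult.assoc exp_add[symmetric])
  qed
  show ?thesis using ** unfolding * *** .
qed

text \<open>A modulus above t forces the real or the imaginary part above t / sqrt 2 in absolute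
  value. Two parts with two signs give the factor 4, and halving the square turns 2 s into 4
  s.\<close>

lemma card_signs_norm_gt:
  fixes z :: "nat \<Rightarrow> complex"
  assumes s: "(\<Sum>l<n. (cmod (z l))\<^sup>2) \<le> s" "0 < s" and t: "0 \<le> t"
  shows "real (card {B \<in> Pow {..<n}. t < cmod (\<Sum>l<n. of_real (sign_of B l) * z l)}) \<le> 4 * 2 ^ n * exp (- (t\<^sup>2 / (4 * s)))"
proof -
  let ?t = "t / sqrt 2"
  let ?G = "\<lambda>x. {B \<in> Pow {..<n}. ?t < (\<Sum>l<n. sign_of B l * x l)}"
  have bound: "real (card (?G x)) \<le> 2 ^ n * exp (- (t\<^sup>2 / (4 * s)))" if "\<And>l. (x l)\<^sup>2 \<le> (cmod (z l))\<^sup>2" for x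
  proof -
    have "(\<Sum>l<n. (x l)\<^sup>2) \<le> s" using s(1) sum_mono[of "{..<n}" "\<lambda>l. (x l)\<^sup>2", OF that] by linarith
    from card_signs_gt[OF this s(2), of ?t] t show ?thesis by (simp add: power_divide)
  qed
  have sub: "{B \<in> Pow {..<n}. t < cmod (\<Sum>l<n. of_real (sign_of B l) * z l)} \<subseteq>
      (?G (\<lambda>l. Re (z l)) \<union> ?G (\<lambda>l. - Re (z l))) \<union> (?G (\<lambda>l. Im (z l)) \<union> ?G (\<lambda>l. - Im (z l)))"
  proof
    fix B assume B: "B \<in> {B \<in> Pow {..<n}. t < cmod (\<Sum>l<n. of_real (sign_of B l) * z l)}"
    let ?w = "\<Sum>l<n. of_real (sign_of B l) * z l"
    have "?t < \<bar>Re ?w\<bar> \<or> ?t < \<bar>Im ?w\<bar>"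
    proof (rule ccontr)
      assume "\<not> ?thesis"
      then have "\<bar>Re ?w\<bar>\<^sup>2 \<le> ?t\<^sup>2" "\<bar>Im ?w\<bar>\<^sup>2 \<le> ?t\<^sup>2" by (intro power_mono; simp)+
      then have "(cmod ?w)\<^sup>2 \<le> t\<^sup>2" unfolding cmod_power2 by (simp add: power_divide)
      then have "cmod ?w \<le> t" using t by (rule power2_le_imp_le)
      then show False using B by simp
    qed
    then show "B \<in> (?G (\<lambda>l. Re (z l)) \<union> ?G (\<lambda>l. - Re (z l))) \<union> (?G (\<lambda>l. Im (z l)) \<union> ?G (\<lambda>l. - Im (z l)))"
      using B by (auto simp: abs_if sum_negf split: if_splits)
  qed
  have "card {B \<in> Pow {..<n}. t < cmod (\<Sum>l<n. of_real (sign_of B l) * z l)} \<le>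
      card ((?G (\<lambda>l. Re (z l)) \<union> ?G (\<lambda>l. - Re (z l))) \<union> (?G (\<lambda>l. Im (z l)) \<union> ?G (\<lambda>l. - Im (z l))))"
    by (rule card_mono[OF _ sub]) simp
  also have "\<dots> \<le> (card (?G (\<lambda>l. Re (z l))) + card (?G (\<lambda>l. - Re (z l)))) + (card (?G (\<lambda>l. Im (z l))) + card (?G (\<lambda>l. - Im (z l))))"
    by (intro order_trans[OF card_Un_le] add_mono card_Un_le)
  finally have "real (card {B \<in> Pow {..<n}. t < cmod (\<Sum>l<n. of_real (sign_of B l) * z l)}) \<le>
     (real (card (?G (\<lambda>l. Re (z l)))) + real (card (?G (\<lambda>l. - Re (z l))))) + (real (card (?G (\<lambda>l. Im (z l)))) + real (card (?G (\<lambda>l. - Im (z l)))))"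
    by linarith
  moreover have "real (card (?G (\<lambda>l. Re (z l)))) \<le> 2 ^ n * exp (- (t\<^sup>2 / (4 * s)))"
    "real (card (?G (\<lambda>l. - Re (z l)))) \<le> 2 ^ n * exp (- (t\<^sup>2 / (4 * s)))"
    "real (card (?G (\<lambda>l. Im (z l)))) \<le> 2 ^ n * exp (- (t\<^sup>2 / (4 * s)))"
    "real (card (?G (\<lambda>l. - Im (z l)))) \<le> 2 ^ n * exp (- (t\<^sup>2 / (4 * s)))"
    by (rule bound, simp add: cmod_power2)+
  ultimately show ?thesis by linarith
qed

section \<open>Signed Fourier matrices and the tail of a Haar entry\<close>

lemma unitary_on_imp_unitary_group:
  assumes "unitary_on n V"
  shows "Matrix.mat n n (\<lambda>(i, j). V i j) \<in> unitary_group n"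
proof -
  let ?M = "Matrix.mat n n (\<lambda>(i, j). V i j)"
  have M: "?M \<in> carrier_mat n n" by simp
  note c = mat_adjoint_carrier[OF M]
  have "?M * mat_adjoint ?M = 1\<^sub>m n"
    using assms M c unfolding unitary_on_def
    by (intro eq_matI) (auto simp: scalar_prod_def atLeast0LessThan mat_adjoint_index[OF M])
  moreover have "mat_adjoint ?M * ?M = 1\<^sub>m n"
    using assms M c unfolding unitary_on_def
    by (intro eq_matI) (auto simp: scalar_prod_def atLeast0LessThan mat_adjoint_index[OF M])
  ultimately show ?thesis using M by (simp add: unitary_group_def)
qed

definition dft_entry :: "nat \<Rightarrow> nat \<Rightarrow> nat \<Rightarrow> complex" where
  "dft_entry n j k = complex_of_real (1 / sqrt (real n)) *
     exp (- (2 * complex_of_real pi * \<i> * of_nat j * of_nat k / of_nat n))"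

lemma dft_mat_eq: "dft_mat n = Matrix.mat n n (\<lambda>(j, k). dft_entry n j k)"
  by (simp add: dft_mat_def dft_entry_def)

lemma dft_entry_sym: "dft_entry n j k = dft_entry n k j"
  by (simp add: dft_entry_def mult.commute mult.left_commute)

lemma norm_dft_entry: "cmod (dft_entry n j k) = 1 / sqrt (real n)"
proof -
  have *: "- (2 * complex_of_real pi * \<i> * of_nat j * of_nat k / of_nat n) = \<i> * of_real (- (2 * pi * j * k / n))"
    by simp
  show ?thesis
    unfolding dft_entry_def norm_mult * norm_exp_i_times norm_of_real by simp
qed

lemma sum_dft_entry:
  assumes "i < n" "j < n"
  shows "(\<Sum>t<n. dft_entry n i t * cnj (dft_entry n j t)) = of_bool (i = j)"
proof -
  define z where "z = exp (2 * of_real pi * \<i> * of_nat j / of_nat n) / exp (2 * of_real pi * \<i> * of_nat i / of_nat n)"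
  have n: "n \<ge> 1" using assms by simp
  have zt: "dft_entry n i t * cnj (dft_entry n j t) = z ^ t / of_nat n" for t
  proof -
    have "cnj (dft_entry n j t) = of_real (1 / sqrt n) * exp (2 * of_real pi * \<i> * of_nat j * of_nat t / of_nat n)"
    proof -
      have "cnj (exp (- (2 * of_real pi * \<i> * of_nat j * of_nat t / of_nat n))) =
          exp (2 * of_real pi * \<i> * of_nat j * of_nat t / of_nat n)"
        by (subst exp_cnj) simp
      then show ?thesis by (simp only: dft_entry_def complex_cnj_mult complex_cnj_complex_of_real)
    qed
    then have "dft_entry n i t * cnj (dft_entry n j t) = of_real (1 / sqrt n * (1 / sqrt n)) *
        (exp (- (2 * of_real pi * \<i> * of_nat i * of_nat t / of_nat n)) * exp (2 * of_real pi * \<i> * of_nat j * of_nat t / of_nat n))"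
      by (simp only: dft_entry_def of_real_mult ac_simps)
    also have "1 / sqrt n * (1 / sqrt n) = 1 / n" by simp
    also have "exp (- (2 * of_real pi * \<i> * of_nat i * of_nat t / of_nat n)) * exp (2 * of_real pi * \<i> * of_nat j * of_nat t / of_nat n) = z ^ t"
    proof -
      have "z = exp (2 * of_real pi * \<i> * of_nat j / of_nat n - 2 * of_real pi * \<i> * of_nat i / of_nat n)"
        by (simp add: z_def exp_diff)
      then have "z ^ t = exp (of_nat t * (2 * of_real pi * \<i> * of_nat j / of_nat n - 2 * of_real pi * \<i> * of_nat i / of_nat n))"
        by (simp add: exp_of_nat_mult)
      then show ?thesis by (simp add: exp_add[symmetric] algebra_simps)
    qed
    finally show ?thesis by simp
  qed
  have zn: "z ^ n = 1"
  proof -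
    have "exp (2 * of_real pi * \<i> * of_nat m / of_nat n) ^ n = 1" for m
      using n by (intro complex_root_unity) simp
    then show ?thesis by (simp add: z_def power_divide)
  qed
  show ?thesis
  proof (cases "i = j")
    case True
    then have "z = 1" by (simp add: z_def)
    then show ?thesis unfolding zt using True n by simp
  next
    case False
    have "z \<noteq> 1"
    proof
      assume "z = 1"
      then have "exp (2 * of_real pi * \<i> * of_nat j / of_nat n) = exp (2 * of_real pi * \<i> * of_nat i / of_nat n)"
        by (simp add: z_def)
      then have "j mod n = i mod n" using complex_root_unity_eq[OF n] by blast
      then show False using assms False by simp
    qed
    then have "(\<Sum>t<n. z ^ t) = 0" by (simp add: geometric_sum zn)
    then show ?thesis unfolding zt sum_divide_distrib[symmetric] using False by simp
  qed
qed

text \<open>In products of rows the signs cancel; in products of columns they factor out, and the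
  symmetry of the Fourier matrix reduces columns to rows.\<close>

lemma unitary_on_signed_dft: "unitary_on n (\<lambda>i l. dft_entry n i l * of_real (sign_of B l))"
proof -
  have s: "of_real (sign_of B l) * of_real (sign_of B l) = (1::complex)" for l by (simp add: sign_of_def)
  have 1: "dft_entry n i t * of_real (sign_of B t) * cnj (dft_entry n j t * of_real (sign_of B t)) = dft_entry n i t * cnj (dft_entry n j t)" for i j t
  proof -
    have "dft_entry n i t * of_real (sign_of B t) * cnj (dft_entry n j t * of_real (sign_of B t)) =
        dft_entry n i t * cnj (dft_entry n j t) * (of_real (sign_of B t) * of_real (sign_of B t))"
      by (simp only: complex_cnj_mult complex_cnj_complex_of_real ac_simps)
    then show ?thesis by (simp only: s mult_1_right)
  qed
  have 2: "cnj (dft_entry n i u * of_real (sign_of B u)) * (dft_entry n i t * of_real (sign_of B t)) =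
      of_real (sign_of B u) * of_real (sign_of B t) * (dft_entry n t i * cnj (dft_entry n u i))" for i u t
    unfolding dft_entry_sym[of n i u] dft_entry_sym[of n i t]
    by (simp only: complex_cnj_mult complex_cnj_complex_of_real ac_simps)
  have 3: "(\<Sum>i<n. of_real (sign_of B u) * of_real (sign_of B t) * (dft_entry n t i * cnj (dft_entry n u i))) = of_bool (u = t)"
    if "u < n" "t < n" for u t
    unfolding sum_distrib_left[symmetric] sum_dft_entry[OF that(2,1)] using s[of t] by auto
  show ?thesis
    unfolding unitary_on_def 1 2 using 3 sum_dft_entry by blast
qed

lemma dft_mat_unitary: "dft_mat n \<in> unitary_group n"
  using unitary_on_imp_unitary_group[OF unitary_on_signed_dft[of n "{}"]]
  by (simp add: dft_mat_eq sign_of_def)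

text \<open>By invariance each of the 2^n matrices \<open>W B * A\<close> has the law of
  \<open>A\<close>. Adding up their tails and exchanging sum and integral leaves, for every fixed
  \<open>A\<close>, a count of sign patterns; the distribution of Haar entries is never
  computed.\<close>

lemma haar_entry_tail:
  assumes haar: "haar_unitary n \<mu>" and ij: "i < n" "j < n" and t: "0 \<le> t"
  shows "measure \<mu> {A \<in> unitary_group n. t < cmod (A $$ (i, j))} \<le> 4 * exp (- (real n * t\<^sup>2 / 4))"
proof -
  interpret \<mu>: prob_space \<mu> using haar by (simp add: haar_unitary_def)
  have sets: "sets \<mu> = sets (unitary_space n)" using haar by (simp add: haar_unitary_def)
  have space: "space \<mu> = unitary_group n" using sets_eq_imp_space_eq[OF sets] by simp
  have inv: "distr \<mu> (unitary_space n) (\<lambda>A. W * A) = \<mu>" if "W \<in> unitary_group n" for W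
    using haar that by (simp add: haar_unitary_def)
  define E where "E = {A \<in> unitary_group n. t < cmod (A $$ (i, j))}"
  have E_sets: "E \<in> sets (unitary_space n)"
  proof -
    have "(\<lambda>A. cmod (A $$ (i, j))) \<in> borel_measurable (unitary_space n)"
      using measurable_unitary_space_entry[OF ij] by measurable
    then have "{A \<in> space (unitary_space n). t < cmod (A $$ (i, j))} \<in> sets (unitary_space n)"
      by measurable
    then show ?thesis by (simp add: E_def)
  qed
  define W where "W B = Matrix.mat n n (\<lambda>(i, l). dft_entry n i l * of_real (sign_of B l))" for B
  have W: "W B \<in> unitary_group n" for B
    unfolding W_def by (rule unitary_on_imp_unitary_group[OF unitary_on_signed_dft])
  have W_meas: "(\<lambda>A. W B * A) \<in> measurable \<mu> (unitary_space n)" for B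
    using measurable_unitary_space_mult_left[OF W] by (simp add: measurable_cong_sets[OF sets refl])
  define EB where "EB B = {A \<in> unitary_group n. W B * A \<in> E}" for B
  have EB: "measure \<mu> (EB B) = measure \<mu> E" "EB B \<in> sets \<mu>" for B
  proof -
    have *: "EB B = (\<lambda>A. W B * A) -` E \<inter> space \<mu>" by (auto simp: EB_def space)
    show "EB B \<in> sets \<mu>" unfolding * by (rule measurable_sets[OF W_meas E_sets])
    have "measure \<mu> E = measure (distr \<mu> (unitary_space n) (\<lambda>A. W B * A)) E" by (simp add: inv[OF W])
    also have "\<dots> = measure \<mu> (EB B)" unfolding * by (rule measure_distr[OF W_meas E_sets])
    finally show "measure \<mu> (EB B) = measure \<mu> E" ..
  qed
  have count: "(\<Sum>B\<in>Pow {..<n}. indicator (EB B) A) \<le> 4 * 2 ^ n * exp (- (real n * t\<^sup>2 / 4))"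
    if A: "A \<in> unitary_group n" for A
  proof -
    define z where "z l = dft_entry n i l * A $$ (l, j)" for l
    have Ac: "A \<in> carrier_mat n n" using A by (simp add: unitary_group_def)
    have entry: "(W B * A) $$ (i, j) = (\<Sum>l<n. of_real (sign_of B l) * z l)" for B
      using Ac ij by (auto simp: W_def scalar_prod_def z_def atLeast0LessThan intro!: sum.cong)
    have n: "0 < real n" using ij by simp
    have "(\<Sum>l<n. (cmod (z l))\<^sup>2) = (\<Sum>l<n. (cmod (A $$ (l, j)))\<^sup>2 / n)"
      by (simp add: z_def norm_mult norm_dft_entry power_mult_distrib power_divide)
    also have "\<dots> = (\<Sum>l<n. (cmod (A $$ (l, j)))\<^sup>2) / n" by (rule sum_divide_distrib[symmetric])
    also have "(\<Sum>l<n. (cmod (A $$ (l, j)))\<^sup>2) = 1"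
    proof -
      have "complex_of_real (\<Sum>l<n. (cmod (A $$ (l, j)))\<^sup>2) = (\<Sum>l<n. cnj (A $$ (l, j)) * A $$ (l, j))"
        unfolding of_real_sum complex_norm_square by (simp add: mult.commute)
      also have "\<dots> = 1"
        using unitary_group_imp_unitary_on[OF A] ij by (simp add: unitary_on_def)
      finally show ?thesis by (metis of_real_eq_1_iff)
    qed
    \<comment> \<open>Entries of a Fourier row have modulus 1 / sqrt n, and a column of
      \<open>A\<close> has norm 1.\<close>
    finally have s: "(\<Sum>l<n. (cmod (z l))\<^sup>2) \<le> 1 / n" by simp
    have "(\<Sum>B\<in>Pow {..<n}. indicator (EB B) A :: real) = (\<Sum>B\<in>Pow {..<n}. of_bool (t < cmod (\<Sum>l<n. of_real (sign_of B l) * z l)))"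
      using A unitary_group_mult[OF W A]
      by (intro sum.cong) (auto simp: EB_def E_def entry indicator_def)
    also have "\<dots> = real (card {B \<in> Pow {..<n}. t < cmod (\<Sum>l<n. of_real (sign_of B l) * z l)})"
      by (simp add: Int_def)
    also have "\<dots> \<le> 4 * 2 ^ n * exp (- (t\<^sup>2 / (4 * (1 / n))))"
      using n by (intro card_signs_norm_gt s t) simp
    finally show ?thesis using n by (simp add: mult.commute)
  qed
  have "2 ^ n * measure \<mu> E = (\<Sum>B\<in>Pow {..<n}. measure \<mu> (EB B))"
    by (simp add: EB card_Pow)
  also have "\<dots> = (\<Sum>B\<in>Pow {..<n}. \<integral>A. indicator (EB B) A \<partial>\<mu>)"
    using EB(2) by (intro sum.cong refl) (simp add: space[symmetric] sets.sets_into_space Int_absorb2)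
  also have "\<dots> = (\<integral>A. (\<Sum>B\<in>Pow {..<n}. indicator (EB B) A) \<partial>\<mu>)"
    using EB(2) by (intro Bochner_Integration.integral_sum[symmetric]) (simp add: less_top[symmetric])
  also have "\<dots> \<le> (\<integral>A. 4 * 2 ^ n * exp (- (real n * t\<^sup>2 / 4)) \<partial>\<mu>)"
    using EB(2) count by (intro integral_mono Bochner_Integration.integrable_sum) (auto simp: space less_top[symmetric])
  also have "\<dots> = 2 ^ n * (4 * exp (- (real n * t\<^sup>2 / 4)))" by (simp add: \<mu>.prob_space)
  finally have "measure \<mu> E \<le> 4 * exp (- (real n * t\<^sup>2 / 4))" by (rule mult_left_le_imp_le) simp
  then show ?thesis by (simp add: E_def)
qed

section \<open>Almost sure convergence\<close>

lemma trace_centered_product_cong: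
  assumes "\<And>i j. i < n \<Longrightarrow> j < n \<Longrightarrow> V i j = W i j"
  shows "(\<Sum>x<n. matrix_pow {..<n} (centered_product n V a b) k x x) =
    (\<Sum>x<n. matrix_pow {..<n} (centered_product n W a b) k x x)"
proof -
  have c: "centered_product n V a b x l = centered_product n W a b x l" if "x < n" "l < n" for x l
    using that assms by (auto simp: centered_product_def intro!: sum.cong)
  have "matrix_pow {..<n} (centered_product n V a b) k x y = matrix_pow {..<n} (centered_product n W a b) k x y"
    if "x < n" for x y using that
  proof (induction k arbitrary: x)
    case (Suc k)
    show ?case
      unfolding matrix_pow.simps
      by (intro sum.cong refl arg_cong2[of _ _ _ _ "(*)"] c Suc) (use Suc.prems in simp_all)
  qed simp
  then show ?thesis by (intro sum.cong) auto
qed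

context wachter_parameters
begin

text \<open>Deterministic, to be applied outcome by outcome: the limits of the cardinalities and of
  the traces carry all the probabilistic information.\<close>

lemma weak_conv_submatrix:
  fixes V :: "nat \<Rightarrow> complex mat" and Om T :: "nat \<Rightarrow> nat set"
  assumes V: "\<And>n. n \<ge> 1 \<Longrightarrow> V n \<in> unitary_group n"
    and Om: "\<And>n. n \<ge> 1 \<Longrightarrow> Om n \<subseteq> {..<n}" and T: "\<And>n. n \<ge> 1 \<Longrightarrow> T n \<subseteq> {..<n}"
    and card_Om: "(\<lambda>n. card (Om n) / n) \<longlonglongrightarrow> 1 - q" and card_T: "(\<lambda>n. card (T n) / n) \<longlonglongrightarrow> 1 - p"
    and trace: "\<And>k. k \<ge> 1 \<Longrightarrow>
      (\<lambda>n. (\<Sum>x<n. matrix_pow {..<n} (centered_product n (\<lambda>i j. V n $$ (i, j))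
        (\<lambda>i. indicator (Om n) i - (1 - q)) (\<lambda>t. indicator (T n) t - (1 - p))) k x x) / of_nat n) \<longlonglongrightarrow> 0"
  shows "weak_conv_m (\<lambda>n. empirical_distribution (take (min (card (T n)) (card (Om n)))
      (singular_values (submatrix (V n) (Om n) (T n))))) (fs_measure p q)"
proof -
  define \<alpha> \<beta> c D where ab: "\<alpha> = 1 - q" "\<beta> = 1 - p" "c = \<alpha> + \<beta> - 2 * \<alpha> * \<beta>" "D = \<alpha> * \<beta> * (1 - \<alpha>) * (1 - \<beta>)"
  define xs where "xs n = take (min (card (T n)) (card (Om n))) (singular_values (submatrix (V n) (Om n) (T n)))" for n
  define r where "r n = min (card (T n)) (card (Om n))" for n
  define good where "good n E \<longleftrightarrow> (\<forall>x. x \<in># E \<longrightarrow> 0 \<le> x \<and> x \<le> 1) \<and>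
      (\<forall>j. (\<Sum>i\<in>Om n. matrix_pow (Om n) (column_gram (\<lambda>i j. V n $$ (i, j)) (T n)) j i i) = (\<Sum>x\<in>#E. of_real (x ^ j))) \<and>
      length (xs n) = r n \<and>
      (\<forall>f. (\<Sum>x\<leftarrow>xs n. f x) = (\<Sum>x\<in>#E. f (sqrt x)) - (real (card (Om n)) - real (r n)) * f 0)"
    for n and E :: "real multiset"
  \<comment> \<open>Chosen separately for each n; at n = 0 it is arbitrary, which the guards n >= 1
    respect.\<close>
  define E where "E n = (SOME E. good n E)" for n
  have good: "good n (E n)" if n: "n \<ge> 1" for n
    unfolding E_def
  proof (rule someI_ex, rule singular_values_submatrix[OF V[OF n] Om[OF n] T[OF n]])
    fix E' :: "real multiset"
    assume "\<And>x. x \<in># E' \<Longrightarrow> 0 \<le> x \<and> x \<le> 1"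
      "\<And>j. (\<Sum>i\<in>Om n. matrix_pow (Om n) (column_gram (\<lambda>i j. V n $$ (i, j)) (T n)) j i i) = (\<Sum>x\<in>#E'. of_real (x ^ j))"
      "length (take (min (card (T n)) (card (Om n))) (singular_values (submatrix (V n) (Om n) (T n)))) = min (card (T n)) (card (Om n))"
      "\<And>f. (\<Sum>x\<leftarrow>take (min (card (T n)) (card (Om n))) (singular_values (submatrix (V n) (Om n) (T n))). f x) =
         (\<Sum>x\<in>#E'. f (sqrt x)) - (real (card (Om n)) - real (min (card (T n)) (card (Om n)))) * f 0"
    then show "\<exists>E. good n E"
      unfolding good_def xs_def r_def by blast
  qed
  have E01: "\<And>n x. n \<ge> 1 \<Longrightarrow> x \<in># E n \<Longrightarrow> 0 \<le> x \<and> x \<le> 1"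
    and mom: "\<And>n j. n \<ge> 1 \<Longrightarrow> (\<Sum>i\<in>Om n. matrix_pow (Om n) (column_gram (\<lambda>i j. V n $$ (i, j)) (T n)) j i i) = (\<Sum>x\<in>#E n. of_real (x ^ j))"
    and len: "\<And>n. n \<ge> 1 \<Longrightarrow> length (xs n) = r n"
    and sums: "\<And>n f. n \<ge> 1 \<Longrightarrow> (\<Sum>x\<leftarrow>xs n. f x) = (\<Sum>x\<in>#E n. f (sqrt x)) - (real (card (Om n)) - real (r n)) * f 0"
    using good unfolding good_def by blast+
  have size: "size (E n) \<le> n" if n: "n \<ge> 1" for n
  proof -
    have "complex_of_nat (card (Om n)) = (\<Sum>x\<in>#E n. 1)" using mom[OF n, of 0] by simp
    then have "complex_of_nat (card (Om n)) = complex_of_nat (size (E n))" by simp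
    then have "card (Om n) = size (E n)" by (simp only: of_nat_eq_iff)
    then show ?thesis using card_mono[OF _ Om[OF n]] by simp
  qed
  let ?tr = "\<lambda>k n. \<Sum>x<n. matrix_pow {..<n} (centered_product n (\<lambda>i j. V n $$ (i, j))
        (\<lambda>i. indicator (Om n) i - \<alpha>) (\<lambda>t. indicator (T n) t - \<beta>)) k x x"
  have cheb: "(\<lambda>n. (\<Sum>x\<in>#E n. centered_cheb c D k x) / n) \<longlonglongrightarrow> limit_functional (centered_cheb c D k)" for k
  proof -
    have tr: "(\<lambda>n. ?tr k n / of_nat n) \<longlonglongrightarrow> of_bool (k = 0)"
    proof (cases "k = 0")
      case True
      have "(\<lambda>n. ?tr k n / of_nat n) \<longlonglongrightarrow> 1"
      proof (rule tendsto_eventually)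
        show "eventually (\<lambda>n. ?tr k n / of_nat n = 1) sequentially"
          using eventually_ge_at_top[of 1] by eventually_elim (simp add: True)
      qed
      then show ?thesis using True by simp
    next
      case False
      then show ?thesis using trace[of k] by (simp add: ab)
    qed
    \<comment> \<open>The trace formula solved for the Chebyshev average, with all sizes divided by
      n.\<close>
    define G where "G n = ?tr k n / of_nat n - of_real ((\<alpha> * \<beta>) ^ k) * (1 - of_real (card (T n) / n) - of_real (card (Om n) / n))
        - of_real ((- \<alpha> * (1 - \<beta>)) ^ k) * (of_real (card (T n) / n) - of_real (card (Om n) / n))" for n
    have "G \<longlonglongrightarrow> of_bool (k = 0) - of_real ((\<alpha> * \<beta>) ^ k) * (1 - of_real \<beta> - of_real \<alpha>)
        - of_real ((- \<alpha> * (1 - \<beta>)) ^ k) * (of_real \<beta> - of_real \<alpha>)"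
      unfolding G_def using card_Om card_T by (intro tendsto_intros tr) (simp_all add: ab)
    also have "of_bool (k = 0) - of_real ((\<alpha> * \<beta>) ^ k) * (1 - of_real \<beta> - of_real \<alpha>)
        - of_real ((- \<alpha> * (1 - \<beta>)) ^ k) * (of_real \<beta> - of_real \<alpha>) = complex_of_real (limit_functional (centered_cheb c D k))"
      unfolding limit_functional_def integral_spectral_cheb[OF ab] by (simp add: algebra_simps)
    finally have lim: "G \<longlonglongrightarrow> complex_of_real (limit_functional (centered_cheb c D k))" .
    have G_eq: "G n = complex_of_real ((\<Sum>x\<in>#E n. centered_cheb c D k x) / n)" if n: "n \<ge> 1" for n
    proof -
      have t: "?tr k n = (\<Sum>x\<in>#E n. of_real (centered_cheb c D k x))
         + of_real ((\<alpha> * \<beta>) ^ k) * (of_nat n - of_nat (card (T n)) - of_nat (card (Om n)))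
         + of_real ((- \<alpha> * (1 - \<beta>)) ^ k) * (of_nat (card (T n)) - of_nat (card (Om n)))"
        by (rule trace_centered_product_power[OF unitary_group_imp_unitary_on[OF V[OF n]] Om[OF n] T[OF n] ab(3,4) mom[OF n]])
      have s: "(\<Sum>x\<in>#E n. complex_of_real (centered_cheb c D k x)) = of_real (\<Sum>x\<in>#E n. centered_cheb c D k x)"
      proof -
        have "(\<Sum>x\<in>#F. complex_of_real (f x)) = of_real (\<Sum>x\<in>#F. f x)" for F :: "real multiset" and f
          by (induction F) simp_all
        then show ?thesis .
      qed
      have gen: "(s + a * (m - x - y) + b * (x - y)) / m - a * (1 - x / m - y / m) - b * (x / m - y / m) = s / m"
        if "m \<noteq> 0" for s a b m x y :: complex
        using that by (simp add: field_simps)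
      have "G n = of_real (\<Sum>x\<in>#E n. centered_cheb c D k x) / of_nat n"
        unfolding G_def t s using gen[of "of_nat n"] n by simp
      then show ?thesis by simp
    qed
    have "(\<lambda>n. complex_of_real ((\<Sum>x\<in>#E n. centered_cheb c D k x) / n)) \<longlonglongrightarrow> complex_of_real (limit_functional (centered_cheb c D k))"
    proof (rule Lim_transform_eventually[OF lim])
      show "eventually (\<lambda>n. G n = complex_of_real ((\<Sum>x\<in>#E n. centered_cheb c D k x) / n)) sequentially"
        using eventually_ge_at_top[of 1] by eventually_elim (rule G_eq)
    qed
    then show ?thesis by (simp only: tendsto_of_real_iff)
  qed
  have r: "(\<lambda>n. r n / n) \<longlonglongrightarrow> 1 - max p q"
  proof -
    have "(\<lambda>n. min (card (T n) / n) (card (Om n) / n)) \<longlonglongrightarrow> min (1 - p) (1 - q)"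
      by (intro tendsto_min card_T card_Om)
    moreover have "min (card (T n) / n) (card (Om n) / n) = r n / n" for n
      by (cases "n = 0") (auto simp: r_def min_def divide_le_cancel)
    moreover have "min (1 - p) (1 - q) = 1 - max p q" by (simp add: min_def max_def)
    ultimately show ?thesis by simp
  qed
  have "weak_conv_m (\<lambda>n. empirical_distribution (xs n)) (fs_measure p q)"
    by (rule weak_conv_empirical[OF E01 size cheb card_Om r len sums])
  then show ?thesis by (simp only: xs_def)
qed

end

context prob_space
begin

text \<open>The values of \<open>S\<close> carry the discrete \<sigma>-algebra, so every function
  \<open>g\<close> of the index sets is admissible.\<close>

lemma indep_var_if_indep_vimage_algebras:
  fixes f :: "'x \<Rightarrow> complex" and g :: "'s \<Rightarrow> complex"
  assumes X: "X \<in> measurable M N"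
    and indep: "indep_set (sets (vimage_algebra (space M) X N)) (sets (vimage_algebra (space M) S (count_space UNIV)))"
    and f: "f \<in> borel_measurable N"
  shows "indep_var borel (\<lambda>\<omega>. f (X \<omega>)) borel (\<lambda>\<omega>. g (S \<omega>))"
proof -
  let ?VX = "vimage_algebra (space M) X N" and ?VS = "vimage_algebra (space M) S (count_space UNIV)"
  have fX: "(\<lambda>\<omega>. f (X \<omega>)) -` A \<inter> space M \<in> sets ?VX" if "A \<in> sets borel" for A
  proof -
    have "(\<lambda>\<omega>. f (X \<omega>)) -` A \<inter> space M = X -` (f -` A \<inter> space N) \<inter> space M"
      using measurable_space[OF X] by auto
    then show ?thesis using measurable_sets[OF f that] by (simp only: in_vimage_algebra)
  qed
  have gS: "(\<lambda>\<omega>. g (S \<omega>)) -` A \<inter> space M \<in> sets ?VS" for A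
  proof -
    have "(\<lambda>\<omega>. g (S \<omega>)) -` A \<inter> space M = S -` (g -` A) \<inter> space M" by auto
    then show ?thesis by (simp add: in_vimage_algebra)
  qed
  have m1: "(\<lambda>\<omega>. f (X \<omega>)) \<in> borel_measurable M" by (rule measurable_compose[OF X f])
  have m2: "(\<lambda>\<omega>. g (S \<omega>)) \<in> borel_measurable M"
    using indep_setD_ev2[OF indep] gS by (intro measurableI) auto
  have s1: "sigma_sets (space M) {(\<lambda>\<omega>. f (X \<omega>)) -` A \<inter> space M |A. A \<in> sets borel} \<subseteq> sets ?VX"
    using sets.sigma_sets_subset[of "{(\<lambda>\<omega>. f (X \<omega>)) -` A \<inter> space M |A. A \<in> sets borel}" ?VX] fX by auto
  have s2: "sigma_sets (space M) {(\<lambda>\<omega>. g (S \<omega>)) -` A \<inter> space M |A. A \<in> sets borel} \<subseteq> sets ?VS"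
    using sets.sigma_sets_subset[of "{(\<lambda>\<omega>. g (S \<omega>)) -` A \<inter> space M |A. A \<in> sets borel}" ?VS] gS by auto
  have "indep_set (sigma_sets (space M) {(\<lambda>\<omega>. f (X \<omega>)) -` A \<inter> space M |A. A \<in> sets borel})
      (sigma_sets (space M) {(\<lambda>\<omega>. g (S \<omega>)) -` A \<inter> space M |A. A \<in> sets borel})"
  proof (rule indep_setI)
    show "sigma_sets (space M) {(\<lambda>\<omega>. f (X \<omega>)) -` A \<inter> space M |A. A \<in> sets borel} \<subseteq> events"
      using s1 indep_setD_ev1[OF indep] by (rule order_trans)
    show "sigma_sets (space M) {(\<lambda>\<omega>. g (S \<omega>)) -` A \<inter> space M |A. A \<in> sets borel} \<subseteq> events"
      using s2 indep_setD_ev2[OF indep] by (rule order_trans)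
  qed (use s1 s2 indep_setD[OF indep] in blast)
  then show ?thesis unfolding indep_var_eq using m1 m2 by blast
qed

end

text \<open>
  The factor 16 makes the tail bound of \<open>haar_entry_tail\<close> of order \<open>n\<^sup>-\<^sup>4\<close>, so that it remains summable
  after the union bound over all \<open>n\<^sup>2\<close> entries.
\<close>

definition flatness :: "nat \<Rightarrow> real" where
  "flatness n = sqrt ((16 * ln (real n) + 1) / real n)"

lemma flatness_nonneg: "0 \<le> flatness n"
  by (cases "n = 0") (auto simp: flatness_def)

lemma flatness_square: "n \<ge> 1 \<Longrightarrow> (flatness n)\<^sup>2 = (16 * ln (real n) + 1) / real n"
  by (simp add: flatness_def)

lemma summable_log_power_over_square:
  assumes k: "k \<ge> 1"
  shows "summable (\<lambda>n. (16 * ln (real (Suc n)) + 1) ^ (2 * k) / real (Suc n) ^ 2)"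
proof -
  \<comment> \<open>Chosen so that the logarithmic factor is bounded by a multiple of x powr (1 /
    2), which leaves the summable exponent - 3 / 2.\<close>
  define a where "a = 1 / (4 * real k)"
  have a: "0 < a" "a * real (2 * k) = 1 / 2" using k by (simp_all add: a_def)
  define C where "C = (16 / a + 1) ^ (2 * k)"
  have bound: "(16 * ln x + 1) ^ (2 * k) / x ^ 2 \<le> C * x powr (- 3 / 2)" if x: "1 \<le> x" for x :: real
  proof -
    have "ln x \<le> x powr a / a" using x a by (intro ln_powr_bound)
    moreover have "1 \<le> x powr a" using x a by (simp add: ge_one_powr_ge_zero)
    ultimately have "16 * ln x + 1 \<le> 16 * (x powr a / a) + x powr a" by linarith
    also have "\<dots> = (16 / a + 1) * x powr a" by (simp add: distrib_right)
    finally have "16 * ln x + 1 \<le> (16 / a + 1) * x powr a" .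
    then have "(16 * ln x + 1) ^ (2 * k) \<le> ((16 / a + 1) * x powr a) ^ (2 * k)"
      using x by (intro power_mono) auto
    also have "\<dots> = C * (x powr a) powr real (2 * k)"
    proof -
      have "0 < x powr a" using x by simp
      from powr_realpow[OF this] show ?thesis by (simp only: C_def power_mult_distrib)
    qed
    also have "(x powr a) powr real (2 * k) = x powr (1 / 2)" unfolding powr_powr a(2) ..
    finally have "(16 * ln x + 1) ^ (2 * k) / x ^ 2 \<le> C * x powr (1 / 2) / x ^ 2"
      by (intro divide_right_mono) simp_all
    also have "\<dots> = C * (x powr (1 / 2) / x powr 2)" using x by simp
    also have "x powr (1 / 2) / x powr 2 = x powr (1 / 2 - 2)" by (rule powr_diff[symmetric])
    finally show ?thesis by simp
  qed
  have "summable (\<lambda>n. real n powr (- 3 / 2))" by (simp add: summable_real_powr_iff)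
  then have "summable (\<lambda>n. C * real (Suc n) powr (- 3 / 2))"
    by (intro summable_mult) (subst summable_Suc_iff)
  then show ?thesis
  proof (rule summable_comparison_test')
    fix n :: nat
    have "0 \<le> (16 * ln (real (Suc n)) + 1) ^ (2 * k) / real (Suc n) ^ 2"
      by (intro divide_nonneg_nonneg zero_le_power add_nonneg_nonneg mult_nonneg_nonneg ln_ge_zero) simp_all
    then show "norm ((16 * ln (real (Suc n)) + 1) ^ (2 * k) / real (Suc n) ^ 2) \<le> C * real (Suc n) powr (- 3 / 2)"
      using bound[of "real (Suc n)"] by simp
  qed
qed

lemma summable_inverse_square_Suc: "summable (\<lambda>n. c / real (Suc n) ^ 2)"
proof -
  have "summable (\<lambda>n. c * inverse (real (Suc n) ^ 2))"
    by (intro summable_mult) (subst summable_Suc_iff, rule inverse_power_summable, simp)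
  then show ?thesis by (simp add: divide_inverse)
qed

context prob_space
begin

lemma AE_trace_tendsto_0:
  fixes X :: "nat \<Rightarrow> 'a \<Rightarrow> 'x" and N :: "nat \<Rightarrow> 'x measure" and S :: "nat \<Rightarrow> 'a \<Rightarrow> nat set \<times> nat set"
    and V :: "nat \<Rightarrow> 'x \<Rightarrow> nat \<Rightarrow> nat \<Rightarrow> complex" and \<alpha> \<beta> :: real
  assumes indep: "\<And>n (f :: 'x \<Rightarrow> complex) (g :: nat set \<times> nat set \<Rightarrow> complex). n \<ge> 1 \<Longrightarrow>
      f \<in> borel_measurable (N n) \<Longrightarrow> indep_var borel (\<lambda>\<omega>. f (X n \<omega>)) borel (\<lambda>\<omega>. g (S n \<omega>))"
    and A: "\<And>n. n \<ge> 1 \<Longrightarrow> indep_events (case_sum (\<lambda>i. {\<omega> \<in> space M. i \<in> fst (S n \<omega>)}) (\<lambda>i. {\<omega> \<in> space M. i \<in> snd (S n \<omega>)})) ({..<n} <+> {..<n})"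
    and \<alpha>: "\<And>n i. i < n \<Longrightarrow> prob {\<omega> \<in> space M. i \<in> fst (S n \<omega>)} = \<alpha>"
    and \<beta>: "\<And>n i. i < n \<Longrightarrow> prob {\<omega> \<in> space M. i \<in> snd (S n \<omega>)} = \<beta>"
    and V: "\<And>n i j. n \<ge> 1 \<Longrightarrow> (\<lambda>x. V n x i j) \<in> borel_measurable (N n)"
    and \<kappa>: "\<And>n x i j. i < n \<Longrightarrow> j < n \<Longrightarrow> cmod (V n x i j) \<le> flatness n"
    and k: "k \<ge> 1"
  shows "AE \<omega> in M. (\<lambda>n. (\<Sum>x<n. matrix_pow {..<n} (centered_product n (V n (X n \<omega>))
      (\<lambda>i. indicator (fst (S n \<omega>)) i - \<alpha>) (\<lambda>t. indicator (snd (S n \<omega>)) t - \<beta>)) k x x) / of_nat n) \<longlonglongrightarrow> 0"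
proof -
  define Y where "Y n \<omega> = (\<Sum>x<n. matrix_pow {..<n} (centered_product n (V n (X n \<omega>))
      (\<lambda>i. indicator (fst (S n \<omega>)) i - \<alpha>) (\<lambda>t. indicator (snd (S n \<omega>)) t - \<beta>)) k x x)" for n \<omega>
  note second = trace_second_moment[where X = "X n" and N = "N n" and V = "V n" and S = "S n" and \<kappa> = "flatness n" and n = n and k = k and \<alpha> = \<alpha> and \<beta> = \<beta> for n,
      OF indep A \<alpha> \<beta> V \<kappa> flatness_nonneg _ k, folded Y_def]
  \<comment> \<open>Shifted by one because the moment bounds require n >= 1.\<close>
  define Z where "Z n \<omega> = (cmod (Y (Suc n) \<omega>))\<^sup>2 / real (Suc n) ^ 2" for n \<omega>
  have Zint: "integrable M (Z n)" for n
    unfolding Z_def[abs_def] by (intro integrable_divide_zero second(2)) simp_all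
  have Zbound: "expectation (Z n) \<le> real k ^ (4 * k) * ((16 * ln (real (Suc n)) + 1) ^ (2 * k) / real (Suc n) ^ 2)" for n
  proof -
    let ?n = "real (Suc n)" and ?L = "16 * ln (real (Suc n)) + 1"
    have "expectation (\<lambda>\<omega>. (cmod (Y (Suc n) \<omega>))\<^sup>2) \<le> flatness (Suc n) ^ (4 * k) * (?n ^ k * real k ^ (2 * k))\<^sup>2"
      by (rule second(3)) simp_all
    also have "flatness (Suc n) ^ (4 * k) = (?L / ?n) ^ (2 * k)"
    proof -
      have "flatness (Suc n) ^ (4 * k) = ((flatness (Suc n))\<^sup>2) ^ (2 * k)" by (simp flip: power_mult)
      then show ?thesis by (simp add: flatness_square)
    qed
    \<comment> \<open>Here the powers of n cancel; only logarithms remain, and the division by n^2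
      is left over for summability.\<close>
    also have "(?L / ?n) ^ (2 * k) * (?n ^ k * real k ^ (2 * k))\<^sup>2 = real k ^ (4 * k) * ?L ^ (2 * k)"
    proof -
      have "(?n ^ k * real k ^ (2 * k))\<^sup>2 = ?n ^ (2 * k) * real k ^ (4 * k)"
        by (simp add: power_mult_distrib mult.commute flip: power_mult)
      then show ?thesis by (simp add: power_divide)
    qed
    finally have "expectation (\<lambda>\<omega>. (cmod (Y (Suc n) \<omega>))\<^sup>2) / ?n ^ 2 \<le> real k ^ (4 * k) * ?L ^ (2 * k) / ?n ^ 2"
      by (intro divide_right_mono) simp_all
    then show ?thesis by (simp add: Z_def[abs_def])
  qed
  have "AE \<omega> in M. (\<lambda>n. Z n \<omega>) \<longlonglongrightarrow> 0"
  proof (rule AE_tendsto_0_if_summable_moments)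
    show "Z n \<in> borel_measurable M" for n using Zint by (rule borel_measurable_integrable)
    show "0 \<le> Z n \<omega>" for n \<omega> by (simp add: Z_def)
    show "integrable M (Z n)" for n by (rule Zint)
    have "summable (\<lambda>n. real k ^ (4 * k) * ((16 * ln (real (Suc n)) + 1) ^ (2 * k) / real (Suc n) ^ 2))"
      by (intro summable_mult summable_log_power_over_square k)
    then show "summable (\<lambda>n. expectation (Z n))"
    proof (rule summable_comparison_test')
      fix n :: nat
      have "0 \<le> expectation (Z n)" by (intro integral_nonneg_AE) (simp add: Z_def)
      then show "norm (expectation (Z n)) \<le> real k ^ (4 * k) * ((16 * ln (real (Suc n)) + 1) ^ (2 * k) / real (Suc n) ^ 2)"
        using Zbound[of n] by simp
    qed
  qed
  then show ?thesis
    unfolding Y_def[symmetric]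
  proof eventually_elim
    case (elim \<omega>)
    have "(\<lambda>n. sqrt (Z n \<omega>)) \<longlonglongrightarrow> sqrt 0" by (rule tendsto_real_sqrt[OF elim])
    moreover have "sqrt (Z n \<omega>) = norm (Y (Suc n) \<omega> / of_nat (Suc n))" for n
      by (simp add: Z_def real_sqrt_divide norm_divide del: of_nat_Suc)
    ultimately have "(\<lambda>n. norm (Y (Suc n) \<omega> / of_nat (Suc n))) \<longlonglongrightarrow> 0" by simp
    then have "(\<lambda>n. Y (Suc n) \<omega> / of_nat (Suc n)) \<longlonglongrightarrow> 0" by (rule tendsto_norm_zero_cancel)
    then show ?case by (rule LIMSEQ_imp_Suc)
  qed
qed

text \<open>The injection \<open>h\<close> selects the row or the column events from one joint
  independent family, so both cardinalities are covered.\<close>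

lemma AE_card_tendsto:
  fixes A :: "nat \<Rightarrow> 'i \<Rightarrow> 'a set" and C :: "nat \<Rightarrow> 'a \<Rightarrow> nat set"
  assumes A: "\<And>n. n \<ge> 1 \<Longrightarrow> indep_events (A n) (I n)" and I: "\<And>n. finite (I n)"
    and h: "inj h" "\<And>n. h ` {..<n} \<subseteq> I n" and \<alpha>: "\<And>n i. i < n \<Longrightarrow> prob (A n (h i)) = \<alpha>"
    and C: "\<And>n \<omega>. n \<ge> 1 \<Longrightarrow> \<omega> \<in> space M \<Longrightarrow> C n \<omega> \<subseteq> {..<n}"
    and AC: "\<And>n i \<omega>. \<omega> \<in> space M \<Longrightarrow> \<omega> \<in> A n (h i) \<longleftrightarrow> i \<in> C n \<omega>"
  shows "AE \<omega> in M. (\<lambda>n. card (C n \<omega>) / n) \<longlonglongrightarrow> \<alpha>"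
proof -
  define Y where "Y n \<omega> = (\<Sum>i<n. indicator (A n (h i)) \<omega> - \<alpha>) ^ 4" for n \<omega>
  note fourth = fourth_moment_centered_sum[where A = "A n" and I = "I n" and h = h and n = n and \<alpha> = \<alpha> for n,
      OF A I h _ \<alpha>, folded Y_def]
  define Z where "Z n \<omega> = Y (Suc n) \<omega> / real (Suc n) ^ 4" for n \<omega>
  have Zint: "integrable M (Z n)" for n
    unfolding Z_def[abs_def] by (intro integrable_divide_zero) (use fourth(2)[of "Suc n"] in \<open>simp add: Y_def[abs_def]\<close>)
  have "AE \<omega> in M. (\<lambda>n. Z n \<omega>) \<longlonglongrightarrow> 0"
  proof (rule AE_tendsto_0_if_summable_moments)
    show "Z n \<in> borel_measurable M" for n using Zint by (rule borel_measurable_integrable)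
    show nn: "0 \<le> Z n \<omega>" for n \<omega> by (simp add: Z_def Y_def)
    show "integrable M (Z n)" for n by (rule Zint)
    show "summable (\<lambda>n. expectation (Z n))"
    proof (rule summable_comparison_test'[OF summable_inverse_square_Suc[of 16]])
      fix n :: nat
      have "expectation (Y (Suc n)) \<le> 16 * real (Suc n) ^ 2"
        using fourth(3)[of "Suc n"] by (simp add: Y_def[abs_def])
      then have "expectation (Y (Suc n)) / real (Suc n) ^ 4 \<le> 16 * real (Suc n) ^ 2 / real (Suc n) ^ 4"
        by (intro divide_right_mono) simp_all
      also have "\<dots> = 16 / real (Suc n) ^ 2"
        by (simp add: field_simps flip: power_add del: of_nat_Suc)
      finally have "expectation (Z n) \<le> 16 / real (Suc n) ^ 2" by (simp add: Z_def[abs_def])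
      moreover have "0 \<le> expectation (Z n)" by (intro integral_nonneg_AE) (simp add: nn)
      ultimately show "norm (expectation (Z n)) \<le> 16 / real (Suc n) ^ 2" by simp
    qed
  qed
  moreover have "AE \<omega> in M. \<omega> \<in> space M" by (rule AE_space)
  ultimately show ?thesis
  proof eventually_elim
    case (elim \<omega>)
    have Zn: "Z n \<omega> = (card (C (Suc n) \<omega>) / real (Suc n) - \<alpha>) ^ 4" for n
    proof -
      have "(\<Sum>i<Suc n. indicator (A (Suc n) (h i)) \<omega> :: real) = (\<Sum>i\<in>{..<Suc n}. if i \<in> C (Suc n) \<omega> then 1 else 0)"
        using AC[OF elim(2)] by (intro sum.cong) (auto simp: indicator_def)
      also have "\<dots> = card (C (Suc n) \<omega>)"
        using C[OF _ elim(2), of "Suc n"] by (simp add: sum.If_cases Int_absorb1 del: sum_of_bool_eq sum.lessThan_Suc)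
      finally have "(\<Sum>i<Suc n. indicator (A (Suc n) (h i)) \<omega> - \<alpha>) = card (C (Suc n) \<omega>) - real (Suc n) * \<alpha>"
        by (simp only: sum_subtractf) simp
      then show ?thesis
        unfolding Z_def Y_def by (simp only: power_divide[symmetric] diff_divide_distrib) simp
    qed
    have "(\<lambda>n. sqrt (sqrt (Z n \<omega>))) \<longlonglongrightarrow> sqrt (sqrt 0)" by (intro tendsto_real_sqrt elim(1))
    moreover have "sqrt (sqrt (x ^ 4)) = \<bar>x\<bar>" for x :: real
    proof -
      have "x ^ 4 = (x\<^sup>2)\<^sup>2" by simp
      then show ?thesis by (simp only: real_sqrt_abs) simp
    qed
    ultimately have "(\<lambda>n. \<bar>card (C (Suc n) \<omega>) / real (Suc n) - \<alpha>\<bar>) \<longlonglongrightarrow> 0" unfolding Zn by simp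
    then have "(\<lambda>n. card (C (Suc n) \<omega>) / real (Suc n) - \<alpha>) \<longlonglongrightarrow> 0" by (rule tendsto_rabs_zero_cancel)
    then have "(\<lambda>n. card (C (Suc n) \<omega>) / real (Suc n)) \<longlonglongrightarrow> \<alpha>" by (simp only: LIM_zero_iff)
    then show ?case by (rule LIMSEQ_imp_Suc)
  qed
qed

text \<open>Borel-Cantelli in the summable direction, which tolerates any dependence between
  different n.\<close>

lemma AE_haar_flat:
  fixes U :: "nat \<Rightarrow> 'a \<Rightarrow> complex mat"
  assumes U: "\<And>n. n \<ge> 1 \<Longrightarrow> U n \<in> measurable M (unitary_space n)"
    and haar: "\<And>n. n \<ge> 1 \<Longrightarrow> haar_unitary n (distr M (unitary_space n) (U n))"
  shows "AE \<omega> in M. eventually (\<lambda>n. \<forall>i<n. \<forall>j<n. cmod (U n \<omega> $$ (i, j)) \<le> flatness n) sequentially"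
proof -
  define B where "B n i j = {\<omega> \<in> space M. flatness n < cmod (U n \<omega> $$ (i, j))}" for n i j
  have B: "B n i j \<in> events" "prob (B n i j) \<le> 4 / real n ^ 4" if n: "n \<ge> 1" and ij: "i < n" "j < n" for n i j
  proof -
    let ?H = "{A \<in> unitary_group n. flatness n < cmod (A $$ (i, j))}"
    have "(\<lambda>A. cmod (A $$ (i, j))) \<in> borel_measurable (unitary_space n)"
      using measurable_unitary_space_entry[OF ij] by measurable
    then have "{A \<in> space (unitary_space n). flatness n < cmod (A $$ (i, j))} \<in> sets (unitary_space n)"
      by measurable
    then have H: "?H \<in> sets (unitary_space n)" by simp
    have BH: "B n i j = U n -` ?H \<inter> space M"
      using measurable_space[OF U[OF n]] by (auto simp: B_def)
    show "B n i j \<in> events" unfolding BH by (rule measurable_sets[OF U[OF n] H])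
    have "prob (B n i j) = measure (distr M (unitary_space n) (U n)) ?H"
      unfolding BH by (rule measure_distr[OF U[OF n] H, symmetric])
    also have "\<dots> \<le> 4 * exp (- (real n * (flatness n)\<^sup>2 / 4))"
      by (rule haar_entry_tail[OF haar[OF n] ij flatness_nonneg])
    also have "real n * (flatness n)\<^sup>2 / 4 = 4 * ln (real n) + 1 / 4"
      using n by (simp add: flatness_square field_simps)
    also have "4 * exp (- (4 * ln (real n) + 1 / 4)) \<le> 4 * exp (- (4 * ln (real n)))" by simp
    also have "exp (- (4 * ln (real n))) = 1 / real n ^ 4"
    proof -
      have "exp (4 * ln (real n)) = exp (ln (real n)) ^ 4" using exp_of_nat_mult[of 4 "ln (real n)"] by simp
      then show ?thesis using n by (simp add: exp_minus inverse_eq_divide)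
    qed
    finally show "prob (B n i j) \<le> 4 / real n ^ 4" by simp
  qed
  define D where "D n = (\<Union>i<Suc n. \<Union>j<Suc n. B (Suc n) i j)" for n
  have D: "D n \<in> events" for n unfolding D_def using B(1)[of "Suc n"] by (intro sets.finite_UN) auto
  have prob_D: "prob (D n) \<le> 4 / real (Suc n) ^ 2" for n
  proof -
    have "prob (D n) \<le> (\<Sum>i<Suc n. prob (\<Union>j<Suc n. B (Suc n) i j))"
      unfolding D_def using B(1)[of "Suc n"]
      by (intro finite_measure_subadditive_finite) (auto intro!: sets.finite_UN)
    also have "\<dots> \<le> (\<Sum>i<Suc n. \<Sum>j<Suc n. prob (B (Suc n) i j))"
      using B(1)[of "Suc n"] by (intro sum_mono finite_measure_subadditive_finite) auto
    also have "\<dots> \<le> (\<Sum>i<Suc n. \<Sum>j<Suc n. 4 / real (Suc n) ^ 4)"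
      using B(2)[of "Suc n"] by (intro sum_mono) auto
    also have "\<dots> = real (Suc n) ^ 2 * (4 / real (Suc n) ^ 4)"
      by (simp add: power2_eq_square del: sum.lessThan_Suc)
    also have "\<dots> = 4 / real (Suc n) ^ 2"
    proof -
      have "x ^ 2 * (4 / x ^ 4) = 4 / x ^ 2" if "x \<noteq> 0" for x :: real
        using that by (simp add: field_simps flip: power_add)
      then show ?thesis by simp
    qed
    finally show ?thesis .
  qed
  have "AE \<omega> in M. eventually (\<lambda>n. \<omega> \<in> space M - D n) sequentially"
  proof (rule borel_cantelli_AE1)
    show "D n \<in> sets M" for n by (rule D)
    show "emeasure M (D n) < \<infinity>" for n by (simp add: less_top[symmetric])
    show "summable (\<lambda>n. measure M (D n))"
      by (rule summable_comparison_test'[OF summable_inverse_square_Suc[of 4]]) (use prob_D in simp)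
  qed
  then show ?thesis
  proof eventually_elim
    case (elim \<omega>)
    then have "eventually (\<lambda>n. \<forall>i<Suc n. \<forall>j<Suc n. cmod (U (Suc n) \<omega> $$ (i, j)) \<le> flatness (Suc n)) sequentially"
      by eventually_elim (auto simp: D_def B_def not_less)
    then show ?case by (simp only: eventually_sequentially_Suc[where P = "\<lambda>n. \<forall>i<n. \<forall>j<n. cmod (U n \<omega> $$ (i, j)) \<le> flatness n"])
  qed
qed

end

theorem corollary3p3:
  fixes p q :: real
    and M :: "'w measure"
    and \<Omega> T :: "nat \<Rightarrow> 'w \<Rightarrow> nat set"
    and U :: "nat \<Rightarrow> 'w \<Rightarrow> complex mat"
  assumes p: "0 < p" "p < 1"
    and q: "0 < q" "q < 1"
    and M: "prob_space M"
    and \<Omega>_subset: "\<And>n \<omega>. n \<ge> 1 \<Longrightarrow> \<omega> \<in> space M \<Longrightarrow> \<Omega> n \<omega> \<subseteq> {..<n}"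
    and T_subset: "\<And>n \<omega>. n \<ge> 1 \<Longrightarrow> \<omega> \<in> space M \<Longrightarrow> T n \<omega> \<subseteq> {..<n}"
    and \<Omega>_prob: "\<And>n i. i < n \<Longrightarrow> measure M {\<omega> \<in> space M. i \<in> \<Omega> n \<omega>} = 1 - q"
    and T_prob: "\<And>n i. i < n \<Longrightarrow> measure M {\<omega> \<in> space M. i \<in> T n \<omega>} = 1 - p"
    and \<Omega>_T_indep: "\<And>n. n \<ge> 1 \<Longrightarrow>
      prob_space.indep_events M
        (case_sum (\<lambda>i. {\<omega> \<in> space M. i \<in> \<Omega> n \<omega>}) (\<lambda>i. {\<omega> \<in> space M. i \<in> T n \<omega>}))
        ({..<n} <+> {..<n})"
    and U_measurable: "\<And>n. n \<ge> 1 \<Longrightarrow> U n \<in> measurable M (unitary_space n)"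
    and U_haar: "\<And>n. n \<ge> 1 \<Longrightarrow> haar_unitary n (distr M (unitary_space n) (U n))"
    and U_indep: "\<And>n. n \<ge> 1 \<Longrightarrow>
      prob_space.indep_set M
        (sets (vimage_algebra (space M) (U n) (unitary_space n)))
        (sets (vimage_algebra (space M) (\<lambda>\<omega>. (\<Omega> n \<omega>, T n \<omega>)) (count_space UNIV)))"
  shows "(AE \<omega> in M. weak_conv_m
            (\<lambda>n. empirical_distribution
               (take (min (card (T n \<omega>)) (card (\<Omega> n \<omega>)))
                 (singular_values (submatrix (dft_mat n) (\<Omega> n \<omega>) (T n \<omega>)))))
            (fs_measure p q)) \<and>
         (AE \<omega> in M. weak_conv_m
            (\<lambda>n. empirical_distribution
               (take (min (card (T n \<omega>)) (card (\<Omega> n \<omega>)))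
                 (singular_values (submatrix (U n \<omega>) (\<Omega> n \<omega>) (T n \<omega>)))))
            (fs_measure p q))"
proof -
  interpret prob_space M by (rule M)
  interpret wachter_parameters p q by unfold_locales (fact p q)+
  let ?tr = "\<lambda>V k n \<omega>. \<Sum>x<n. matrix_pow {..<n} (centered_product n V
      (\<lambda>i. indicator (\<Omega> n \<omega>) i - (1 - q)) (\<lambda>t. indicator (T n \<omega>) t - (1 - p))) k x x"
  have card_\<Omega>: "AE \<omega> in M. (\<lambda>n. card (\<Omega> n \<omega>) / n) \<longlonglongrightarrow> 1 - q"
    by (rule AE_card_tendsto[OF \<Omega>_T_indep, where h = Inl]) (auto simp: \<Omega>_prob \<Omega>_subset inj_on_def dest: \<Omega>_subset)
  have card_T: "AE \<omega> in M. (\<lambda>n. card (T n \<omega>) / n) \<longlonglongrightarrow> 1 - p"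
    by (rule AE_card_tendsto[OF \<Omega>_T_indep, where h = Inr]) (auto simp: T_prob T_subset inj_on_def dest: T_subset)
  have in_space: "AE \<omega> in M. \<omega> \<in> space M" by (rule AE_space)
  have flat: "AE \<omega> in M. eventually (\<lambda>n. \<forall>i<n. \<forall>j<n. cmod (U n \<omega> $$ (i, j)) \<le> flatness n) sequentially"
    by (rule AE_haar_flat[OF U_measurable U_haar])
  \<comment> \<open>The matrix \<open>V n A\<close> may depend on the Haar matrix: it is constant in
    the Fourier case and a truncation in the Haar case.\<close>
  have trace: "AE \<omega> in M. \<forall>k\<ge>1. (\<lambda>n. ?tr (V n (U n \<omega>)) k n \<omega> / of_nat n) \<longlonglongrightarrow> 0"
    if V: "\<And>n i j. n \<ge> 1 \<Longrightarrow> (\<lambda>A. V n A i j) \<in> borel_measurable (unitary_space n)"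
      and \<kappa>: "\<And>n A i j. i < n \<Longrightarrow> j < n \<Longrightarrow> cmod (V n A i j) \<le> flatness n"
    for V :: "nat \<Rightarrow> complex mat \<Rightarrow> nat \<Rightarrow> nat \<Rightarrow> complex"
    unfolding AE_all_countable
  proof (intro allI AE_impI)
    fix k :: nat assume k: "1 \<le> k"
    have "AE \<omega> in M. (\<lambda>n. (\<Sum>x<n. matrix_pow {..<n} (centered_product n (V n (U n \<omega>))
        (\<lambda>i. indicator (fst (\<Omega> n \<omega>, T n \<omega>)) i - (1 - q)) (\<lambda>t. indicator (snd (\<Omega> n \<omega>, T n \<omega>)) t - (1 - p))) k x x) / of_nat n) \<longlonglongrightarrow> 0"
    proof (rule AE_trace_tendsto_0[where S = "\<lambda>n \<omega>. (\<Omega> n \<omega>, T n \<omega>)" and N = unitary_space and X = U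
          and V = V and \<alpha> = "1 - q" and \<beta> = "1 - p" and k = k])
      fix n :: nat and f :: "complex mat \<Rightarrow> complex" and g :: "nat set \<times> nat set \<Rightarrow> complex"
      assume "1 \<le> n" "f \<in> borel_measurable (unitary_space n)"
      then show "indep_var borel (\<lambda>\<omega>. f (U n \<omega>)) borel (\<lambda>\<omega>. g (\<Omega> n \<omega>, T n \<omega>))"
        by (intro indep_var_if_indep_vimage_algebras[OF U_measurable U_indep])
    next
      fix n :: nat assume "1 \<le> n"
      then show "indep_events (case_sum (\<lambda>i. {\<omega> \<in> space M. i \<in> fst (\<Omega> n \<omega>, T n \<omega>)})
          (\<lambda>i. {\<omega> \<in> space M. i \<in> snd (\<Omega> n \<omega>, T n \<omega>)})) ({..<n} <+> {..<n})"
        unfolding fst_conv snd_conv by (rule \<Omega>_T_indep)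
    next
      fix n i :: nat assume "i < n"
      then show "prob {\<omega> \<in> space M. i \<in> fst (\<Omega> n \<omega>, T n \<omega>)} = 1 - q"
        "prob {\<omega> \<in> space M. i \<in> snd (\<Omega> n \<omega>, T n \<omega>)} = 1 - p"
        unfolding fst_conv snd_conv by (fact \<Omega>_prob T_prob)+
    qed (fact V \<kappa> k)+
    then show "AE \<omega> in M. (\<lambda>n. ?tr (V n (U n \<omega>)) k n \<omega> / of_nat n) \<longlonglongrightarrow> 0"
      unfolding fst_conv snd_conv .
  qed
  have "AE \<omega> in M. \<forall>k\<ge>1. (\<lambda>n. ?tr (dft_entry n) k n \<omega> / of_nat n) \<longlonglongrightarrow> 0"
  proof (rule trace[of "\<lambda>n A. dft_entry n"])
    fix n i j :: nat assume "i < n" "j < n"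
    \<comment> \<open>The summand 1 in \<open>flatness\<close> secures this at n = 1, where the
      logarithm vanishes.\<close>
    then have "1 / real n \<le> (16 * ln (real n) + 1) / real n"
      by (intro divide_right_mono) auto
    then have "sqrt (1 / real n) \<le> flatness n"
      unfolding flatness_def by (rule real_sqrt_le_mono)
    then show "cmod (dft_entry n i j) \<le> flatness n"
      by (simp add: norm_dft_entry real_sqrt_divide)
  qed simp
  with card_\<Omega> card_T in_space have dft: "AE \<omega> in M. weak_conv_m
            (\<lambda>n. empirical_distribution
               (take (min (card (T n \<omega>)) (card (\<Omega> n \<omega>)))
                 (singular_values (submatrix (dft_mat n) (\<Omega> n \<omega>) (T n \<omega>)))))
            (fs_measure p q)"
  proof eventually_elim
    case (elim \<omega>)
    show ?case
    proof (rule weak_conv_submatrix)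
      fix k :: nat assume "k \<ge> 1"
      then have "(\<lambda>n. ?tr (dft_entry n) k n \<omega> / of_nat n) \<longlonglongrightarrow> 0" using elim(4) by blast
      moreover have "?tr (dft_entry n) k n \<omega> = ?tr (\<lambda>i j. dft_mat n $$ (i, j)) k n \<omega>" for n
        by (rule trace_centered_product_cong) (simp add: dft_mat_eq)
      ultimately show "(\<lambda>n. ?tr (\<lambda>i j. dft_mat n $$ (i, j)) k n \<omega> / of_nat n) \<longlonglongrightarrow> 0"
        by (simp only:)
    qed (use elim \<Omega>_subset T_subset dft_mat_unitary in auto)
  qed
  \<comment> \<open>The moment bound asks for small entries at every outcome, so large ones are
    replaced by 0. This may destroy unitarity, but almost surely the result agrees with
    \<open>U n\<close> in the n by n range for all large n. The value 0 outside that range makes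
    every entry measurable.\<close>
  define trunc where "trunc n A i j = (if i < n \<and> j < n \<and> cmod (A $$ (i, j)) \<le> flatness n then A $$ (i, j) else 0)"
    for n and A :: "complex mat" and i j
  have "AE \<omega> in M. \<forall>k\<ge>1. (\<lambda>n. ?tr (trunc n (U n \<omega>)) k n \<omega> / of_nat n) \<longlonglongrightarrow> 0"
  proof (rule trace)
    show "(\<lambda>A. trunc n A i j) \<in> borel_measurable (unitary_space n)" for n i j
    proof (cases "i < n \<and> j < n")
      case True
      then have [measurable]: "(\<lambda>A. A $$ (i, j)) \<in> borel_measurable (unitary_space n)"
        by (intro measurable_unitary_space_entry) auto
      show ?thesis unfolding trunc_def using True by simp
    qed (auto simp: trunc_def)
    show "cmod (trunc n A i j) \<le> flatness n" for n A i j
      by (simp add: trunc_def flatness_nonneg)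
  qed
  with card_\<Omega> card_T in_space flat have "AE \<omega> in M. weak_conv_m
            (\<lambda>n. empirical_distribution
               (take (min (card (T n \<omega>)) (card (\<Omega> n \<omega>)))
                 (singular_values (submatrix (U n \<omega>) (\<Omega> n \<omega>) (T n \<omega>)))))
            (fs_measure p q)"
  proof eventually_elim
    case (elim \<omega>)
    show ?case
    proof (rule weak_conv_submatrix)
      show "U n \<omega> \<in> unitary_group n" if "n \<ge> 1" for n
        using measurable_space[OF U_measurable[OF that] elim(3)] by simp
      fix k :: nat assume "k \<ge> 1"
      then have lim: "(\<lambda>n. ?tr (trunc n (U n \<omega>)) k n \<omega> / of_nat n) \<longlonglongrightarrow> 0" using elim(5) by simp
      show "(\<lambda>n. ?tr (\<lambda>i j. U n \<omega> $$ (i, j)) k n \<omega> / of_nat n) \<longlonglongrightarrow> 0"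
      proof (rule Lim_transform_eventually[OF lim])
        show "eventually (\<lambda>n. ?tr (trunc n (U n \<omega>)) k n \<omega> / of_nat n = ?tr (\<lambda>i j. U n \<omega> $$ (i, j)) k n \<omega> / of_nat n) sequentially"
          using elim(4)
        proof eventually_elim
          case (elim n)
          have "?tr (trunc n (U n \<omega>)) k n \<omega> = ?tr (\<lambda>i j. U n \<omega> $$ (i, j)) k n \<omega>"
            using elim by (intro trace_centered_product_cong) (simp add: trunc_def)
          then show ?case by simp
        qed
      qed
    qed (use elim \<Omega>_subset T_subset in auto)
  qed
  with dft show ?thesis by blast
qed

end
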